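(* One has $\tilde f_{\sigma_0,0}(\mathrm{Sh}(\mathrm H_C))=\mathbb C[L_w\mid w\in\hat S_\infty^*]=\mathcal H_{\mathbb P^1_{\mathbb C}\smallsetminus S}(\sigma_0)$ (equality of subalgebras of $\mathcal O_{hol}(\tilde C)$).
   Context: $S\subset\mathbb P^1_{\mathbb C}$ is a finite set containing $0$ and $\infty$, $C:=\mathbb P^1_{\mathbb C}\smallsetminus S$, $S_\infty:=S\smallsetminus\{\infty\}$; $\hat S_\infty$ is $S_\infty$ viewed as an abstract set of letters $\hat s$, and $\hat S_\infty^*$ is the set of words in these letters. $p:\tilde C\to C$ is a universal cover, $\mathcal O_{hol}(\tilde C)$ the algebra of holomorphic functions on it, $\mathcal O(C)$, $\Omega(C)$ the regular functions and differentials on $C$, and $\mathrm H_C:=\Omega(C)/d\mathcal O(C)$, identified with $\mathbb C\hat S_\infty$ so that $\hat s$ corresponds to the class of $d\log(z-s)$. $\sigma_0:\mathrm H_C\to\Omega(C)$ is the section $\hat s\mapsto d\log(z-s)$ of the projection. For a vector space $V$, $\mathrm{Sh}(V)=\oplus_{n\ge0}V^{\otimes n}$ with shuffle product, $[v_1|\cdots|v_n]:=v_1\otimes\cdots\otimes v_n$; $[-|-]$ also denotes concatenation; words in $\hat S_\infty$ form a basis of $\mathrm{Sh}(\mathrm H_C)$. $(\sigma_0)_*:\mathrm{Sh}(\mathrm H_C)\to\mathrm{Sh}(\Omega(C))$ is induced by $\sigma_0$. For $x_0\in\tilde C$, $I_{x_0}:\mathrm{Sh}(\Omega(C))\to\mathcal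 O_{hol}(\tilde C)$ is the algebra morphism $[\omega_1|\cdots|\omega_n]\mapsto(x\mapsto\int_{x_0}^x\omega_1\cdots\omega_n)$, the iterated integral being $\int_{0\le t_1\le\cdots\le t_n\le1}\gamma^*\omega_1(t_1)\wedge\cdots\wedge\gamma^*\omega_n(t_n)$ along any path $\gamma$ in $\tilde C$ from $x_0$ to $x$. $\mathcal H_C(\sigma_0):=I_{x_0}((\sigma_0)_*(\mathrm{Sh}(\mathrm H_C)))$, which is independent of $x_0\in\tilde C$. Definition of $\tilde f_{\sigma_0,0}$: let $\mathrm H_C^{(0)}:=\oplus_{s\in S_\infty\smallsetminus\{0\}}\mathbb C\hat s$ and $\mathrm{Sh}^*(\mathrm H_C):=\mathbb C\oplus[\mathrm H_C^{(0)}|\mathrm{Sh}(\mathrm H_C)]$, a subalgebra of $\mathrm{Sh}(\mathrm H_C)$. The algebra morphism $\mathrm{Sh}^*(\mathrm H_C)[X]\to\mathrm{Sh}(\mathrm H_C)$ extending the inclusion by $X\mapsto[\hat0]$ is an isomorphism. Let $\delta>0$ with $]0,\delta[\,\subset C$, fix a connected component $K$ of $p^{-1}(]0,\delta[)$ and let $q_K:\,]0,\delta[\,\to K$ be the inverse of the bijection $p_{|K}$. For $t\in\mathrm{Sh}^*(\mathrm H_C)$, the function $\tilde f^*_{\sigma_0,0}(t):=(z\mapsto\lim_{\epsilon\to0}I_{q_K(\epsilon)}((\sigma_0)_*(t))(z))$ is well-defined and in $\mathcal O_{hol}(\tilde C)$, and $t\mapsto\tilde f^*_{\sigma_0,0}(t)$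 is an algebra morphism. Let $\log\in\mathcal O_{hol}(\tilde C)$ be the function with $d\log=p^*(dz/z)$ restricting on $K$ to the real logarithm of $p$. Then $\tilde f_{\sigma_0,0}:\mathrm{Sh}(\mathrm H_C)\to\mathcal O_{hol}(\tilde C)$ is the algebra morphism extending $\tilde f^*_{\sigma_0,0}$ and such that $[\hat0]\mapsto\log$. For a word $w\in\hat S_\infty^*$, $L_w:=\tilde f_{\sigma_0,0}(w)$ is the hyperlogarithm function associated to $w$, and $\mathbb C[L_w\mid w\in\hat S_\infty^*]$ is the subalgebra generated by these functions. *)

theory Defs
  imports "HOL-Complex_Analysis.Complex_Analysis" "HOL-Library.Poly_Mapping"
begin

section \<open>The punctured projective line\<close>

text \<open>
  The projective line is \<open>complex option\<close>, with \<open>None\<close> the point at infinity.  If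
  \<open>S\<close> contains infinity, its complement is the affine curve \<open>\<complex> - S\<^sub>\<infinity>\<close>; the definitions
  below depend on \<open>S\<close> only through \<open>A = S\<^sub>\<infinity>\<close>.

  Functions on a subset of a type (on \<open>C\<close> or on its universal cover) are represented by
  their extension by zero, so that equality of functions on the subset is equality in HOL.
\<close>

type_synonym proj_line = "complex option"

definition finite_points :: "proj_line set \<Rightarrow> complex set" where
  "finite_points S = {s. Some s \<in> S}"

definition curve :: "complex set \<Rightarrow> complex set" where
  "curve A = - A"

definition regular_functions :: "complex set \<Rightarrow> (complex \<Rightarrow> complex) set" where
  "regular_functions A =
     {g. \<exists>P n. g = (\<lambda>z. if z \<in> curve A then poly P z / (\<Prod>s\<in>A. z - s) ^ n else 0)}"

text \<open>
  \<open>\<Omega>(C)\<close> is free of rank one over \<open>\<O>(C)\<close> with generator \<open>dz\<close>: the differential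
  \<open>g dz\<close> is represented by its coefficient \<open>g\<close>.
\<close>

type_synonym diff_form = "complex \<Rightarrow> complex"

definition regular_forms :: "complex set \<Rightarrow> diff_form set" where
  "regular_forms A = regular_functions A"

definition dlog_form :: "complex set \<Rightarrow> complex \<Rightarrow> diff_form" where
  "dlog_form A s = (\<lambda>z. if z \<in> curve A then 1 / (z - s) else 0)"


section \<open>Holomorphic functions on a universal cover\<close>

definition universal_cover ::
    "'a::topological_space set \<Rightarrow> ('a \<Rightarrow> complex) \<Rightarrow> complex set \<Rightarrow> bool" where
  "universal_cover Ct p C \<longleftrightarrow> covering_space Ct p C \<and> simply_connected Ct"

text \<open>\<open>q\<close> is the inverse of the chart of \<open>Ct\<close> given by the restriction of \<open>p\<close> to \<open>U\<close>.\<close>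

definition cover_chart ::
    "'a::topological_space set \<Rightarrow> ('a \<Rightarrow> complex) \<Rightarrow> 'a set \<Rightarrow> (complex \<Rightarrow> 'a) \<Rightarrow> bool" where
  "cover_chart Ct p U q \<longleftrightarrow>
     openin (top_of_set Ct) U \<and> open (p ` U) \<and> homeomorphism U (p ` U) p q"

definition O_hol :: "'a::topological_space set \<Rightarrow> ('a \<Rightarrow> complex) \<Rightarrow> ('a \<Rightarrow> complex) set" where
  "O_hol Ct p =
     {f. (\<forall>x. x \<notin> Ct \<longrightarrow> f x = 0) \<and>
         (\<forall>x\<in>Ct. \<exists>U q. x \<in> U \<and> cover_chart Ct p U q \<and> (\<lambda>z. f (q z)) holomorphic_on p ` U)}"

text \<open>\<open>df = p\<^sup>*(g dz)\<close>\<close>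

definition has_differential ::
    "'a::topological_space set \<Rightarrow> ('a \<Rightarrow> complex) \<Rightarrow> ('a \<Rightarrow> complex) \<Rightarrow> diff_form \<Rightarrow> bool" where
  "has_differential Ct p f g \<longleftrightarrow>
     (\<forall>x\<in>Ct. \<exists>U q. x \<in> U \<and> cover_chart Ct p U q \<and>
        (\<forall>z\<in>p ` U. ((\<lambda>z. f (q z)) has_field_derivative g z) (at z)))"

definition hol_one :: "'a set \<Rightarrow> 'a \<Rightarrow> complex" where
  "hol_one Ct = (\<lambda>x. if x \<in> Ct then 1 else 0)"

definition hol_subalgebra ::
    "'a::topological_space set \<Rightarrow> ('a \<Rightarrow> complex) \<Rightarrow> ('a \<Rightarrow> complex) set \<Rightarrow> bool" where
  "hol_subalgebra Ct p B \<longleftrightarrow>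
     B \<subseteq> O_hol Ct p \<and> hol_one Ct \<in> B \<and>
     (\<forall>c. \<forall>f\<in>B. (\<lambda>x. c * f x) \<in> B) \<and>
     (\<forall>f\<in>B. \<forall>g\<in>B. (\<lambda>x. f x + g x) \<in> B \<and> (\<lambda>x. f x * g x) \<in> B)"

definition generated_subalgebra ::
    "'a::topological_space set \<Rightarrow> ('a \<Rightarrow> complex) \<Rightarrow> ('a \<Rightarrow> complex) set \<Rightarrow> ('a \<Rightarrow> complex) set" where
  "generated_subalgebra Ct p G = hol_subalgebra Ct p hull G"


section \<open>Shuffle algebras\<close>

text \<open>
  Formal linear combinations of words.  \<open>Sh(H\<^sub>C)\<close> has the words in the letters
  \<open>s \<in> A\<close> as a basis, where the letter \<open>s\<close> is the class of \<open>d log(z - s)\<close>;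
  so it is the space of formal combinations of such words.
\<close>

type_synonym 'b word_comb = "'b list \<Rightarrow>\<^sub>0 complex"

definition scale_comb :: "complex \<Rightarrow> 'b word_comb \<Rightarrow> 'b word_comb" where
  "scale_comb c t = Poly_Mapping.map (\<lambda>a. c * a) t"

definition Sh :: "complex set \<Rightarrow> complex word_comb set" where
  "Sh A = {t. Poly_Mapping.keys t \<subseteq> lists A}"

definition word :: "'b list \<Rightarrow> 'b word_comb" where
  "word w = Poly_Mapping.single w 1"

text \<open>Shuffles of two words, listed with multiplicity.\<close>

fun word_shuffles :: "'b list \<Rightarrow> 'b list \<Rightarrow> 'b list list" where
  "word_shuffles [] v = [v]"
| "word_shuffles (a # u) [] = [a # u]"
| "word_shuffles (a # u) (b # v) =
     map ((#) a) (word_shuffles u (b # v)) @ map ((#) b) (word_shuffles (a # u) v)"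

definition shuffle_prod :: "'b word_comb \<Rightarrow> 'b word_comb \<Rightarrow> 'b word_comb" where
  "shuffle_prod t t' =
     (\<Sum>u\<in>Poly_Mapping.keys t. \<Sum>v\<in>Poly_Mapping.keys t'.
        scale_comb (Poly_Mapping.lookup t u * Poly_Mapping.lookup t' v)
          (\<Sum>w\<leftarrow>word_shuffles u v. word w))"

text \<open>\<open>Sh\<^sup>*(H\<^sub>C)\<close>: the span of the empty word and of the words not starting with \<open>0\<close>.\<close>

definition Sh_star :: "complex set \<Rightarrow> complex word_comb set" where
  "Sh_star A = {t. Poly_Mapping.keys t \<subseteq> insert [] {s # w |s w. s \<in> A - {0} \<and> w \<in> lists A}}"

text \<open>
  \<open>Sh(\<Omega>(C))\<close> is the tensor algebra of \<open>\<Omega>(C)\<close> as a vector space: formal combinations of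
  words \<open>[\<omega>\<^sub>1|\<dots>|\<omega>\<^sub>n]\<close> of forms modulo multilinearity.  Its elements are the classes
  \<open>forms_class A t\<close>.
\<close>

definition multilinear_relations :: "complex set \<Rightarrow> diff_form word_comb set" where
  "multilinear_relations A =
     {word (u @ [\<lambda>z. a * f z + b * g z] @ v)
        - scale_comb a (word (u @ [f] @ v)) - scale_comb b (word (u @ [g] @ v)) |u v f g a b.
      u \<in> lists (regular_forms A) \<and> v \<in> lists (regular_forms A) \<and>
      f \<in> regular_forms A \<and> g \<in> regular_forms A}"

definition forms_class :: "complex set \<Rightarrow> diff_form word_comb \<Rightarrow> diff_form word_comb set" where
  "forms_class A t =
     {t'. Poly_Mapping.keys t' \<subseteq> lists (regular_forms A) \<and>
          t' - t \<in> module.span scale_comb (multilinear_relations A)}"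

definition Sh_forms :: "complex set \<Rightarrow> diff_form word_comb set set" where
  "Sh_forms A = forms_class A ` {t. Poly_Mapping.keys t \<subseteq> lists (regular_forms A)}"

text \<open>The map \<open>(\<sigma>\<^sub>0)\<^sub>* : Sh(H\<^sub>C) \<rightarrow> Sh(\<Omega>(C))\<close> induced by \<open>s \<mapsto> d log(z - s)\<close>.\<close>

definition sigma0_star :: "complex set \<Rightarrow> complex word_comb \<Rightarrow> diff_form word_comb set" where
  "sigma0_star A t =
     forms_class A (\<Sum>w\<in>Poly_Mapping.keys t.
       scale_comb (Poly_Mapping.lookup t w) (word (map (dlog_form A) w)))"


section \<open>Iterated integrals\<close>

definition ordered_simplex :: "nat \<Rightarrow> (nat \<Rightarrow> real) set" where
  "ordered_simplex n =
     {t \<in> {..<n} \<rightarrow>\<^sub>E {0..1}. \<forall>i j. i \<le> j \<longrightarrow> j < n \<longrightarrow> t i \<le> t j}"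

text \<open>
  The integral over \<open>0 \<le> t\<^sub>1 \<le> \<dots> \<le> t\<^sub>n \<le> 1\<close> along a path \<open>c\<close> in \<open>C\<close>, where
  \<open>c\<^sup>*(g dz) = g (c t) c' t dt\<close>; list positions and coordinates are numbered from 0.
\<close>

definition path_iterated_integral :: "(real \<Rightarrow> complex) \<Rightarrow> diff_form list \<Rightarrow> complex" where
  "path_iterated_integral c \<omega>s =
     set_lebesgue_integral (\<Pi>\<^sub>M i\<in>{..<length \<omega>s}. lborel) (ordered_simplex (length \<omega>s))
       (\<lambda>t. \<Prod>i<length \<omega>s. (\<omega>s ! i) (c (t i)) * vector_derivative c (at (t i)))"

text \<open>
  Paths in \<open>Ct\<close> are taken piecewise \<open>C\<^sup>1\<close>, so that forms can be pulled back along them.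
  \<open>valid_path\<close> alone would let the derivative blow up at a break point, where the simplex
  integral need not converge absolutely; hence the boundedness condition, which holds for
  every path with one-sided derivatives continuous up to the break points.  The values of
  \<open>vector_derivative\<close> at the finitely many break points are irrelevant to it.
\<close>

definition cover_path ::
    "'a::topological_space set \<Rightarrow> ('a \<Rightarrow> complex) \<Rightarrow> 'a \<Rightarrow> 'a \<Rightarrow> (real \<Rightarrow> 'a) \<Rightarrow> bool" where
  "cover_path Ct p x y \<gamma> \<longleftrightarrow>
     path \<gamma> \<and> path_image \<gamma> \<subseteq> Ct \<and> pathstart \<gamma> = x \<and> pathfinish \<gamma> = y \<and>
     valid_path (p \<circ> \<gamma>) \<and> bounded ((\<lambda>t. vector_derivative (p \<circ> \<gamma>) (at t)) ` {0..1})"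

text \<open>The integral from \<open>x\<close> to \<open>y\<close>: the common value along all paths in \<open>Ct\<close>.\<close>

definition iterated_integral ::
    "'a::topological_space set \<Rightarrow> ('a \<Rightarrow> complex) \<Rightarrow> 'a \<Rightarrow> diff_form list \<Rightarrow> 'a \<Rightarrow> complex" where
  "iterated_integral Ct p x \<omega>s y =
     (THE v. \<forall>\<gamma>. cover_path Ct p x y \<gamma> \<longrightarrow> path_iterated_integral (p \<circ> \<gamma>) \<omega>s = v)"

text \<open>
  The map \<open>I\<^bsub>x\<^esub> : Sh(\<Omega>(C)) \<rightarrow> O_hol(Ct)\<close>; its value on a class is computed by any
  representative.
\<close>

definition I_map ::
    "'a::topological_space set \<Rightarrow> ('a \<Rightarrow> complex) \<Rightarrow> 'a \<Rightarrow> diff_form word_comb set \<Rightarrow> 'a \<Rightarrow> complex"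
  where
  "I_map Ct p x T = (\<lambda>y. if y \<in> Ct then
     (THE v. \<forall>t\<in>T. (\<Sum>\<omega>s\<in>Poly_Mapping.keys t.
        Poly_Mapping.lookup t \<omega>s * iterated_integral Ct p x \<omega>s y) = v) else 0)"

definition H_sigma0 ::
    "complex set \<Rightarrow> 'a::topological_space set \<Rightarrow> ('a \<Rightarrow> complex) \<Rightarrow> 'a \<Rightarrow> ('a \<Rightarrow> complex) set" where
  "H_sigma0 A Ct p x = I_map Ct p x ` sigma0_star A ` Sh A"


section \<open>Hyperlogarithms\<close>

definition open_segment_0 :: "real \<Rightarrow> complex set" where
  "open_segment_0 \<delta> = complex_of_real ` {0<..<\<delta>}"

definition f_star ::
    "complex set \<Rightarrow> 'a::topological_space set \<Rightarrow> ('a \<Rightarrow> complex) \<Rightarrow> 'a set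
       \<Rightarrow> complex word_comb \<Rightarrow> 'a \<Rightarrow> complex" where
  "f_star A Ct p K t = (\<lambda>z. if z \<in> Ct then
     Lim (at_right 0)
       (\<lambda>\<epsilon>. I_map Ct p (inv_into K p (complex_of_real \<epsilon>)) (sigma0_star A t) z) else 0)"

definition cover_log ::
    "complex set \<Rightarrow> 'a::topological_space set \<Rightarrow> ('a \<Rightarrow> complex) \<Rightarrow> 'a set \<Rightarrow> 'a \<Rightarrow> complex" where
  "cover_log A Ct p K =
     (THE f. f \<in> O_hol Ct p \<and> has_differential Ct p f (dlog_form A 0) \<and>
             (\<forall>x\<in>K. f x = complex_of_real (ln (Re (p x)))))"

definition Sh_algebra_morphism ::
    "complex set \<Rightarrow> 'a::topological_space set \<Rightarrow> ('a \<Rightarrow> complex)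
       \<Rightarrow> (complex word_comb \<Rightarrow> 'a \<Rightarrow> complex) \<Rightarrow> bool" where
  "Sh_algebra_morphism A Ct p F \<longleftrightarrow>
     F ` Sh A \<subseteq> O_hol Ct p \<and> F (word []) = hol_one Ct \<and>
     (\<forall>c. \<forall>t\<in>Sh A. F (scale_comb c t) = (\<lambda>x. c * F t x)) \<and>
     (\<forall>t\<in>Sh A. \<forall>t'\<in>Sh A. F (t + t') = (\<lambda>x. F t x + F t' x) \<and>
                           F (shuffle_prod t t') = (\<lambda>x. F t x * F t' x))"

text \<open>Extensionality only fixes the irrelevant values outside \<open>Sh A\<close>.\<close>

definition f_tilde ::
    "complex set \<Rightarrow> 'a::topological_space set \<Rightarrow> ('a \<Rightarrow> complex) \<Rightarrow> 'a set
       \<Rightarrow> complex word_comb \<Rightarrow> 'a \<Rightarrow> complex" where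
  "f_tilde A Ct p K =
     (THE F. F \<in> extensional (Sh A) \<and> Sh_algebra_morphism A Ct p F \<and>
             (\<forall>t\<in>Sh_star A. F t = f_star A Ct p K t) \<and> F (word [0]) = cover_log A Ct p K)"

definition hyperlog ::
    "complex set \<Rightarrow> 'a::topological_space set \<Rightarrow> ('a \<Rightarrow> complex) \<Rightarrow> 'a set
       \<Rightarrow> complex list \<Rightarrow> 'a \<Rightarrow> complex" where
  "hyperlog A Ct p K w = f_tilde A Ct p K (word w)"

end

(*
  For a base point x the functions J_x(w) are the iterated primitives of the logarithmic
  forms that vanish at x; primitives exist because the cover is simply connected.  The
  hyperlogarithms L_w satisfy the same differential equations d L_{ws} = L_w dlog(z - s), but
  are normalized at the tangential base point: along the segment K they are log^n/n! for the
  n-th power of the letter 0 and O(sqrt t) for every other word.  Any two families of solutions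
  differ by a path composition formula L_w = sum_{w = uv} L_u(x) J_x(v), which is unitriangular
  in the length of words, hence both families span the same space.  Letting x tend to 0 along K
  in this formula identifies L_w with the limit defining f_star on words not starting with 0.
  Products of the L_w obey the shuffle relation because both sides have the same differential
  and the same asymptotics along K, so the span is a subalgebra and equals f_tilde of Sh.
*)

theory Submission
  imports Defs "HOL-Real_Asymp.Real_Asymp"
begin

section \<open>Gluing local increments over a simply connected space\<close>

text \<open>The objects to be compared are given by definite descriptions and a limit, so showing
  that these have a value is as much work as comparing spans: \<open>iterated_integral\<close> needs
  independence of the path, \<open>I_map\<close> independence of the representing tensor, and
  \<open>f_tilde\<close> uniqueness of the morphism, which rests on \<open>Sh_star\<close> and the
  letter 0 generating the shuffle algebra. The cover is a subset of an arbitrary topological space;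
  a path in it has no derivative of its own, and all calculus passes through charts inverse to
  \<open>p\<close>. Along the segment, a word with a nonzero letter has at most the order of t times
  a power of the logarithm. The weaker bound sqrt t absorbs the logarithms and reproduces itself
  under integration: divided by t it is 1/sqrt t, with primitive 2 sqrt t. The same gap in order
  settles the limit for words not starting with 0: integrals from the moving base point grow slower
  than any negative power of t, while each correcting factor is O(sqrt t).\<close>

lemma simply_connected_imp_path_connected_topological:
  fixes T :: "'a::topological_space set"
  assumes sc: "simply_connected T"
  shows "path_connected T"
  unfolding path_connected_def
proof (intro ballI)
  fix a y assume "a \<in> T" "y \<in> T"
  \<comment> \<open>\<open>simply_connected\<close> makes any two loops freely homotopic; for two
    constant loops the base point traces a path from one point to the other.\<close>
  then have "homotopic_loops T (\<lambda>_. a) (\<lambda>_. y)"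
    using sc unfolding simply_connected_def
    by (force simp: path_def path_image_def pathfinish_def pathstart_def)
  then obtain h where h: "continuous_on ({0..1::real} \<times> {0..1::real}) h"
      "h ` ({0..1} \<times> {0..1}) \<subseteq> T" "h (0, 0) = a" "h (1, 0) = y"
    unfolding homotopic_loops by (auto simp: pathfinish_def pathstart_def image_subset_iff_funcset)
  have "continuous_on {0..1} (\<lambda>t. h (t, 0))"
    by (rule continuous_on_compose2[OF h(1)]) (auto intro!: continuous_intros)
  then show "\<exists>\<gamma>. path \<gamma> \<and> path_image \<gamma> \<subseteq> T \<and> pathstart \<gamma> = a \<and> pathfinish \<gamma> = y"
    using h by (intro exI[of _ "\<lambda>t. h (t, 0)"])
      (auto simp: path_def path_image_def pathfinish_def pathstart_def)
qed

text \<open>A primitive of \<open>D\<close> along \<sigma> in topological terms: increments to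
  nearby parameters are compared in an abelian group.\<close>

definition antiderivative_along ::
    "('a \<Rightarrow> 'a \<Rightarrow> 'c::ab_group_add) \<Rightarrow> 'b::topological_space set \<Rightarrow> ('b \<Rightarrow> 'a) \<Rightarrow> ('b \<Rightarrow> 'c) \<Rightarrow> bool" where
  "antiderivative_along D X \<sigma> f \<longleftrightarrow>
     (\<forall>t\<in>X. \<forall>\<^sub>F t' in at t within X. f t' = f t + D (\<sigma> t) (\<sigma> t'))"

text \<open>\<open>D x y\<close> is the increment from \<open>x\<close> to \<open>y\<close> of a local primitive chosen near \<open>x\<close>; it is
  meaningful for \<open>y\<close> close to \<open>x\<close> only.\<close>

locale local_increments =
  fixes T :: "'a::topological_space set" and D :: "'a \<Rightarrow> 'a \<Rightarrow> 'c::ab_group_add"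
  assumes refl: "D x x = 0"
    and additive: "x \<in> T \<Longrightarrow> \<exists>U. open U \<and> x \<in> U \<and>
      (\<forall>x'\<in>U \<inter> T. \<forall>\<^sub>F y in at x' within T. D x y = D x x' + D x' y)"
begin

abbreviation "along \<equiv> antiderivative_along D"

lemma along_compose:
  assumes "along X \<sigma> f" "continuous_on Y k" "k ` Y \<subseteq> X"
  shows "along Y (\<lambda>y. \<sigma> (k y)) (\<lambda>y. f (k y))"
  unfolding antiderivative_along_def
proof
  fix t assume t: "t \<in> Y"
  then have "k t \<in> X" using assms(3) by auto
  then have "\<forall>\<^sub>F t' in at (k t) within X. f t' = f (k t) + D (\<sigma> (k t)) (\<sigma> t')"
    using assms(1) by (auto simp: antiderivative_along_def)
  then obtain S where S: "open S" "k t \<in> S"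
      "\<And>t'. t' \<in> S \<Longrightarrow> t' \<noteq> k t \<Longrightarrow> t' \<in> X \<Longrightarrow> f t' = f (k t) + D (\<sigma> (k t)) (\<sigma> t')"
    unfolding eventually_at_topological by auto
  have "(k \<longlongrightarrow> k t) (at t within Y)"
    using assms(2) t by (simp add: continuous_on_def)
  then have "\<forall>\<^sub>F t' in at t within Y. k t' \<in> S"
    using S(1,2) by (rule topological_tendstoD)
  moreover have "\<forall>\<^sub>F t' in at t within Y. t' \<in> Y"
    by (auto simp: eventually_at_filter)
  \<comment> \<open>The filter at \<open>k t\<close> leaves out \<open>k t\<close> itself, whereas
    \<open>k\<close> may return there for t' near t; at such t' the increment is
    \<open>D x x = 0\<close>.\<close>
  ultimately show "\<forall>\<^sub>F t' in at t within Y. f (k t') = f (k t) + D (\<sigma> (k t)) (\<sigma> (k t'))"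
    by eventually_elim (use S(3) assms(3) refl in \<open>metis add.right_neutral image_subset_iff\<close>)
qed

lemma along_subset: "along X \<sigma> f \<Longrightarrow> Y \<subseteq> X \<Longrightarrow> along Y \<sigma> f"
  using along_compose[of X \<sigma> f Y "\<lambda>y. y"] by auto

lemma along_cong:
  assumes "along X \<sigma> f" "\<And>t. t \<in> X \<Longrightarrow> \<sigma> t = \<sigma>' t" "\<And>t. t \<in> X \<Longrightarrow> f t = f' t"
  shows "along X \<sigma>' f'"
  unfolding antiderivative_along_def
proof
  fix t assume t: "t \<in> X"
  have "\<forall>\<^sub>F t' in at t within X. t' \<in> X"
    by (auto simp: eventually_at_filter)
  moreover have "\<forall>\<^sub>F t' in at t within X. f t' = f t + D (\<sigma> t) (\<sigma> t')"
    using assms(1) t by (auto simp: antiderivative_along_def)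
  ultimately show "\<forall>\<^sub>F t' in at t within X. f' t' = f' t + D (\<sigma>' t) (\<sigma>' t')"
    by eventually_elim (use assms(2,3) t in auto)
qed

lemma along_const: "along X (\<lambda>_. x) (\<lambda>_. c)"
  by (simp add: antiderivative_along_def refl)

lemma along_shift: "along X \<sigma> f \<Longrightarrow> along X \<sigma> (\<lambda>t. f t + c)"
  unfolding antiderivative_along_def by (auto elim!: eventually_mono simp: algebra_simps)

lemma along_unique:
  assumes "along X \<sigma> f" "along X \<sigma> g" "connected X" "s \<in> X" "t \<in> X"
  shows "f t - f s = g t - g s"
proof -
  have "f s - g s = f t - g t"
  proof (rule connected_local_const[OF assms(3-5)], rule ballI)
    fix a assume "a \<in> X"
    then have "\<forall>\<^sub>F t' in at a within X. f t' = f a + D (\<sigma> a) (\<sigma> t')"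
      "\<forall>\<^sub>F t' in at a within X. g t' = g a + D (\<sigma> a) (\<sigma> t')"
      using assms(1,2) by (auto simp: antiderivative_along_def)
    then show "\<forall>\<^sub>F b in at a within X. f a - g a = f b - g b"
      by eventually_elim simp
  qed
  then show ?thesis by (simp add: algebra_simps)
qed

text \<open>On the connected overlap the two antiderivatives differ by one constant, which is
  absorbed into the second. Closedness deals with a point lying in only one of the sets: it is not a
  limit point of the other, whose filter there is trivial.\<close>

lemma along_glue:
  assumes f: "along X \<sigma> f" and g: "along Y \<sigma> g" and "closed X" "closed Y" "connected (X \<inter> Y)"
  obtains h where "along (X \<union> Y) \<sigma> h"
proof -
  obtain c where c: "\<And>t. t \<in> X \<inter> Y \<Longrightarrow> f t = g t + c"
  proof (cases "X \<inter> Y = {}")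
    case False
    then obtain s where s: "s \<in> X \<inter> Y" by auto
    have "f t = g t + (f s - g s)" if "t \<in> X \<inter> Y" for t
      using along_unique[OF along_subset[OF f] along_subset[OF g] assms(5) s that]
      by (auto simp: algebra_simps)
    then show ?thesis using that by blast
  qed (use that in auto)
  define h where "h t = (if t \<in> X then f t else g t + c)" for t
  have hX: "along X \<sigma> h"
    by (rule along_cong[OF f]) (auto simp: h_def)
  have hY: "along Y \<sigma> h"
    by (rule along_cong[OF along_shift[OF g, of c]]) (use c in \<open>auto simp: h_def\<close>)
  have "along (X \<union> Y) \<sigma> h"
    unfolding antiderivative_along_def
  proof
    fix t assume t: "t \<in> X \<union> Y"
    have *: "\<forall>\<^sub>F t' in at t within Z. h t' = h t + D (\<sigma> t) (\<sigma> t')"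
      if "closed Z" "along Z \<sigma> h" for Z
    proof (cases "t \<in> Z")
      case True
      then show ?thesis using that by (auto simp: antiderivative_along_def)
    next
      case False
      then have "at t within Z = bot"
        using that(1) by (metis at_within_eq_bot_iff closed_limpt islimpt_subset Diff_subset
            trivial_limit_within)
      then show ?thesis by simp
    qed
    show "\<forall>\<^sub>F t' in at t within X \<union> Y. h t' = h t + D (\<sigma> t) (\<sigma> t')"
      unfolding at_within_union eventually_sup using *[OF _ hX] *[OF _ hY] assms(3,4) by blast
  qed
  then show ?thesis by (rule that)
qed

text \<open>By \<open>additive\<close>, the increments measured from the single point
  \<open>\<sigma> t\<close> already form an antiderivative on a neighbourhood of that point.\<close>

lemma along_locally:
  assumes "continuous_on X \<sigma>" "\<sigma> ` X \<subseteq> T" "t \<in> X"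
  obtains V f where "open V" "t \<in> V" "along (X \<inter> V) \<sigma> f"
proof -
  have t: "\<sigma> t \<in> T" using assms by auto
  obtain U where U: "open U" "\<sigma> t \<in> U" and
    U2: "\<And>x'. x' \<in> U \<inter> T \<Longrightarrow> \<forall>\<^sub>F y in at x' within T. D (\<sigma> t) y = D (\<sigma> t) x' + D x' y"
    using additive[OF t] by auto
  have "along (U \<inter> T) (\<lambda>x. x) (D (\<sigma> t))"
    unfolding antiderivative_along_def
  proof
    fix x' assume x': "x' \<in> U \<inter> T"
    then have "at x' within T = at x' within (U \<inter> T)"
      using U(1) by (intro at_within_nhd[of _ U]) auto
    with U2[OF x'] show "\<forall>\<^sub>F y in at x' within U \<inter> T. D (\<sigma> t) y = D (\<sigma> t) x' + D x' y"
      by simp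
  qed
  moreover obtain V where V: "open V" "V \<inter> X = \<sigma> -` U \<inter> X"
    using assms(1) U(1) unfolding continuous_on_open_invariant by metis
  moreover from assms(1) have "continuous_on (X \<inter> V) \<sigma>"
    by (rule continuous_on_subset) auto
  ultimately have "along (X \<inter> V) (\<lambda>s. \<sigma> s) (\<lambda>s. D (\<sigma> t) (\<sigma> s))"
    using assms(2) by (intro along_compose[of "U \<inter> T" "\<lambda>x. x" "D (\<sigma> t)" "X \<inter> V" \<sigma>]) auto
  then show ?thesis
    using V U(2) assms(3) by (intro that[of V]) auto
qed

text \<open>Boxes small enough to carry an antiderivative are merged by bisection, in the second
  coordinate to full strips and then in the first. Intersecting with \<open>Q\<close> lets boxes
  reach beyond the square; two merged boxes meet in a box, which is convex and hence
  connected.\<close>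

lemma along_square:
  fixes h :: "real \<times> real \<Rightarrow> 'a"
  assumes h: "continuous_on ({0..1} \<times> {0..1}) h" "h ` ({0..1} \<times> {0..1}) \<subseteq> T"
  obtains f where "along ({0..1} \<times> {0..1}) h f"
proof -
  define Q where "Q = {0..1::real} \<times> {0..1::real}"
  define P where "P a b c d \<longleftrightarrow> (\<exists>f. along (Q \<inter> ({a..b} \<times> {c..d})) h f)" for a b c d
  have cl: "closed (Q \<inter> ({a..b} \<times> {c..d}))" for a b c d
    unfolding Q_def by (intro closed_Int closed_Times) auto
  have co: "connected (Q \<inter> ({a..b} \<times> {c..d}))" for a b c d
    unfolding Q_def by (intro convex_connected convex_Int convex_Times) auto
  have glue: "P a' b' c' d'"
    if Ps: "P a b c d" "P a2 b2 c2 d2" and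
      eqs: "{a..b} \<times> {c..d} \<inter> {a2..b2} \<times> {c2..d2} = {p..q} \<times> {r..s}"
      "{a..b} \<times> {c..d} \<union> {a2..b2} \<times> {c2..d2} = {a'..b'} \<times> {c'..d'}"
    for a b c d a2 b2 c2 d2 p q r s a' b' c' d'
  proof -
    obtain f g where fg: "along (Q \<inter> ({a..b} \<times> {c..d})) h f"
        "along (Q \<inter> ({a2..b2} \<times> {c2..d2})) h g"
      using Ps unfolding P_def by blast
    have "(Q \<inter> {a..b} \<times> {c..d}) \<inter> (Q \<inter> {a2..b2} \<times> {c2..d2}) = Q \<inter> ({p..q} \<times> {r..s})"
      using eqs(1) by blast
    then have "connected ((Q \<inter> {a..b} \<times> {c..d}) \<inter> (Q \<inter> {a2..b2} \<times> {c2..d2}))"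
      using co by simp
    from along_glue[OF fg cl cl this] obtain k
      where "along (Q \<inter> {a..b} \<times> {c..d} \<union> Q \<inter> {a2..b2} \<times> {c2..d2}) h k" .
    moreover have "Q \<inter> {a..b} \<times> {c..d} \<union> Q \<inter> {a2..b2} \<times> {c2..d2} = Q \<inter> ({a'..b'} \<times> {c'..d'})"
      using eqs(2) by blast
    ultimately have "along (Q \<inter> ({a'..b'} \<times> {c'..d'})) h k" by (simp only:)
    then show ?thesis unfolding P_def by blast
  qed
  have mono: "P a' b' c' d'" if P0: "P a b c d" and sub: "{a'..b'} \<times> {c'..d'} \<subseteq> {a..b} \<times> {c..d}"
    for a b c d a' b' c' d'
  proof -
    obtain f where "along (Q \<inter> ({a..b} \<times> {c..d})) h f"
      using P0 unfolding P_def by blast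
    then have "along (Q \<inter> ({a'..b'} \<times> {c'..d'})) h f"
      by (rule along_subset) (use sub in blast)
    then show ?thesis unfolding P_def by blast
  qed
  have box: "\<exists>d>0. P (x - d) (x + d) (y - d) (y + d)" if "(x, y) \<in> Q" for x y
  proof -
    have "continuous_on Q h" "h ` Q \<subseteq> T" using h by (simp_all add: Q_def)
    from along_locally[OF this that] obtain V f
      where V: "open V" "(x, y) \<in> V" "along (Q \<inter> V) h f" .
    obtain A B where AB: "open A" "open B" "(x, y) \<in> A \<times> B" "A \<times> B \<subseteq> V"
      using open_prod_elim[OF V(1,2)] .
    obtain e1 where e1: "e1 > 0" "cball x e1 \<subseteq> A"
      using AB open_contains_cball[of A] by auto
    obtain e2 where e2: "e2 > 0" "cball y e2 \<subseteq> B"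
      using AB open_contains_cball[of B] by auto
    define d where "d = min e1 e2"
    have "{x - d..x + d} \<subseteq> cball x e1" "{y - d..y + d} \<subseteq> cball y e2"
      by (auto simp: d_def dist_real_def)
    then have "{x - d..x + d} \<times> {y - d..y + d} \<subseteq> V" using AB e1 e2 by blast
    then have "along (Q \<inter> ({x - d..x + d} \<times> {y - d..y + d})) h f"
      by (intro along_subset[OF V(3)]) blast
    then have "P (x - d) (x + d) (y - d) (y + d)" unfolding P_def by blast
    then show ?thesis using e1 e2 by (intro exI[of _ d]) (auto simp: d_def)
  qed
  have strip: "\<exists>e>0. P (x - e) (x + e) 0 1" if x: "0 \<le> x" "x \<le> 1" for x
  proof (rule Bolzano[of 0 1 "\<lambda>a b. \<exists>e>0. P (x - e) (x + e) a b"])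
    fix a b c :: real
    assume "\<exists>e>0. P (x - e) (x + e) a b" "\<exists>e>0. P (x - e) (x + e) b c" and abc: "a \<le> b" "b \<le> c"
    then obtain e1 e2 where e: "e1 > 0" "e2 > 0" "P (x - e1) (x + e1) a b" "P (x - e2) (x + e2) b c"
      by auto
    \<comment> \<open>Strips over adjacent intervals are cut down to a common width before they are
      merged.\<close>
    define e where "e = min e1 e2"
    have "P (x - e) (x + e) a b" "P (x - e) (x + e) b c"
      by (rule mono[OF e(3)], force simp: e_def) (rule mono[OF e(4)], force simp: e_def)
    moreover have "{x-e..x+e} \<times> {a..b} \<inter> {x-e..x+e} \<times> {b..c} = {x-e..x+e} \<times> {b..b}"
      "{x-e..x+e} \<times> {a..b} \<union> {x-e..x+e} \<times> {b..c} = {x-e..x+e} \<times> {a..c}"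
      using abc by auto
    ultimately have "P (x - e) (x + e) a c" by (rule glue)
    then show "\<exists>e>0. P (x - e) (x + e) a c" using e by (intro exI[of _ e]) (auto simp: e_def)
  next
    fix y :: real assume "0 \<le> y" "y \<le> 1"
    then obtain d where d: "d > 0" "P (x - d) (x + d) (y - d) (y + d)"
      using box[of x y] x by (auto simp: Q_def)
    have "P (x - d) (x + d) a b" if "a \<le> y \<and> y \<le> b \<and> b - a < d" for a b
      by (rule mono[OF d(2)]) (use that in auto)
    then show "\<exists>d>0. \<forall>a b. a \<le> y \<and> y \<le> b \<and> b - a < d \<longrightarrow> (\<exists>e>0. P (x - e) (x + e) a b)"
      using d(1) by blast
  qed simp
  have "P 0 1 0 1"
  proof (rule Bolzano[of 0 1 "\<lambda>a b. P a b 0 1"])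
    fix a b c :: real
    assume P: "P a b 0 1" "P b c 0 1" and abc: "a \<le> b" "b \<le> c"
    have "{a..b} \<times> {0..1} \<inter> {b..c} \<times> {0..1::real} = {b..b} \<times> {0..1}"
      "{a..b} \<times> {0..1} \<union> {b..c} \<times> {0..1::real} = {a..c} \<times> {0..1}"
      using abc by auto
    with P show "P a c 0 1" by (rule glue)
  next
    fix x :: real assume "0 \<le> x" "x \<le> 1"
    then obtain e where e: "e > 0" "P (x - e) (x + e) 0 1" using strip by blast
    have "P a b 0 1" if "a \<le> x \<and> x \<le> b \<and> b - a < e" for a b
      by (rule mono[OF e(2)]) (use that in auto)
    then show "\<exists>d>0. \<forall>a b. a \<le> x \<and> x \<le> b \<and> b - a < d \<longrightarrow> P a b 0 1" using e(1) by blast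
  qed simp
  then obtain f where "along (Q \<inter> ({0..1} \<times> {0..1})) h f" unfolding P_def by blast
  then show ?thesis using that[of f] by (simp add: Q_def)
qed

text \<open>A path is read as a square that is constant in the first coordinate, so the bisection is
  not repeated.\<close>

lemma along_path:
  assumes "path \<gamma>" "path_image \<gamma> \<subseteq> T"
  obtains f where "along {0..1} \<gamma> f"
proof -
  have "continuous_on ({0..1} \<times> {0..1}) (\<lambda>u. \<gamma> (snd u))"
    using assms(1) unfolding path_def
    by (intro continuous_on_compose2[OF _ continuous_on_snd[OF continuous_on_id]]) auto
  moreover have "(\<lambda>u::real \<times> real. \<gamma> (snd u)) ` ({0..1} \<times> {0..1}) \<subseteq> T"
    using assms(2) by (auto simp: path_image_def)
  ultimately obtain f :: "real \<times> real \<Rightarrow> 'c" where "along ({0..1} \<times> {0..1}) (\<lambda>u. \<gamma> (snd u)) f"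
    by (rule along_square)
  have "along {0..1} \<gamma> (\<lambda>t. f (0, t))"
    by (rule along_cong[OF along_compose[OF \<open>along _ _ f\<close>, of _ "\<lambda>t. (0, t)"]])
      (auto intro!: continuous_intros)
  then show ?thesis by (rule that)
qed

text \<open>An antiderivative over the square of a free contraction compares the loop with a
  constant. The two remaining sides carry the same path, because all intermediate curves are closed,
  so their variations cancel.\<close>

lemma along_loop:
  assumes "simply_connected T" "path \<gamma>" "path_image \<gamma> \<subseteq> T" "pathfinish \<gamma> = pathstart \<gamma>"
    and f: "along {0..1} \<gamma> f"
  shows "f 1 = f 0"
proof -
  define a where "a = pathstart \<gamma>"
  have "path (\<lambda>_. a)" "path_image (\<lambda>_. a) \<subseteq> T"
    using assms(3) by (auto simp: path_def path_image_def a_def pathstart_def)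
  then have "homotopic_loops T \<gamma> (\<lambda>_. a)"
    using assms(1-4) unfolding simply_connected_def
    by (metis pathfinish_def pathstart_def)
  then obtain h where h: "continuous_on ({0..1::real} \<times> {0..1::real}) h"
      "h ` ({0..1} \<times> {0..1}) \<subseteq> T" "\<And>x. x \<in> {0..1} \<Longrightarrow> h (0, x) = \<gamma> x"
      "\<And>x. x \<in> {0..1} \<Longrightarrow> h (1, x) = a" "\<And>t. t \<in> {0..1} \<Longrightarrow> h (t, 1) = h (t, 0)"
    unfolding homotopic_loops by (auto simp: pathfinish_def pathstart_def image_subset_iff_funcset)
  obtain k where k: "along ({0..1} \<times> {0..1}) h k"
    using along_square[OF h(1,2)] .
  have 0: "along {0..1} \<gamma> (\<lambda>t. k (0, t))"
    by (rule along_cong[OF along_compose[OF k, of _ "\<lambda>t. (0, t)"]])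
      (use h(3) in \<open>auto intro!: continuous_intros\<close>)
  have 1: "along {0..1} (\<lambda>_. a) (\<lambda>t. k (1, t))"
    by (rule along_cong[OF along_compose[OF k, of _ "\<lambda>t. (1, t)"]])
      (use h(4) in \<open>auto intro!: continuous_intros\<close>)
  have left: "along {0..1} (\<lambda>t. h (t, 0)) (\<lambda>t. k (t, 0))"
    by (rule along_cong[OF along_compose[OF k, of _ "\<lambda>t. (t, 0)"]])
      (auto intro!: continuous_intros)
  have right: "along {0..1} (\<lambda>t. h (t, 0)) (\<lambda>t. k (t, 1))"
    by (rule along_cong[OF along_compose[OF k, of _ "\<lambda>t. (t, 1)"]])
      (use h(5) in \<open>auto intro!: continuous_intros\<close>)
  have "k (1, 0) - k (0, 0) = k (1, 1) - k (0, 1)"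
    using along_unique[OF left right, of 0 1] by simp
  moreover have "k (1, 1) - k (1, 0) = 0"
    using along_unique[OF 1 along_const[of _ _ 0], of 0 1] by simp
  ultimately have "k (0, 1) - k (0, 0) = 0" by (simp add: algebra_simps)
  then show ?thesis
    using along_unique[OF f 0, of 0 1] by simp
qed

lemma along_join:
  assumes "along {0..1} \<gamma>\<^sub>1 f" "along {0..1} \<gamma>\<^sub>2 g" "pathfinish \<gamma>\<^sub>1 = pathstart \<gamma>\<^sub>2"
    and h: "along {0..1} (\<gamma>\<^sub>1 +++ \<gamma>\<^sub>2) h"
  shows "h (1/2) - h 0 = f 1 - f 0" "h 1 - h (1/2) = g 1 - g 0"
proof -
  have 1: "along {0..1} \<gamma>\<^sub>1 (\<lambda>t. h (t / 2))"
    by (rule along_cong[OF along_compose[OF h, of _ "\<lambda>t. t / 2"]])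
      (auto simp: joinpaths_def intro!: continuous_intros)
  have 2: "along {0..1} \<gamma>\<^sub>2 (\<lambda>t. h ((t + 1) / 2))"
    by (rule along_cong[OF along_compose[OF h, of _ "\<lambda>t. (t + 1) / 2"]])
      (use assms(3) in \<open>auto simp: joinpaths_def pathfinish_def pathstart_def add_divide_distrib
        intro!: continuous_intros\<close>)
  show "h (1/2) - h 0 = f 1 - f 0" using along_unique[OF 1 assms(1), of 0 1] by simp
  show "h 1 - h (1/2) = g 1 - g 0" using along_unique[OF 2 assms(2), of 0 1] by simp
qed

lemma along_reversepath:
  assumes "along {0..1} \<gamma> f"
  shows "along {0..1} (reversepath \<gamma>) (\<lambda>t. f (1 - t))"
  unfolding reversepath_def
  by (rule along_compose[OF assms]) (auto intro!: continuous_intros)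

text \<open>The value at y is the variation along some path from a fixed point to y. Local path
  connectedness supplies short paths near x, along which the variation is
  \<open>D x y\<close>.\<close>

theorem global_antiderivative:
  assumes sc: "simply_connected T" and lpc: "locally path_connected T"
  obtains G where "\<And>x. x \<in> T \<Longrightarrow> \<forall>\<^sub>F y in at x within T. G y = G x + D x y"
proof (cases "T = {}")
  case False
  then obtain a where a: "a \<in> T" by auto
  \<comment> \<open>A relation rather than a function: \<open>step\<close> compares arbitrary
    admissible values, so a choice by \<open>SOME\<close> can serve as the antiderivative.\<close>
  define R where "R y v \<longleftrightarrow> (\<exists>\<gamma> f. path \<gamma> \<and> path_image \<gamma> \<subseteq> T \<and> pathstart \<gamma> = a \<and>
      pathfinish \<gamma> = y \<and> along {0..1} \<gamma> f \<and> v = f 1 - f 0)" for y v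
  have step: "w = v + (g 1 - g 0)"
    if R: "R x v" "R y w" and \<sigma>: "path \<sigma>" "path_image \<sigma> \<subseteq> T" "pathstart \<sigma> = x" "pathfinish \<sigma> = y"
      and g: "along {0..1} \<sigma> g" for x y v w \<sigma> g
  proof -
    obtain \<gamma> f where \<gamma>: "path \<gamma>" "path_image \<gamma> \<subseteq> T" "pathstart \<gamma> = a" "pathfinish \<gamma> = x"
        "along {0..1} \<gamma> f" "v = f 1 - f 0"
      using R by (auto simp: R_def)
    obtain \<beta> k where \<beta>: "path \<beta>" "path_image \<beta> \<subseteq> T" "pathstart \<beta> = a" "pathfinish \<beta> = y"
        "along {0..1} \<beta> k" "w = k 1 - k 0"
      using R by (auto simp: R_def)
    have p1: "path (\<gamma> +++ \<sigma>)" "path_image (\<gamma> +++ \<sigma>) \<subseteq> T" "pathfinish (\<gamma> +++ \<sigma>) = y"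
      using \<gamma> \<sigma> by (auto simp: path_image_join)
    \<comment> \<open>This loop has zero variation, which yields the relation between v, w and the
      variation of g.\<close>
    then have p2: "path ((\<gamma> +++ \<sigma>) +++ reversepath \<beta>)"
        "path_image ((\<gamma> +++ \<sigma>) +++ reversepath \<beta>) \<subseteq> T"
        "pathfinish ((\<gamma> +++ \<sigma>) +++ reversepath \<beta>) = pathstart ((\<gamma> +++ \<sigma>) +++ reversepath \<beta>)"
      using \<beta> \<gamma> by (auto simp: path_image_join)
    obtain m where m: "along {0..1} (\<gamma> +++ \<sigma>) m" using along_path p1 by blast
    obtain n where n: "along {0..1} ((\<gamma> +++ \<sigma>) +++ reversepath \<beta>) n" using along_path p2 by blast
    have n10: "n 1 = n 0" using along_loop[OF sc p2 n] .
    have ms: "m (1/2) - m 0 = f 1 - f 0" "m 1 - m (1/2) = g 1 - g 0"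
      using along_join[OF \<gamma>(5) g _ m] \<gamma> \<sigma> by auto
    have ns: "n (1/2) - n 0 = m 1 - m 0" "n 1 - n (1/2) = k 0 - k 1"
      using along_join[OF m along_reversepath[OF \<beta>(5)] _ n] \<beta> p1 by auto
    have "k 1 - k 0 = - (n 1 - n (1/2))" by (simp only: ns(2) minus_diff_eq)
    also have "\<dots> = n (1/2) - n 0" by (simp only: n10 minus_diff_eq)
    also have "\<dots> = (m 1 - m (1/2)) + (m (1/2) - m 0)" by (simp add: ns(1))
    also have "\<dots> = (g 1 - g 0) + (f 1 - f 0)" by (simp only: ms)
    finally have "k 1 - k 0 = (g 1 - g 0) + (f 1 - f 0)" .
    then show ?thesis using \<gamma>(6) \<beta>(6) by (simp add: add.commute)
  qed
  have ex: "\<exists>v. R y v" if y: "y \<in> T" for y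
  proof -
    obtain \<gamma> where \<gamma>: "path \<gamma>" "path_image \<gamma> \<subseteq> T" "pathstart \<gamma> = a" "pathfinish \<gamma> = y"
      using simply_connected_imp_path_connected_topological[OF sc] a y
      unfolding path_connected_def by blast
    moreover obtain f where "along {0..1} \<gamma> f" using along_path[OF \<gamma>(1,2)] .
    ultimately show ?thesis unfolding R_def by blast
  qed
  define G where "G y = (SOME v. R y v)" for y
  have RG: "R y (G y)" if "y \<in> T" for y
    unfolding G_def using ex[OF that] by (rule someI_ex)
  show ?thesis
  proof (rule that[of G])
    fix x assume x: "x \<in> T"
    obtain U where U: "open U" "x \<in> U" and
      U2: "\<And>x'. x' \<in> U \<inter> T \<Longrightarrow> \<forall>\<^sub>F y in at x' within T. D x y = D x x' + D x' y"
      using additive[OF x] by auto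
    have "openin (top_of_set T) (T \<inter> U)" using U by auto
    then obtain W V where W: "openin (top_of_set T) W" "path_connected V" "x \<in> W" "W \<subseteq> V" "V \<subseteq> T \<inter> U"
      using locallyE[OF lpc, of "T \<inter> U" x] x U(2) by blast
    have "along (U \<inter> T) (\<lambda>x. x) (D x)"
      unfolding antiderivative_along_def
    proof
      fix x' assume x': "x' \<in> U \<inter> T"
      then have "at x' within T = at x' within (U \<inter> T)"
        using U(1) by (intro at_within_nhd[of _ U]) auto
      with U2[OF x'] show "\<forall>\<^sub>F y in at x' within U \<inter> T. D x y = D x x' + D x' y"
        by simp
    qed
    then have V: "along V (\<lambda>x. x) (D x)"
      using along_subset W(5) by blast
    have "G y = G x + D x y" if "y \<in> V" for y
    proof -
      have "x \<in> V" using W by auto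
      then obtain \<sigma> where \<sigma>: "path \<sigma>" "path_image \<sigma> \<subseteq> V" "pathstart \<sigma> = x" "pathfinish \<sigma> = y"
        using W(2) \<open>y \<in> V\<close> unfolding path_connected_def by meson
      have "along {0..1} (\<lambda>t. \<sigma> t) (\<lambda>t. D x (\<sigma> t))"
        by (rule along_compose[OF V]) (use \<sigma> in \<open>auto simp: path_def path_image_def\<close>)
      moreover have "path_image \<sigma> \<subseteq> T" using \<sigma> W by blast
      moreover have "y \<in> T" using that W by blast
      ultimately have "G y = G x + (D x (\<sigma> 1) - D x (\<sigma> 0))"
        by (intro step[OF RG[OF x] RG[OF \<open>y \<in> T\<close>] \<sigma>(1) _ \<sigma>(3,4)])
      then show ?thesis using \<sigma> refl by (simp add: pathfinish_def pathstart_def)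
    qed
    moreover obtain O' where "open O'" "W = T \<inter> O'"
      using W(1) by (auto simp: openin_open)
    ultimately show "\<forall>\<^sub>F y in at x within T. G y = G x + D x y"
      unfolding eventually_at_topological using W(3,4) by (intro exI[of _ O']) auto
  qed
qed (use that in auto)

end

section \<open>Differentiation and primitives on a simply connected cover\<close>

text \<open>The derivative in the coordinate \<open>p\<close> at a single point. Being pointwise, it
  turns \<open>O_hol\<close> and \<open>has_differential\<close> into conditions at each point
  (\<open>O_hol_iff\<close>, \<open>has_differential_iff\<close>).\<close>

definition has_cover_derivative ::
    "'a::topological_space set \<Rightarrow> ('a \<Rightarrow> complex) \<Rightarrow> ('a \<Rightarrow> complex) \<Rightarrow> 'a \<Rightarrow> complex \<Rightarrow> bool" where
  "has_cover_derivative Ct p f x d \<longleftrightarrow>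
     (\<exists>U q. x \<in> U \<and> cover_chart Ct p U q \<and> ((\<lambda>z. f (q z)) has_field_derivative d) (at (p x)))"

lemma cover_chartD:
  assumes "cover_chart Ct p U q"
  shows "U \<subseteq> Ct" "openin (top_of_set Ct) U" "open (p ` U)" "continuous_on U p"
    "continuous_on (p ` U) q" "x \<in> U \<Longrightarrow> q (p x) = x" "z \<in> p ` U \<Longrightarrow> q z \<in> U"
    "z \<in> p ` U \<Longrightarrow> p (q z) = z"
  using assms unfolding cover_chart_def homeomorphism_def
  by (auto dest: openin_imp_subset)

lemma cover_chart_subset:
  assumes c: "cover_chart Ct p U q" and V: "openin (top_of_set Ct) V" "V \<subseteq> U"
  shows "cover_chart Ct p V q"
proof -
  obtain W where W: "open W" "V = Ct \<inter> W" using V by (auto simp: openin_open)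
  have "p ` V = p ` U \<inter> q -` W"
    using cover_chartD[OF c] V W by (auto simp: subset_iff image_iff)
  moreover have "open (p ` U \<inter> q -` W)"
    using cover_chartD[OF c] W(1) by (intro continuous_open_preimage)
  moreover have "homeomorphism V (p ` V) p q"
    using c V(2) unfolding cover_chart_def by (auto intro: homeomorphism_of_subsets)
  ultimately show ?thesis using V by (simp add: cover_chart_def)
qed

lemma cover_chart_Int:
  assumes "cover_chart Ct p U q" "cover_chart Ct p V r"
  shows "cover_chart Ct p (U \<inter> V) q"
  using assms by (intro cover_chart_subset[OF assms(1)]) (auto intro: openin_Int cover_chartD(2))

lemma cover_chart_eventually:
  assumes c: "cover_chart Ct p U q" and x: "x \<in> U" and P: "\<forall>\<^sub>F y in at x within Ct. P y" "P x"
  shows "\<forall>\<^sub>F z in nhds (p x). z \<in> p ` U \<and> P (q z)"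
proof -
  obtain S where S: "open S" "x \<in> S" "\<And>y. y \<in> S \<Longrightarrow> y \<in> Ct \<Longrightarrow> P y"
    using P unfolding eventually_at_topological by metis
  have "open (p ` U \<inter> q -` S)"
    using cover_chartD[OF c] S(1) by (intro continuous_open_preimage)
  moreover have "p x \<in> p ` U \<inter> q -` S" using cover_chartD(6)[OF c x] x S by auto
  moreover have "z \<in> p ` U \<and> P (q z)" if "z \<in> p ` U \<inter> q -` S" for z
    using that S(3)[of "q z"] cover_chartD(1,7)[OF c] by auto
  ultimately show ?thesis unfolding eventually_nhds by blast
qed

lemma has_cover_derivative_transform:
  assumes "has_cover_derivative Ct p f x d" "\<forall>\<^sub>F y in at x within Ct. g y = f y" "g x = f x"
  shows "has_cover_derivative Ct p g x d"
proof -
  obtain U q where U: "x \<in> U" "cover_chart Ct p U q"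
      "((\<lambda>z. f (q z)) has_field_derivative d) (at (p x))"
    using assms(1) by (auto simp: has_cover_derivative_def)
  have "\<forall>\<^sub>F z in nhds (p x). z \<in> p ` U \<and> g (q z) = f (q z)"
    using cover_chart_eventually[OF U(2,1), where P="\<lambda>y. g y = f y"] assms(2,3) by blast
  then have "\<forall>\<^sub>F z in nhds (p x). g (q z) = f (q z)" by eventually_elim auto
  then have "((\<lambda>z. g (q z)) has_field_derivative d) (at (p x))"
    using U(3) by (subst DERIV_cong_ev[of _ _ _ "\<lambda>z. f (q z)"]) auto
  then show ?thesis using U unfolding has_cover_derivative_def by blast
qed

lemma has_cover_derivative_cong:
  assumes "has_cover_derivative Ct p f x d" "x \<in> Ct" "\<And>y. y \<in> Ct \<Longrightarrow> g y = f y"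
  shows "has_cover_derivative Ct p g x d"
  by (rule has_cover_derivative_transform[OF assms(1)])
    (use assms in \<open>auto simp: eventually_at_filter\<close>)

text \<open>On the image of the overlap both chart inverses invert the same map \<open>p\<close>, so
  they coincide there.\<close>

lemma has_cover_derivative_chart:
  assumes f: "has_cover_derivative Ct p f x d" and c: "cover_chart Ct p U q" and x: "x \<in> U"
  shows "((\<lambda>z. f (q z)) has_field_derivative d) (at (p x))"
proof -
  obtain V r where V: "x \<in> V" "cover_chart Ct p V r"
      "((\<lambda>z. f (r z)) has_field_derivative d) (at (p x))"
    using f by (auto simp: has_cover_derivative_def)
  note UV = cover_chart_Int[OF c V(2)] 
  have "f (q z) = f (r z)" if "z \<in> p ` (U \<inter> V)" for z
    using that cover_chartD(6)[OF c] cover_chartD(6)[OF V(2)] by auto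
  moreover have "\<forall>\<^sub>F z in nhds (p x). z \<in> p ` (U \<inter> V)"
    using cover_chartD(3)[OF UV] x V(1) by (intro eventually_nhds_in_open) auto
  ultimately have "\<forall>\<^sub>F z in nhds (p x). f (q z) = f (r z)" by (auto elim: eventually_mono)
  then show ?thesis using V(3) by (subst DERIV_cong_ev[of _ _ _ "\<lambda>z. f (r z)"]) auto
qed

lemma has_cover_derivative_add:
  assumes "has_cover_derivative Ct p f x d" "has_cover_derivative Ct p g x e"
  shows "has_cover_derivative Ct p (\<lambda>y. f y + g y) x (d + e)"
proof -
  obtain U q where U: "x \<in> U" "cover_chart Ct p U q"
    using assms(1) by (auto simp: has_cover_derivative_def)
  then show ?thesis
    using DERIV_add[OF has_cover_derivative_chart[OF assms(1) U(2,1)]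
        has_cover_derivative_chart[OF assms(2) U(2,1)]]
    unfolding has_cover_derivative_def by blast
qed

lemma has_cover_derivative_mult:
  assumes "has_cover_derivative Ct p f x d" "has_cover_derivative Ct p g x e"
  shows "has_cover_derivative Ct p (\<lambda>y. f y * g y) x (d * g x + e * f x)"
proof -
  obtain U q where U: "x \<in> U" "cover_chart Ct p U q"
    using assms(1) by (auto simp: has_cover_derivative_def)
  then show ?thesis
    using DERIV_mult[OF has_cover_derivative_chart[OF assms(1) U(2,1)]
        has_cover_derivative_chart[OF assms(2) U(2,1)]] cover_chartD(6)[OF U(2,1)]
    unfolding has_cover_derivative_def by auto
qed

lemma has_cover_derivative_cmult:
  assumes "has_cover_derivative Ct p f x d"
  shows "has_cover_derivative Ct p (\<lambda>y. c * f y) x (c * d)"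
proof -
  obtain U q where U: "x \<in> U" "cover_chart Ct p U q"
      "((\<lambda>z. f (q z)) has_field_derivative d) (at (p x))"
    using assms by (auto simp: has_cover_derivative_def)
  then show ?thesis
    using DERIV_cmult[OF U(3), of c] unfolding has_cover_derivative_def by blast
qed

lemma has_cover_derivative_tendsto:
  assumes "has_cover_derivative Ct p f x d"
  shows "(f \<longlongrightarrow> f x) (at x within Ct)"
proof (rule topological_tendstoI)
  fix S assume S: "open S" "f x \<in> S"
  obtain U q where U: "x \<in> U" "cover_chart Ct p U q"
      "((\<lambda>z. f (q z)) has_field_derivative d) (at (p x))"
    using assms by (auto simp: has_cover_derivative_def)
  have "isCont (\<lambda>z. f (q z)) (p x)" using U(3) by (rule DERIV_isCont)
  then have "((\<lambda>z. f (q z)) \<longlongrightarrow> f (q (p x))) (nhds (p x))"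
    unfolding isCont_def by (rule tendsto_at_iff_tendsto_nhds[THEN iffD1, of "\<lambda>z. f (q z)"])
  then have "((\<lambda>z. f (q z)) \<longlongrightarrow> f x) (nhds (p x))"
    using cover_chartD(6)[OF U(2,1)] by simp
  then have "\<forall>\<^sub>F z in nhds (p x). f (q z) \<in> S" using S by (rule topological_tendstoD)
  then obtain W where W: "open W" "p x \<in> W" "\<And>z. z \<in> W \<Longrightarrow> f (q z) \<in> S"
    by (auto simp: eventually_nhds)
  have "openin (top_of_set U) (U \<inter> p -` W)"
    by (rule continuous_openin_preimage_gen[OF cover_chartD(4)[OF U(2)] W(1)])
  then have "openin (top_of_set Ct) (U \<inter> p -` W)"
    using cover_chartD(2)[OF U(2)] by (rule openin_trans)
  then obtain V where V: "open V" "U \<inter> p -` W = Ct \<inter> V" by (auto simp: openin_open)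
  have "f y \<in> S" if "y \<in> V" "y \<in> Ct" for y
  proof -
    have "y \<in> U \<inter> p -` W" using V(2) that by blast
    then show ?thesis using W(3)[of "p y"] cover_chartD(6)[OF U(2)] by auto
  qed
  moreover have "x \<in> V" using V(2) U(1) W(2) by blast
  ultimately show "\<forall>\<^sub>F y in at x within Ct. f y \<in> S"
    unfolding eventually_at_topological using V(1) by blast
qed

text \<open>Only the projected path is differentiated: near t the function is
  \<open>f (q (p (\<gamma> s)))\<close>, since continuity of \<gamma> keeps the path in the chart,
  and the ordinary chain rule applies.\<close>

lemma has_cover_derivative_path:
  assumes f: "has_cover_derivative Ct p f (\<gamma> t) d" and S: "t \<in> S" "\<gamma> ` S \<subseteq> Ct"
    and \<gamma>: "(\<gamma> \<longlongrightarrow> \<gamma> t) (at t within S)"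
    and v: "((\<lambda>s. p (\<gamma> s)) has_vector_derivative v) (at t within S)"
  shows "((\<lambda>s. f (\<gamma> s)) has_vector_derivative (d * v)) (at t within S)"
proof -
  obtain U q where U: "\<gamma> t \<in> U" "cover_chart Ct p U q"
      "((\<lambda>z. f (q z)) has_field_derivative d) (at (p (\<gamma> t)))"
    using f by (auto simp: has_cover_derivative_def)
  have deriv: "(((\<lambda>z. f (q z)) \<circ> (\<lambda>s. p (\<gamma> s))) has_vector_derivative (v * d)) (at t within S)"
    by (intro field_vector_diff_chain_within v has_field_derivative_at_within[OF U(3)])
  obtain V where V: "open V" "U = Ct \<inter> V"
    using cover_chartD(2)[OF U(2)] by (auto simp: openin_open)
  have "\<forall>\<^sub>F s in at t within S. \<gamma> s \<in> V"
    using \<gamma> V U(1) by (intro topological_tendstoD) auto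
  then have "\<forall>\<^sub>F s in nhds t. s \<in> S \<longrightarrow> \<gamma> s \<in> U"
    using V S U(1) by (auto simp: eventually_at_filter elim!: eventually_mono)
  then have ev: "\<forall>\<^sub>F s in nhds t. s \<in> S \<longrightarrow> ((\<lambda>z. f (q z)) \<circ> (\<lambda>s. p (\<gamma> s))) s = f (\<gamma> s)"
    by eventually_elim (use cover_chartD(6)[OF U(2)] in auto)
  have "((\<lambda>z. f (q z)) \<circ> (\<lambda>s. p (\<gamma> s))) t = f (\<gamma> t)"
    using cover_chartD(6)[OF U(2,1)] by simp
  from has_vector_derivative_cong_ev[THEN iffD1, OF ev this deriv]
  show ?thesis by (simp only: mult.commute)
qed

section \<open>Constancy and existence of primitives on a simply connected cover\<close>

locale simply_connected_cover =
  fixes Ct :: "'a::topological_space set" and p :: "'a \<Rightarrow> complex" and C :: "complex set"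
  assumes open_base: "open C" and covering: "covering_space Ct p C"
    and sc: "simply_connected Ct"
begin

abbreviation "hcd \<equiv> has_cover_derivative Ct p"

lemma connected_cover: "connected Ct"
  by (intro path_connected_imp_connected simply_connected_imp_path_connected_topological sc)

lemma p_in_base: "x \<in> Ct \<Longrightarrow> p x \<in> C"
  using covering by (auto simp: covering_space_def)

lemma continuous_p: "continuous_on Ct p"
  using covering by (rule covering_space_imp_continuous)

text \<open>On a disc a function with zero derivative is constant, holomorphic functions have
  primitives, and points are joined by straight segments; each of these is used through such a
  chart.\<close>

lemma disc_chart:
  assumes "openin (top_of_set Ct) W" "x \<in> W"
  obtains U q r where "U \<subseteq> W" "x \<in> U" "cover_chart Ct p U q" "r > 0" "p ` U = ball (p x) r"
proof -
  have x: "x \<in> Ct" using assms openin_imp_subset by blast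
  obtain T u q where T: "x \<in> T" "openin (top_of_set Ct) T" "p x \<in> u" "openin (top_of_set C) u"
      "homeomorphism T u p q"
    using covering_space_local_homeomorphism[OF covering x] .
  have "u = p ` T" using T(5) by (simp add: homeomorphism_def)
  moreover have "open u" using T(4) open_base by (metis openin_open_trans)
  ultimately have "cover_chart Ct p T q" using T by (simp add: cover_chart_def)
  then have c: "cover_chart Ct p (T \<inter> W) q"
    by (rule cover_chart_subset) (use T assms in auto)
  obtain r where r: "r > 0" "ball (p x) r \<subseteq> p ` (T \<inter> W)"
    using cover_chartD(3)[OF c] T(1) assms(2) by (metis IntI imageI openE)
  define U where "U = (T \<inter> W) \<inter> p -` ball (p x) r"
  have "openin (top_of_set (T \<inter> W)) U"
    unfolding U_def using cover_chartD(4)[OF c] by (intro continuous_openin_preimage_gen) auto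
  then have "openin (top_of_set Ct) U"
    using cover_chartD(2)[OF c] by (rule openin_trans)
  then have "cover_chart Ct p U q" by (rule cover_chart_subset[OF c]) (auto simp: U_def)
  moreover have "p ` U = ball (p x) r" using r(2) by (auto simp: U_def)
  ultimately show ?thesis using r T(1) assms(2) by (intro that[of U q r]) (auto simp: U_def)
qed

lemmas disc_chart_at = disc_chart[OF openin_subtopology_self]

lemma locally_path_connected_cover: "locally path_connected Ct"
proof (rule locallyI)
  fix W x assume "openin (top_of_set Ct) W" "x \<in> W"
  then obtain U q r where U: "U \<subseteq> W" "x \<in> U" "cover_chart Ct p U q" "r > 0" "p ` U = ball (p x) r"
    by (rule disc_chart)
  have "path_connected (q ` (p ` U))"
    by (rule path_connected_continuous_image[OF cover_chartD(5)[OF U(3)]])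
      (simp add: U(5) convex_imp_path_connected)
  moreover have "q ` (p ` U) = U"
    using cover_chartD(6)[OF U(3)] by (force simp: image_image)
  ultimately show "\<exists>U V. openin (top_of_set Ct) U \<and> path_connected V \<and> x \<in> U \<and> U \<subseteq> V \<and> V \<subseteq> W"
    using U cover_chartD(2)[OF U(3)] by (intro exI[of _ U]) auto
qed

lemma hcd_compose_p:
  assumes "x \<in> Ct" "(g has_field_derivative d) (at (p x))"
  shows "hcd (\<lambda>y. g (p y)) x d"
proof -
  obtain U q r where U: "U \<subseteq> Ct" "x \<in> U" "cover_chart Ct p U q" "r > 0" "p ` U = ball (p x) r"
    using disc_chart_at[OF assms(1)] .
  have "p x \<in> ball (p x) r" using U(4) by simp
  then have "((\<lambda>z. g (p (q z))) has_field_derivative d) (at (p x))"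
    using assms(2) cover_chartD(8)[OF U(3)] U(5)
    by (subst has_field_derivative_cong_ev[where g=g and S=UNIV])
      (auto intro: eventually_mono[OF eventually_nhds_in_open[of "ball (p x) r"]])
  then show ?thesis using U unfolding has_cover_derivative_def by blast
qed

lemma hcd_const: "x \<in> Ct \<Longrightarrow> hcd (\<lambda>_. c) x 0"
  using hcd_compose_p[of x "\<lambda>_. c" 0] by simp

lemma hcd_locally_const:
  assumes "openin (top_of_set Ct) W" "x \<in> W" "\<And>y. y \<in> W \<Longrightarrow> hcd f y 0"
  shows "\<forall>\<^sub>F y in at x within Ct. f y = f x"
proof -
  obtain U q r where U: "U \<subseteq> W" "x \<in> U" "cover_chart Ct p U q" "r > 0" "p ` U = ball (p x) r"
    using disc_chart[OF assms(1,2)] .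
  have "((\<lambda>z. f (q z)) has_field_derivative 0) (at z within p ` U)" if z: "z \<in> p ` U" for z
    using has_cover_derivative_chart[OF assms(3)[of "q z"] U(3)] cover_chartD(7,8)[OF U(3) z] U(1)
    by (auto intro: has_field_derivative_at_within)
  then obtain c where c: "\<And>z. z \<in> p ` U \<Longrightarrow> f (q z) = c"
    using has_field_derivative_zero_constant[of "p ` U" "\<lambda>z. f (q z)"] U(5) by auto
  have "f y = f x" if "y \<in> U" for y
    using c[of "p y"] c[of "p x"] that U(2) cover_chartD(6)[OF U(3)] by auto
  moreover obtain V where V: "open V" "U = Ct \<inter> V"
    using cover_chartD(2)[OF U(3)] by (auto simp: openin_open)
  ultimately show ?thesis unfolding eventually_at_topological using U(2) by blast
qed

lemma hcd_zero_const:
  assumes "\<And>y. y \<in> Ct \<Longrightarrow> hcd f y 0" "x \<in> Ct" "y \<in> Ct"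
  shows "f x = f y"
proof (rule connected_local_const[OF connected_cover assms(2,3)], rule ballI)
  fix a assume "a \<in> Ct"
  then have "\<forall>\<^sub>F y in at a within Ct. f y = f a"
    using assms(1) by (intro hcd_locally_const[of Ct]) auto
  then show "\<forall>\<^sub>F b in at a within Ct. f a = f b" by eventually_elim simp
qed

lemma hcd_eqI:
  assumes "\<And>y. y \<in> Ct \<Longrightarrow> hcd f y (h y)" "\<And>y. y \<in> Ct \<Longrightarrow> hcd g y (h y)"
    "x \<in> Ct" "f x = g x" "y \<in> Ct"
  shows "f y = g y"
proof -
  have "hcd (\<lambda>y. f y + (-1) * g y) z 0" if "z \<in> Ct" for z
    using has_cover_derivative_add[OF assms(1)[OF that]
        has_cover_derivative_cmult[OF assms(2)[OF that], of "-1"]] by simp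
  from hcd_zero_const[OF this assms(3,5)] assms(4) show ?thesis by simp
qed

text \<open>Primitives \<open>g x\<close> of h on discs give the increments \<open>D\<close>. On an
  overlap two of them have the same derivative, so they differ by a local constant, which is
  \<open>additive\<close>; gluing then uses simple connectedness.\<close>

lemma ex_primitive:
  assumes h: "\<And>x. x \<in> Ct \<Longrightarrow> \<exists>d. hcd h x d"
  obtains G where "\<And>x. x \<in> Ct \<Longrightarrow> hcd G x (h x)"
proof -
  have "\<exists>U g. openin (top_of_set Ct) U \<and> x \<in> U \<and> (\<forall>y\<in>U. (g has_field_derivative h y) (at (p y)))"
    if x: "x \<in> Ct" for x
  proof -
    obtain U q r where U: "U \<subseteq> Ct" "x \<in> U" "cover_chart Ct p U q" "r > 0" "p ` U = ball (p x) r"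
      using disc_chart_at[OF x] .
    have "\<exists>d. ((\<lambda>z. h (q z)) has_field_derivative d) (at z)" if z: "z \<in> p ` U" for z
      using has_cover_derivative_chart[OF _ U(3), of h "q z"] h[of "q z"]
        cover_chartD(7,8)[OF U(3) z] U(1) by auto
    then have "(\<lambda>z. h (q z)) holomorphic_on ball (p x) r"
      using U(5) by (auto simp: holomorphic_on_open)
    then obtain g where g: "\<And>z. z \<in> ball (p x) r \<Longrightarrow>
        (g has_field_derivative h (q z)) (at z within ball (p x) r)"
      using holomorphic_convex_primitive'[of "ball (p x) r" "\<lambda>z. h (q z)"] by auto
    have "(g has_field_derivative h y) (at (p y))" if "y \<in> U" for y
      using g[of "p y"] U(5) that cover_chartD(6)[OF U(3) that]
      by (metis at_within_open imageI open_ball)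
    then show ?thesis using U cover_chartD(2)[OF U(3)] by blast
  qed
  then obtain U g where Ug: "\<And>x. x \<in> Ct \<Longrightarrow> openin (top_of_set Ct) (U x) \<and> x \<in> U x"
      "\<And>x y. x \<in> Ct \<Longrightarrow> y \<in> U x \<Longrightarrow> (g x has_field_derivative h y) (at (p y))"
    by metis
  define D where "D x y = g x (p y) - g x (p x)" for x y
  have hD: "hcd (D x) y (h y)" if "x \<in> Ct" "y \<in> U x" for x y
  proof -
    have "y \<in> Ct" using Ug(1)[OF that(1)] that(2) openin_imp_subset by blast
    then show ?thesis unfolding D_def
      using has_cover_derivative_add[OF hcd_compose_p[OF \<open>y \<in> Ct\<close> Ug(2)[OF that]]
          hcd_const[OF \<open>y \<in> Ct\<close>, of "- g x (p x)"]]
      by simp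
  qed
  interpret D: local_increments Ct D
  proof
    show "D x x = 0" for x by (simp add: D_def)
    fix x assume x: "x \<in> Ct"
    obtain V where V: "open V" "U x = Ct \<inter> V" using Ug(1)[OF x] by (auto simp: openin_open)
    have "\<forall>\<^sub>F y in at x' within Ct. D x y = D x x' + D x' y" if x': "x' \<in> V \<inter> Ct" for x'
    proof -
      have "x' \<in> U x \<inter> U x'" using x' V Ug(1)[of x'] by auto
      moreover have "openin (top_of_set Ct) (U x \<inter> U x')" using Ug(1) x x' by auto
      moreover have "hcd (\<lambda>y. D x y + (-1) * D x' y) y 0" if "y \<in> U x \<inter> U x'" for y
        using has_cover_derivative_add[OF hD[OF x, of y]
            has_cover_derivative_cmult[OF hD[of x' y], of "-1"]] that x' by simp
      ultimately have "\<forall>\<^sub>F y in at x' within Ct. D x y + (-1) * D x' y = D x x' + (-1) * D x' x'"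
        by (intro hcd_locally_const)
      then show ?thesis by eventually_elim (simp add: D_def algebra_simps)
    qed
    then show "\<exists>U. open U \<and> x \<in> U \<and> (\<forall>x'\<in>U \<inter> Ct. \<forall>\<^sub>F y in at x' within Ct. D x y = D x x' + D x' y)"
      using V Ug(1)[OF x] by blast
  qed
  obtain G where G: "\<And>x. x \<in> Ct \<Longrightarrow> \<forall>\<^sub>F y in at x within Ct. G y = G x + D x y"
    using D.global_antiderivative[OF sc locally_path_connected_cover] by blast
  have "hcd G x (h x)" if x: "x \<in> Ct" for x
  proof (rule has_cover_derivative_transform)
    show "hcd (\<lambda>y. G x + D x y) x (h x)"
      using has_cover_derivative_add[OF hcd_const[OF x, of "G x"] hD[OF x]] Ug(1)[OF x] by simp
  qed (use G[OF x] D.refl in auto)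
  then show ?thesis by (rule that)
qed

lemma ex_primitive_at:
  assumes h: "\<And>x. x \<in> Ct \<Longrightarrow> \<exists>d. hcd h x d" and x: "x \<in> Ct"
  obtains G where "\<And>y. y \<in> Ct \<Longrightarrow> hcd G y (h y)" "\<And>y. y \<notin> Ct \<Longrightarrow> G y = 0" "G x = c"
proof -
  obtain G where G: "\<And>x. x \<in> Ct \<Longrightarrow> hcd G x (h x)"
    using ex_primitive[of h] h by blast
  define H where "H y = (if y \<in> Ct then G y + (c - G x) else 0)" for y
  have "hcd H y (h y)" if y: "y \<in> Ct" for y
    by (rule has_cover_derivative_cong[where f="\<lambda>y. G y + (c - G x)"])
      (use has_cover_derivative_add[OF G[OF y] hcd_const[OF y, of "c - G x"]] y in \<open>auto simp: H_def\<close>)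
  then show ?thesis by (rule that) (use x in \<open>auto simp: H_def\<close>)
qed

lemma continuous_on_hcd:
  assumes "\<And>x. x \<in> Ct \<Longrightarrow> \<exists>d. hcd f x d"
  shows "continuous_on Ct f"
  unfolding continuous_on_def using assms has_cover_derivative_tendsto[of Ct p f] by metis

lemma O_hol_iff: "f \<in> O_hol Ct p \<longleftrightarrow> (\<forall>x. x \<notin> Ct \<longrightarrow> f x = 0) \<and> (\<forall>x\<in>Ct. \<exists>d. hcd f x d)"
proof -
  have "\<exists>d. hcd f x d"
    if "x \<in> U" "cover_chart Ct p U q" "(\<lambda>z. f (q z)) holomorphic_on p ` U" for x U q
    using that cover_chartD(3)[OF that(2)] unfolding has_cover_derivative_def
    by (metis holomorphic_on_open imageI)
  moreover have "\<exists>U q. x \<in> U \<and> cover_chart Ct p U q \<and> (\<lambda>z. f (q z)) holomorphic_on p ` U"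
    if f: "\<forall>x\<in>Ct. \<exists>d. hcd f x d" and x: "x \<in> Ct" for x
  proof -
    obtain U q r where U: "U \<subseteq> Ct" "x \<in> U" "cover_chart Ct p U q" "r > 0" "p ` U = ball (p x) r"
      using disc_chart_at[OF x] .
    have "\<exists>d. ((\<lambda>z. f (q z)) has_field_derivative d) (at z)" if z: "z \<in> p ` U" for z
      using has_cover_derivative_chart[OF _ U(3), of f "q z"] f
        cover_chartD(7,8)[OF U(3) z] U(1) by force
    then have "(\<lambda>z. f (q z)) holomorphic_on p ` U"
      using U(5) by (auto simp: holomorphic_on_open)
    then show ?thesis using U by blast
  qed
  ultimately show ?thesis unfolding O_hol_def by blast
qed

lemma has_differential_iff: "has_differential Ct p f g \<longleftrightarrow> (\<forall>x\<in>Ct. hcd f x (g (p x)))"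
proof
  assume "has_differential Ct p f g"
  then show "\<forall>x\<in>Ct. hcd f x (g (p x))"
    unfolding has_differential_def has_cover_derivative_def by blast
next
  assume f: "\<forall>x\<in>Ct. hcd f x (g (p x))"
  show "has_differential Ct p f g"
    unfolding has_differential_def
  proof
    fix x assume x: "x \<in> Ct"
    obtain U q r where U: "U \<subseteq> Ct" "x \<in> U" "cover_chart Ct p U q" "r > 0" "p ` U = ball (p x) r"
      using disc_chart_at[OF x] .
    have "((\<lambda>z. f (q z)) has_field_derivative g z) (at z)" if z: "z \<in> p ` U" for z
      using has_cover_derivative_chart[OF _ U(3), of f "q z"] f
        cover_chartD(7,8)[OF U(3) z] U(1) by force
    then show "\<exists>U q. x \<in> U \<and> cover_chart Ct p U q \<and>
        (\<forall>z\<in>p ` U. ((\<lambda>z. f (q z)) has_field_derivative g z) (at z))"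
      using U by blast
  qed
qed

end

section \<open>Iterated integrals over ordered simplices\<close>

text \<open>The variable upper limit makes a recursion possible: fixing the last and largest
  coordinate at s leaves the simplex with upper limit s.\<close>

definition truncated_simplex :: "nat \<Rightarrow> real \<Rightarrow> (nat \<Rightarrow> real) set" where
  "truncated_simplex n T =
     {t \<in> {..<n} \<rightarrow>\<^sub>E {0..T}. \<forall>i j. i \<le> j \<longrightarrow> j < n \<longrightarrow> t i \<le> t j}"

definition simplex_integral :: "(nat \<Rightarrow> real \<Rightarrow> complex) \<Rightarrow> nat \<Rightarrow> real \<Rightarrow> complex" where
  "simplex_integral g n T = set_lebesgue_integral (\<Pi>\<^sub>M i\<in>{..<n}. lborel) (truncated_simplex n T)
     (\<lambda>t. \<Prod>i<n. g i (t i))"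

lemma sets_truncated_simplex [measurable]:
  "truncated_simplex n T \<in> sets (\<Pi>\<^sub>M i\<in>{..<n}. (lborel::real measure))"
proof -
  have "truncated_simplex n T = {t \<in> space (\<Pi>\<^sub>M i\<in>{..<n}. (lborel::real measure)).
      (\<forall>i\<in>{..<n}. 0 \<le> t i \<and> t i \<le> T) \<and> (\<forall>i\<in>{..<n}. \<forall>j\<in>{..<n}. i \<le> j \<longrightarrow> t i \<le> t j)}"
    unfolding truncated_simplex_def space_PiM by (auto simp: PiE_iff)
  also have "\<dots> \<in> sets (\<Pi>\<^sub>M i\<in>{..<n}. lborel)"
  proof -
    have m: "(\<lambda>t. t i) \<in> borel_measurable (\<Pi>\<^sub>M i\<in>{..<n}. (lborel::real measure))" if "i \<in> {..<n}" for i
      using measurable_component_singleton[OF that, of "\<lambda>_. lborel"] by simp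
    show ?thesis
      by (intro sets.sets_Collect_conj sets.sets_Collect_finite_All sets.sets_Collect_imp
          sets.sets_Collect_const borel_measurable_le m borel_measurable_const) auto
  qed
  finally show ?thesis .
qed

lemma emeasure_truncated_simplex:
  "emeasure (\<Pi>\<^sub>M i\<in>{..<n}. lborel) (truncated_simplex n T) < \<infinity>"
proof -
  interpret product_sigma_finite "\<lambda>_::nat. lborel :: real measure" by standard
  have "emeasure (\<Pi>\<^sub>M i\<in>{..<n}. lborel) (truncated_simplex n T)
      \<le> emeasure (\<Pi>\<^sub>M i\<in>{..<n}. lborel) (\<Pi>\<^sub>E i\<in>{..<n}. {0..T})"
    by (intro emeasure_mono) (auto simp: truncated_simplex_def intro!: sets_PiM_I_finite)
  also have "\<dots> = (\<Prod>i<n. emeasure lborel {0..T})"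
    by (subst emeasure_PiM) auto
  also have "\<dots> < \<infinity>" by (simp add: power_less_top_ennreal emeasure_lborel_Icc_eq)
  finally show ?thesis .
qed

lemma truncated_simplex_Suc:
  assumes "x \<in> extensional {..<n}"
  shows "x(n := s) \<in> truncated_simplex (Suc n) T \<longleftrightarrow> s \<in> {0..T} \<and> x \<in> truncated_simplex n s"
proof
  assume *: "x(n := s) \<in> truncated_simplex (Suc n) T"
  have le: "(x(n := s)) i \<le> (x(n := s)) j" if "i \<le> j" "j < Suc n" for i j
    using * that unfolding truncated_simplex_def by blast
  have "(x(n := s)) i \<in> {0..T}" if "i < Suc n" for i
    using * that unfolding truncated_simplex_def by (auto simp: PiE_iff)
  note r = this
  have "s \<in> {0..T}" using r[of n] by simp
  moreover have "x i \<in> {0..s}" if "i < n" for i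
    using r[of i] le[of i n] that by auto
  moreover have "x i \<le> x j" if "i \<le> j" "j < n" for i j
    using le[of i j] that by auto
  ultimately show "s \<in> {0..T} \<and> x \<in> truncated_simplex n s"
    using assms by (auto simp: truncated_simplex_def PiE_iff)
next
  assume *: "s \<in> {0..T} \<and> x \<in> truncated_simplex n s"
  then have x: "x i \<in> {0..s}" if "i < n" for i
    using that by (auto simp: truncated_simplex_def PiE_iff)
  have le: "x i \<le> x j" if "i \<le> j" "j < n" for i j
    using * that unfolding truncated_simplex_def by blast
  have "(x(n := s)) i \<in> {0..T}" if "i < Suc n" for i
    using x[of i] * that by (auto simp: less_Suc_eq)
  moreover have "(x(n := s)) i \<le> (x(n := s)) j" if "i \<le> j" "j < Suc n" for i j
    using x[of i] le[of i j] that by (auto simp: less_Suc_eq)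
  moreover have "x(n := s) \<in> extensional {..<Suc n}"
    using assms by (auto simp: extensional_def)
  ultimately show "x(n := s) \<in> truncated_simplex (Suc n) T"
    by (auto simp: truncated_simplex_def PiE_iff)
qed

lemma simplex_integral_0: "simplex_integral g 0 T = 1"
proof -
  have "truncated_simplex 0 T = space (\<Pi>\<^sub>M i\<in>{}. lborel)"
    by (auto simp: truncated_simplex_def space_PiM)
  then show ?thesis
    by (simp add: simplex_integral_def PiM_empty set_lebesgue_integral_def space_PiM
        lebesgue_integral_count_space_finite)
qed

text \<open>Fubini with the last coordinate as outer variable. The uniform bound on the factors and
  the finite measure of the simplex give the required integrability.\<close>

lemma simplex_integral_Suc:
  assumes g [measurable]: "\<And>i. g i \<in> borel_measurable borel" and B: "\<And>i s. norm (g i s) \<le> B"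
  shows "simplex_integral g (Suc n) T = (LINT s:{0..T}|lborel. g n s * simplex_integral g n s)"
proof -
  interpret product_sigma_finite "\<lambda>_::nat. lborel :: real measure" by standard
  interpret P: finite_product_sigma_finite "\<lambda>_::nat. lborel :: real measure" "{..<n}"
    by standard auto
  interpret pair: pair_sigma_finite "\<Pi>\<^sub>M i\<in>{..<n}. (lborel :: real measure)" "lborel :: real measure" ..
  let ?M = "\<Pi>\<^sub>M i\<in>{..<n}. (lborel :: real measure)"
  let ?N = "\<Pi>\<^sub>M i\<in>{..<Suc n}. (lborel :: real measure)"
  define F where "F t = indicator (truncated_simplex (Suc n) T) t *\<^sub>R (\<Prod>i<Suc n. g i (t i))" for t
  have prodB: "norm (\<Prod>i<m. g i (t i)) \<le> B ^ m" for m t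
    unfolding prod_norm[symmetric] using prod_mono[of "{..<m}" "\<lambda>i. norm (g i (t i))" "\<lambda>_. B"] B by simp
  have Fm [measurable]: "F \<in> borel_measurable ?N"
    unfolding F_def by measurable
  have 1: "simplex_integral g (Suc n) T = integral\<^sup>L ?N F"
    by (simp only: simplex_integral_def set_lebesgue_integral_def F_def[abs_def])
  have "integrable ?N F"
    unfolding F_def
    by (rule integrableI_bounded_set_indicator[OF sets_truncated_simplex _ emeasure_truncated_simplex, where B="B ^ Suc n"])
      (use prodB in \<open>measurable, auto simp del: prod.lessThan_Suc power_Suc\<close>)
  then have "integral\<^sup>L ?N F = (\<integral>x. (\<integral>s. F (x(n := s)) \<partial>lborel) \<partial>?M)"
    using product_integral_insert[of "{..<n}" n F] by (simp add: lessThan_Suc)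
  also have "\<dots> = (\<integral>s. (\<integral>x. F (x(n := s)) \<partial>?M) \<partial>lborel)"
  proof (rule pair.Fubini_integral[symmetric])
    have meas: "(\<lambda>(x, s). F (x(n := s))) \<in> borel_measurable (?M \<Otimes>\<^sub>M lborel)"
      using measurable_compose[OF measurable_add_dim[of n "{..<n}" "\<lambda>_. lborel"], of F borel] Fm
      by (simp add: lessThan_Suc case_prod_beta)
    have null: "F (x(n := s)) = 0"
      if "x \<in> space ?M" "(x, s) \<notin> (\<Pi>\<^sub>E i\<in>{..<n}. {0..T}) \<times> {0..T}" for x s
    proof -
      have "x \<in> extensional {..<n}" using that(1) by (auto simp: space_PiM PiE_iff)
      then have "x(n := s) \<notin> truncated_simplex (Suc n) T"
        using that(2) by (auto simp: truncated_simplex_Suc truncated_simplex_def PiE_iff)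
      then show ?thesis by (simp add: F_def)
    qed
    \<comment> \<open>The integrand vanishes outside a cube of finite measure and is bounded by
      \<open>B ^ Suc n\<close>.\<close>
    show "integrable (?M \<Otimes>\<^sub>M lborel) (\<lambda>(x, s). F (x(n := s)))"
    proof (rule integrableI_bounded_set[where A="(\<Pi>\<^sub>E i\<in>{..<n}. {0..T}) \<times> {0..T}" and B="B ^ Suc n"])
      have "emeasure (?M \<Otimes>\<^sub>M lborel) ((\<Pi>\<^sub>E i\<in>{..<n}. {0..T}) \<times> {0..T})
          = (\<Prod>i<n. emeasure lborel {0..T}) * emeasure lborel {0..T}"
        by (subst lborel.emeasure_pair_measure_Times) (auto simp: emeasure_PiM intro!: sets_PiM_I_finite)
      also have "\<dots> < \<infinity>" by (simp add: power_less_top_ennreal ennreal_mult_less_top emeasure_lborel_Icc_eq)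
      finally show "emeasure (?M \<Otimes>\<^sub>M lborel) ((\<Pi>\<^sub>E i\<in>{..<n}. {0..T}) \<times> {0..T}) < \<infinity>" .
      have "norm (F t) \<le> B ^ Suc n" for t
        unfolding F_def using prodB[of t "Suc n"] norm_ge_zero[of "\<Prod>i<Suc n. g i (t i)"]
        by (auto simp: indicator_def simp del: prod.lessThan_Suc power_Suc norm_ge_zero)
      then show "AE x in ?M \<Otimes>\<^sub>M lborel. x \<in> (\<Pi>\<^sub>E i\<in>{..<n}. {0..T}) \<times> {0..T} \<longrightarrow>
          norm (case x of (x, s) \<Rightarrow> F (x(n := s))) \<le> B ^ Suc n"
        by (auto simp del: power_Suc)
      show "AE x in ?M \<Otimes>\<^sub>M lborel. x \<notin> (\<Pi>\<^sub>E i\<in>{..<n}. {0..T}) \<times> {0..T} \<longrightarrow>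
          (case x of (x, s) \<Rightarrow> F (x(n := s))) = 0"
      proof (intro AE_I2 impI)
        fix z :: "(nat \<Rightarrow> real) \<times> real"
        assume "z \<in> space (?M \<Otimes>\<^sub>M lborel)" "z \<notin> (\<Pi>\<^sub>E i\<in>{..<n}. {0..T}) \<times> {0..T}"
        then show "(case z of (x, s) \<Rightarrow> F (x(n := s))) = 0"
          using null[of "fst z" "snd z"] by (cases z) (simp add: space_pair_measure)
      qed
    qed (use meas in \<open>auto intro!: sets_PiM_I_finite\<close>)
  qed
  also have "\<dots> = (\<integral>s. indicator {0..T} s *\<^sub>R (g n s * simplex_integral g n s) \<partial>lborel)"
  proof (rule Bochner_Integration.integral_cong[OF refl])
    fix s :: real
    have "F (x(n := s)) = (indicator {0..T} s *\<^sub>R g n s) *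
        (indicator (truncated_simplex n s) x *\<^sub>R (\<Prod>i<n. g i (x i)))" if "x \<in> space ?M" for x
    proof -
      have "x \<in> extensional {..<n}" using that by (auto simp: space_PiM PiE_iff)
      moreover have "(\<Prod>i<n. g i ((x(n := s)) i)) = (\<Prod>i<n. g i (x i))"
        by (intro prod.cong) auto
      ultimately show ?thesis
        by (auto simp: F_def truncated_simplex_Suc indicator_def)
    qed
    then have "(\<integral>x. F (x(n := s)) \<partial>?M) = (\<integral>x. (indicator {0..T} s *\<^sub>R g n s) *
        (indicator (truncated_simplex n s) x *\<^sub>R (\<Prod>i<n. g i (x i))) \<partial>?M)"
      by (intro Bochner_Integration.integral_cong) auto
    also have "\<dots> = (indicator {0..T} s *\<^sub>R g n s) * simplex_integral g n s"
      by (simp only: integral_mult_right_zero simplex_integral_def set_lebesgue_integral_def)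
    finally show "(\<integral>x. F (x(n := s)) \<partial>?M) = indicator {0..T} s *\<^sub>R (g n s * simplex_integral g n s)"
      by simp
  qed
  finally show ?thesis by (simp only: 1 set_lebesgue_integral_def)
qed

text \<open>By the recursion over the last coordinate, the simplex integrals solve the same
  triangular system as \<Phi> with the same initial values. The fundamental theorem tolerates the
  finite set S of parameters without a derivative.\<close>

lemma simplex_integral_eq:
  assumes g: "\<And>i. g i \<in> borel_measurable borel" and B: "\<And>i s. norm (g i s) \<le> B"
    and cont: "\<And>i. i \<le> n \<Longrightarrow> continuous_on {0..1} (\<Phi> i)"
    and \<Phi>0: "\<And>s. s \<in> {0..1} \<Longrightarrow> \<Phi> 0 s = 1" and init: "\<And>i. i < n \<Longrightarrow> \<Phi> (Suc i) 0 = 0"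
    and S: "finite S"
    and deriv: "\<And>i s. i < n \<Longrightarrow> s \<in> {0<..<1} - S \<Longrightarrow>
      (\<Phi> (Suc i) has_vector_derivative g i s * \<Phi> i s) (at s)"
    and T: "T \<in> {0..1}"
  shows "simplex_integral g n T = \<Phi> n T"
  using T cont init deriv
proof (induction n arbitrary: T)
  case 0
  then show ?case by (simp add: simplex_integral_0 \<Phi>0)
next
  case (Suc n)
  have IH: "simplex_integral g n s = \<Phi> n s" if "s \<in> {0..1}" for s
    using Suc that by auto
  have "simplex_integral g (Suc n) T = (LINT s:{0..T}|lborel. g n s * simplex_integral g n s)"
    by (rule simplex_integral_Suc[OF g B])
  also have "\<dots> = (LINT s:{0..T}|lborel. g n s * \<Phi> n s)"
    by (rule set_lebesgue_integral_cong) (use IH Suc.prems(1) in auto)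
  \<comment> \<open>The fundamental theorem concerns the gauge integral; passing to it from the
    Lebesgue integral needs absolute integrability, here from boundedness and measurability.\<close>
  also have "\<dots> = integral {0..T} (\<lambda>s. g n s * \<Phi> n s)"
  proof (rule set_borel_integral_eq_integral(2))
    have c: "continuous_on {0..T} (\<Phi> n)"
      using Suc.prems(1) by (intro continuous_on_subset[OF Suc.prems(2)[of n]]) auto
    then have "compact (\<Phi> n ` {0..T})" by (intro compact_continuous_image) auto
    then have "bounded (\<Phi> n ` {0..T})" by (rule compact_imp_bounded)
    then obtain M where M: "\<And>s. s \<in> {0..T} \<Longrightarrow> norm (\<Phi> n s) \<le> M"
      unfolding bounded_iff by (metis imageI)
    have "(\<lambda>s. indicator {0..T} s *\<^sub>R \<Phi> n s) \<in> borel_measurable lborel"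
      using borel_measurable_continuous_on_indicator[OF _ c] by simp
    then have "(\<lambda>s. g n s * (indicator {0..T} s *\<^sub>R \<Phi> n s)) \<in> borel_measurable lborel"
      using g[of n] by (intro borel_measurable_times) auto
    then have "set_borel_measurable lborel {0..T} (\<lambda>s. g n s * \<Phi> n s)"
      by (simp add: set_borel_measurable_def)
    moreover have "norm (g n s * \<Phi> n s) \<le> B * M" if "s \<in> {0..T}" for s
      unfolding norm_mult using that B M norm_ge_zero[of "g n s"] norm_ge_zero[of "g n s"]
      by (meson mult_mono norm_ge_zero order_trans)
    ultimately show "set_integrable lborel {0..T} (\<lambda>s. g n s * \<Phi> n s)"
      unfolding set_integrable_def set_borel_measurable_def
      by (intro integrableI_bounded_set[where A="{0..T}" and B="B * M"])
        (auto simp: indicator_def emeasure_lborel_Icc_eq)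
  qed
  also have "\<dots> = \<Phi> (Suc n) T - \<Phi> (Suc n) 0"
  proof (rule integral_unique, rule fundamental_theorem_of_calculus_interior_strong[OF S])
    show "continuous_on {0..T} (\<Phi> (Suc n))"
      using Suc.prems(1) by (intro continuous_on_subset[OF Suc.prems(2)[of "Suc n"]]) auto
  qed (use Suc.prems in auto)
  finally show ?case using Suc.prems(3)[of n] by simp
qed

text \<open>The derivative condition ranges over every velocity v that c has at s, so it says
  nothing where c is not differentiable. The bounded velocity makes the simplex integral absolutely
  convergent.\<close>

lemma path_iterated_integral_eq:
  assumes c: "valid_path c" "bounded ((\<lambda>t. vector_derivative c (at t)) ` {0..1})"
    and \<omega>: "\<And>w. w \<in> set ws \<Longrightarrow> continuous_on (path_image c) w"
    and cont: "\<And>i. i \<le> length ws \<Longrightarrow> continuous_on {0..1} (\<Phi> i)"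
    and \<Phi>0: "\<And>s. s \<in> {0..1} \<Longrightarrow> \<Phi> 0 s = 1" and init: "\<And>i. i < length ws \<Longrightarrow> \<Phi> (Suc i) 0 = 0"
    and deriv: "\<And>i s v. i < length ws \<Longrightarrow> s \<in> {0<..<1} \<Longrightarrow> (c has_vector_derivative v) (at s) \<Longrightarrow>
      (\<Phi> (Suc i) has_vector_derivative (ws ! i) (c s) * v * \<Phi> i s) (at s)"
  shows "path_iterated_integral c ws = \<Phi> (length ws) 1"
proof -
  obtain S where S: "finite S" "c C1_differentiable_on ({0..1} - S)" and cc: "continuous_on {0..1} c"
    using c(1) unfolding valid_path_def piecewise_C1_differentiable_on_def by auto
  define c' where "c' t = vector_derivative c (at t)" for t
  obtain D where D: "\<And>t. t \<in> {0..1} \<Longrightarrow> norm (c' t) \<le> D"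
    using c(2) unfolding bounded_iff c'_def by (metis imageI)
  \<comment> \<open>Cutting off outside the unit interval and beyond the length of the word makes
    every \<open>g i\<close> measurable and bounded on the whole line.\<close>
  define g where "g i s = (if i < length ws then indicator {0..1} s *\<^sub>R ((ws ! i) (c s) * c' s) else 0)" for i s
  have wc: "continuous_on {0..1} (\<lambda>s. w (c s))" if "w \<in> set ws" for w
    using continuous_on_compose[OF cc, of w] \<omega>[OF that] by (simp add: path_image_def o_def)
  have "(\<lambda>s. indicator ({0..1} - S) s *\<^sub>R c' s) \<in> borel_measurable borel"
  proof (rule borel_measurable_continuous_on_indicator)
    show "{0..1} - S \<in> sets borel" using borel_closed[OF finite_imp_closed[OF S(1)]] by simp
    show "continuous_on ({0..1} - S) c'" using S(2) by (simp add: C1_differentiable_on_eq c'_def)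
  qed
  \<comment> \<open>The velocity is known to be continuous off the finite set S only; a change at
    finitely many points keeps a function measurable.\<close>
  then have c'm: "(\<lambda>s. indicator {0..1} s *\<^sub>R c' s) \<in> borel_measurable borel"
    by (rule measurable_discrete_difference[where X=S])
      (use S(1) in \<open>auto simp: indicator_def countable_finite\<close>)
  have gm: "g i \<in> borel_measurable borel" for i
  proof (cases "i < length ws")
    case True
    have "(\<lambda>s. (indicator {0..1} s *\<^sub>R (ws ! i) (c s)) * (indicator {0..1} s *\<^sub>R c' s)) \<in> borel_measurable borel"
      using True by (intro borel_measurable_times c'm borel_measurable_continuous_on_indicator wc) auto
    moreover have "(\<lambda>s. (indicator {0..1} s *\<^sub>R (ws ! i) (c s)) * (indicator {0..1} s *\<^sub>R c' s)) = g i"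
      using True by (auto simp: g_def indicator_def)
    ultimately show ?thesis by simp
  qed (simp add: g_def[abs_def])
  have "\<exists>M. \<forall>w\<in>set ws. \<forall>s\<in>{0..1}. norm (w (c s)) \<le> M"
  proof -
    have "compact ((\<lambda>s. w (c s)) ` {0..1})" if "w \<in> set ws" for w
      using wc[OF that] by (intro compact_continuous_image) auto
    then have "bounded (\<Union>w\<in>set ws. (\<lambda>s. w (c s)) ` {0..1})"
      by (intro bounded_UN) (auto intro: compact_imp_bounded)
    then show ?thesis unfolding bounded_iff by auto
  qed
  then obtain M where M: "\<And>w s. w \<in> set ws \<Longrightarrow> s \<in> {0..1} \<Longrightarrow> norm (w (c s)) \<le> M" by blast
  have D0: "0 \<le> D" by (rule order_trans[OF norm_ge_zero D[of 0]]) simp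
  \<comment> \<open>For the empty word M is unconstrained and may be negative, hence the maximum
    with 0.\<close>
  have gB: "norm (g i s) \<le> max 0 M * D" for i s
  proof (cases "i < length ws \<and> s \<in> {0..1}")
    case True
    then have "norm ((ws ! i) (c s)) * norm (c' s) \<le> max 0 M * D"
      using M[of "ws ! i" s] D[of s] D0 by (intro mult_mono) auto
    then show ?thesis using True by (auto simp: g_def norm_mult)
  qed (use D0 in \<open>auto simp: g_def indicator_def\<close>)
  have "simplex_integral g (length ws) 1 = \<Phi> (length ws) 1"
  proof (rule simplex_integral_eq[OF gm gB cont \<Phi>0 init S(1)])
    fix i s assume i: "i < length ws" and s: "s \<in> {0<..<1} - S"
    then have "c differentiable at s" using S(2) by (auto simp: C1_differentiable_on_eq)
    then have "(c has_vector_derivative c' s) (at s)"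
      by (simp add: c'_def vector_derivative_works)
    from deriv[OF i _ this] show "(\<Phi> (Suc i) has_vector_derivative g i s * \<Phi> i s) (at s)"
      using i s by (simp add: g_def)
  qed auto
  moreover have "path_iterated_integral c ws = simplex_integral g (length ws) 1"
    unfolding path_iterated_integral_def simplex_integral_def
  proof -
    have "ordered_simplex (length ws) = truncated_simplex (length ws) 1"
      by (simp add: ordered_simplex_def truncated_simplex_def)
    moreover have "(\<Prod>i<length ws. (ws ! i) (c (t i)) * vector_derivative c (at (t i)))
        = (\<Prod>i<length ws. g i (t i))" if "t \<in> truncated_simplex (length ws) 1" for t
    proof (rule prod.cong[OF refl])
      fix i assume "i \<in> {..<length ws}"
      moreover from this have "t i \<in> {0..1}" using that by (auto simp: truncated_simplex_def PiE_iff)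
      ultimately show "(ws ! i) (c (t i)) * vector_derivative c (at (t i)) = g i (t i)"
        by (simp add: g_def c'_def)
    qed
    ultimately show "set_lebesgue_integral (\<Pi>\<^sub>M i\<in>{..<length ws}. lborel) (ordered_simplex (length ws))
        (\<lambda>t. \<Prod>i<length ws. (ws ! i) (c (t i)) * vector_derivative c (at (t i))) =
      set_lebesgue_integral (\<Pi>\<^sub>M i\<in>{..<length ws}. lborel) (truncated_simplex (length ws) 1)
        (\<lambda>t. \<Prod>i<length ws. g i (t i))"
      by (auto intro!: set_lebesgue_integral_cong)
  qed
  ultimately show ?thesis by simp
qed

section \<open>Iterated integrals on the cover\<close>

text \<open>On words of holomorphic forms \<open>SOME\<close> has no freedom: primitives exist, and
  the value at x together with the extension by zero makes them unique.\<close>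

primrec cover_integral_rev ::
    "'a::topological_space set \<Rightarrow> ('a \<Rightarrow> complex) \<Rightarrow> 'a \<Rightarrow> diff_form list \<Rightarrow> 'a \<Rightarrow> complex" where
  "cover_integral_rev Ct p x [] = hol_one Ct"
| "cover_integral_rev Ct p x (w # ws) =
     (SOME G. (\<forall>y\<in>Ct. has_cover_derivative Ct p G y (w (p y) * cover_integral_rev Ct p x ws y)) \<and>
       (\<forall>y. y \<notin> Ct \<longrightarrow> G y = 0) \<and> G x = 0)"

text \<open>The last form of the word is integrated last, so the recursion runs over the reversed word.\<close>

definition cover_integral ::
    "'a::topological_space set \<Rightarrow> ('a \<Rightarrow> complex) \<Rightarrow> 'a \<Rightarrow> diff_form list \<Rightarrow> 'a \<Rightarrow> complex" where
  "cover_integral Ct p x ws = cover_integral_rev Ct p x (rev ws)"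

lemma has_vector_derivative_joinpaths:
  fixes g1 g2 :: "real \<Rightarrow> 'a::real_normed_vector"
  shows "t < 1/2 \<Longrightarrow> (g1 has_vector_derivative v) (at (2 * t)) \<Longrightarrow>
      (g1 +++ g2 has_vector_derivative 2 *\<^sub>R v) (at t)"
    and "t > 1/2 \<Longrightarrow> (g2 has_vector_derivative v) (at (2 * t - 1)) \<Longrightarrow>
      (g1 +++ g2 has_vector_derivative 2 *\<^sub>R v) (at t)"
proof -
  assume t: "t < 1/2" and "(g1 has_vector_derivative v) (at (2 * t))"
  then have "((g1 \<circ> (\<lambda>s. 2 * s)) has_vector_derivative 2 *\<^sub>R v) (at t)"
    by (intro vector_diff_chain_at) (auto intro!: derivative_eq_intros)
  then show "(g1 +++ g2 has_vector_derivative 2 *\<^sub>R v) (at t)"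
    by (rule has_vector_derivative_transform_within_open[where S="{..<1/2}"])
      (use t in \<open>auto simp: joinpaths_def\<close>)
next
  assume t: "t > 1/2" and "(g2 has_vector_derivative v) (at (2 * t - 1))"
  then have "((g2 \<circ> (\<lambda>s. 2 * s - 1)) has_vector_derivative 2 *\<^sub>R v) (at t)"
    by (intro vector_diff_chain_at) (auto intro!: derivative_eq_intros)
  then show "(g1 +++ g2 has_vector_derivative 2 *\<^sub>R v) (at t)"
    by (rule has_vector_derivative_transform_within_open[where S="{1/2<..}"])
      (use t in \<open>auto simp: joinpaths_def\<close>)
qed

text \<open>At the junction 1/2 and at the transported break points \<open>vector_derivative\<close>
  may take an uncontrolled value, but finitely many values are bounded. Everywhere else it is twice
  a velocity of one of the two pieces.\<close>

lemma bounded_vector_derivative_joinpaths: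
  fixes g1 g2 :: "real \<Rightarrow> 'a::real_normed_vector"
  assumes v: "valid_path g1" "valid_path g2"
    and b: "bounded ((\<lambda>t. vector_derivative g1 (at t)) ` {0..1})"
      "bounded ((\<lambda>t. vector_derivative g2 (at t)) ` {0..1})"
  shows "bounded ((\<lambda>t. vector_derivative (g1 +++ g2) (at t)) ` {0..1})"
proof -
  obtain S1 where S1: "finite S1" "\<And>t. t \<in> {0..1} - S1 \<Longrightarrow> g1 differentiable at t"
    using v(1) by (auto simp: valid_path_def piecewise_C1_differentiable_on_def C1_differentiable_on_eq)
  obtain S2 where S2: "finite S2" "\<And>t. t \<in> {0..1} - S2 \<Longrightarrow> g2 differentiable at t"
    using v(2) by (auto simp: valid_path_def piecewise_C1_differentiable_on_def C1_differentiable_on_eq)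
  define F where "F = insert (1/2) ((\<lambda>s. s / 2) ` S1 \<union> (\<lambda>s. (s + 1) / 2) ` S2)"
  define D1 where "D1 = (\<lambda>t. vector_derivative g1 (at t)) ` {0..1}"
  define D2 where "D2 = (\<lambda>t. vector_derivative g2 (at t)) ` {0..1}"
  let ?d = "\<lambda>t. vector_derivative (g1 +++ g2) (at t)"
  have "?d t \<in> ((*\<^sub>R) 2 ` D1 \<union> (*\<^sub>R) 2 ` D2) \<union> ?d ` F" if t: "t \<in> {0..1}" for t
  proof (cases "t \<in> F")
    case False
    consider "t < 1/2" | "t > 1/2" using False by (force simp: F_def)
    then show ?thesis
    proof cases
      case 1
      have "(2 * t) / 2 \<in> F" if "2 * t \<in> S1" using that unfolding F_def by blast
      with False have "2 * t \<notin> S1" by auto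
      then have "(g1 has_vector_derivative vector_derivative g1 (at (2 * t))) (at (2 * t))"
        using S1(2)[of "2 * t"] 1 t by (auto simp: vector_derivative_works)
      then have "?d t = 2 *\<^sub>R vector_derivative g1 (at (2 * t))"
        by (intro vector_derivative_at has_vector_derivative_joinpaths(1) 1)
      then show ?thesis using 1 t by (auto simp: D1_def)
    next
      case 2
      have "((2 * t - 1) + 1) / 2 \<in> F" if "2 * t - 1 \<in> S2" using that unfolding F_def by blast
      with False have "2 * t - 1 \<notin> S2" by auto
      then have "(g2 has_vector_derivative vector_derivative g2 (at (2 * t - 1))) (at (2 * t - 1))"
        using S2(2)[of "2 * t - 1"] 2 t by (auto simp: vector_derivative_works)
      then have "?d t = 2 *\<^sub>R vector_derivative g2 (at (2 * t - 1))"
        by (intro vector_derivative_at has_vector_derivative_joinpaths(2) 2)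
      then show ?thesis using 2 t by (auto simp: D2_def)
    qed
  qed auto
  then have "?d ` {0..1} \<subseteq> ((*\<^sub>R) 2 ` D1 \<union> (*\<^sub>R) 2 ` D2) \<union> ?d ` F" by blast
  moreover have "finite F" using S1(1) S2(1) by (simp add: F_def)
  then have "bounded (((*\<^sub>R) 2 ` D1 \<union> (*\<^sub>R) 2 ` D2) \<union> ?d ` F)"
    using bounded_scaling[OF b(1), of 2] bounded_scaling[OF b(2), of 2]
      finite_imp_bounded[OF finite_imageI[of F ?d]] by (simp add: D1_def D2_def)
  ultimately show ?thesis by (rule bounded_subset[rotated])
qed

lemma cover_path_join:
  assumes "cover_path Ct p x y \<gamma>\<^sub>1" "cover_path Ct p y z \<gamma>\<^sub>2"
  shows "cover_path Ct p x z (\<gamma>\<^sub>1 +++ \<gamma>\<^sub>2)"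
proof -
  have c: "p \<circ> (\<gamma>\<^sub>1 +++ \<gamma>\<^sub>2) = (p \<circ> \<gamma>\<^sub>1) +++ (p \<circ> \<gamma>\<^sub>2)"
    by (auto simp: joinpaths_def)
  have "pathfinish (p \<circ> \<gamma>\<^sub>1) = pathstart (p \<circ> \<gamma>\<^sub>2)"
    using assms by (simp add: cover_path_def pathfinish_def pathstart_def)
  moreover have "path_image (\<gamma>\<^sub>1 +++ \<gamma>\<^sub>2) \<subseteq> Ct"
    using assms by (intro subset_trans[OF path_image_join_subset]) (auto simp: cover_path_def)
  ultimately show ?thesis
    using assms unfolding cover_path_def c
    by (auto intro!: valid_path_join bounded_vector_derivative_joinpaths)
qed

section \<open>Path independence of iterated integrals on the cover\<close>

context simply_connected_cover
begin

lemma cover_path_disc: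
  assumes c: "cover_chart Ct p U q" "p ` U = ball z r" and ab: "a \<in> U" "b \<in> U"
  shows "\<exists>\<gamma>. cover_path Ct p a b \<gamma>"
proof -
  define l where "l = linepath (p a) (p b)"
  define \<gamma> where "\<gamma> t = q (l t)" for t
  have lim: "l t \<in> p ` U" if "t \<in> {0..1}" for t
  proof -
    have "p a \<in> ball z r" "p b \<in> ball z r" using ab c(2) by blast+
    then have "closed_segment (p a) (p b) \<subseteq> ball z r" by (intro closed_segment_subset) auto
    moreover have "l t \<in> closed_segment (p a) (p b)" using that by (simp add: l_def linepath_in_path)
    ultimately show ?thesis using c(2) by blast
  qed
  have pg: "(p \<circ> \<gamma>) t = l t" if "l t \<in> p ` U" for t
    using cover_chartD(8)[OF c(1) that] by (simp add: \<gamma>_def)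
  \<comment> \<open>The straight line stays in the disc slightly beyond both ends, so the two-sided
    derivatives at 0 and 1 exist as well.\<close>
  have op: "open (l -` (p ` U))"
    by (rule open_vimage[OF cover_chartD(3)[OF c(1)]]) (auto simp: l_def linepath_def intro!: continuous_intros)
  have d: "((p \<circ> \<gamma>) has_vector_derivative p b - p a) (at t)" if "t \<in> {0..1}" for t
  proof (rule has_vector_derivative_transform_within_open[where f=l and S="l -` (p ` U)"])
    show "(l has_vector_derivative p b - p a) (at t)"
      using has_vector_derivative_linepath_within[of "p a" "p b" t UNIV] by (simp add: l_def)
  qed (use op lim[OF that] pg in auto)
  have "continuous_on {0..1} \<gamma>"
    unfolding \<gamma>_def
    by (rule continuous_on_compose2[OF cover_chartD(5)[OF c(1)]])
      (use lim in \<open>auto simp: l_def linepath_def intro!: continuous_intros\<close>)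
  moreover have "\<gamma> ` {0..1} \<subseteq> Ct"
    using lim cover_chartD(1,7)[OF c(1)] by (auto simp: \<gamma>_def)
  moreover have "\<gamma> 0 = a" "\<gamma> 1 = b"
    using cover_chartD(6)[OF c(1)] ab by (auto simp: \<gamma>_def l_def linepath_def)
  moreover have "(p \<circ> \<gamma>) C1_differentiable_on {0..1}"
    unfolding C1_differentiable_on_def using d by (intro exI[of _ "\<lambda>_. p b - p a"]) auto
  then have "valid_path (p \<circ> \<gamma>)"
    unfolding valid_path_def by (rule C1_differentiable_imp_piecewise)
  moreover have "bounded ((\<lambda>t. vector_derivative (p \<circ> \<gamma>) (at t)) ` {0..1})"
    by (rule bounded_subset[of "{p b - p a}"]) (use vector_derivative_at[OF d] in auto)
  ultimately show ?thesis
    unfolding cover_path_def path_def path_image_def pathstart_def pathfinish_def by blast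
qed

text \<open>Path connectedness yields merely continuous paths. Instead, reachability from x by an
  admissible path is shown to be locally constant, by appending segments inside disc charts.\<close>

lemma ex_cover_path:
  assumes "x \<in> Ct" "y \<in> Ct"
  obtains \<gamma> where "cover_path Ct p x y \<gamma>"
proof -
  have "(\<exists>\<gamma>. cover_path Ct p x x \<gamma>) = (\<exists>\<gamma>. cover_path Ct p x y \<gamma>)"
  proof (rule connected_local_const[OF connected_cover assms], rule ballI)
    fix a assume a: "a \<in> Ct"
    obtain U q r where U: "U \<subseteq> Ct" "a \<in> U" "cover_chart Ct p U q" "r > 0" "p ` U = ball (p a) r"
      using disc_chart_at[OF a] .
    have "(\<exists>\<gamma>. cover_path Ct p x a \<gamma>) = (\<exists>\<gamma>. cover_path Ct p x b \<gamma>)" if "b \<in> U" for b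
      using cover_path_disc[OF U(3,5,2) that] cover_path_disc[OF U(3,5) that U(2)] cover_path_join
      by metis
    moreover obtain V where "open V" "U = Ct \<inter> V"
      using cover_chartD(2)[OF U(3)] by (auto simp: openin_open)
    ultimately show "\<forall>\<^sub>F b in at a within Ct.
        (\<exists>\<gamma>. cover_path Ct p x a \<gamma>) = (\<exists>\<gamma>. cover_path Ct p x b \<gamma>)"
      unfolding eventually_at_topological using U(2) by blast
  qed
  moreover obtain U q r where "U \<subseteq> Ct" "x \<in> U" "cover_chart Ct p U q" "r > 0" "p ` U = ball (p x) r"
    using disc_chart_at[OF assms(1)] .
  ultimately show ?thesis using cover_path_disc that by metis
qed

abbreviation "forms \<equiv> {w. w holomorphic_on C}"
abbreviation "J \<equiv> cover_integral Ct p"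

lemma form_deriv:
  assumes "w \<in> forms" "y \<in> Ct"
  shows "\<exists>d. hcd (\<lambda>y. w (p y)) y d"
proof -
  obtain d where "(w has_field_derivative d) (at (p y))"
    using assms p_in_base[OF assms(2)] open_base by (auto simp: holomorphic_on_open)
  then show ?thesis using hcd_compose_p[OF assms(2)] by blast
qed

lemma hcd_hol_one: "y \<in> Ct \<Longrightarrow> hcd (hol_one Ct) y 0"
  by (rule has_cover_derivative_cong[OF hcd_const[of y 1]]) (auto simp: hol_one_def)

lemma J_Nil: "J x [] = hol_one Ct"
  by (simp add: cover_integral_def)

text \<open>The primitive for a longer word exists because the integral of the shorter one is
  holomorphic, so differentiability is carried along with the defining equation.\<close>

lemma J_aux:
  assumes "ws \<in> lists forms" "x \<in> Ct"
  shows "(\<forall>y\<in>Ct. \<exists>d. hcd (J x ws) y d) \<and> (\<forall>y. y \<notin> Ct \<longrightarrow> J x ws y = 0)"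
    "w \<in> forms \<Longrightarrow> (\<forall>y\<in>Ct. hcd (J x (ws @ [w])) y (w (p y) * J x ws y)) \<and>
       (\<forall>y. y \<notin> Ct \<longrightarrow> J x (ws @ [w]) y = 0) \<and> J x (ws @ [w]) x = 0"
proof -
  have step: "(\<forall>y\<in>Ct. hcd (J x (vs @ [v])) y (v (p y) * J x vs y)) \<and>
       (\<forall>y. y \<notin> Ct \<longrightarrow> J x (vs @ [v]) y = 0) \<and> J x (vs @ [v]) x = 0"
    if h: "\<forall>y\<in>Ct. \<exists>d. hcd (J x vs) y d" and v: "v \<in> forms" for vs v
  proof -
    have "\<exists>d. hcd (\<lambda>y. v (p y) * J x vs y) y d" if "y \<in> Ct" for y
      using form_deriv[OF v that] h that has_cover_derivative_mult by blast
    then obtain G where "\<And>y. y \<in> Ct \<Longrightarrow> hcd G y (v (p y) * J x vs y)" "\<And>y. y \<notin> Ct \<Longrightarrow> G y = 0"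
        "G x = 0"
      using ex_primitive_at[OF _ assms(2), of "\<lambda>y. v (p y) * J x vs y" 0] by auto
    then have "\<exists>G. (\<forall>y\<in>Ct. hcd G y (v (p y) * J x vs y)) \<and> (\<forall>y. y \<notin> Ct \<longrightarrow> G y = 0) \<and> G x = 0"
      by blast
    from someI_ex[OF this] show ?thesis by (simp add: cover_integral_def)
  qed
  show 1: "(\<forall>y\<in>Ct. \<exists>d. hcd (J x ws) y d) \<and> (\<forall>y. y \<notin> Ct \<longrightarrow> J x ws y = 0)"
    using assms(1)
  proof (induction ws rule: rev_induct)
    case Nil
    then show ?case using hcd_hol_one by (auto simp: J_Nil hol_one_def)
  next
    case (snoc w ws)
    then show ?case using step[of ws w] by (auto simp: snoc)
  qed
  show "(\<forall>y\<in>Ct. hcd (J x (ws @ [w])) y (w (p y) * J x ws y)) \<and>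
       (\<forall>y. y \<notin> Ct \<longrightarrow> J x (ws @ [w]) y = 0) \<and> J x (ws @ [w]) x = 0" if "w \<in> forms"
    using step[OF _ that] 1 by blast
qed

lemma J_hcd: "ws \<in> lists forms \<Longrightarrow> x \<in> Ct \<Longrightarrow> y \<in> Ct \<Longrightarrow> \<exists>d. hcd (J x ws) y d"
  and J_out: "ws \<in> lists forms \<Longrightarrow> x \<in> Ct \<Longrightarrow> y \<notin> Ct \<Longrightarrow> J x ws y = 0"
  and J_snoc: "ws \<in> lists forms \<Longrightarrow> w \<in> forms \<Longrightarrow> x \<in> Ct \<Longrightarrow> y \<in> Ct \<Longrightarrow>
      hcd (J x (ws @ [w])) y (w (p y) * J x ws y)"
  and J_start: "ws \<in> lists forms \<Longrightarrow> w \<in> forms \<Longrightarrow> x \<in> Ct \<Longrightarrow> J x (ws @ [w]) x = 0"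
  using J_aux[of ws x] by auto

text \<open>Along \<gamma>, the integrals of the prefixes of \<open>ws\<close> form the triangular
  system of \<open>path_iterated_integral_eq\<close>.\<close>

lemma path_iterated_integral_cover:
  assumes ws: "ws \<in> lists forms" and x: "x \<in> Ct" and \<gamma>: "cover_path Ct p x y \<gamma>"
  shows "path_iterated_integral (p \<circ> \<gamma>) ws = J x ws y"
proof -
  have \<gamma>': "continuous_on {0..1} \<gamma>" "\<gamma> ` {0..1} \<subseteq> Ct" "\<gamma> 0 = x" "\<gamma> 1 = y"
      "valid_path (p \<circ> \<gamma>)" "bounded ((\<lambda>t. vector_derivative (p \<circ> \<gamma>) (at t)) ` {0..1})"
    using \<gamma> by (auto simp: cover_path_def path_def path_image_def pathstart_def pathfinish_def)
  have tk: "take i ws \<in> lists forms" for i using ws by (auto dest: in_set_takeD)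
  have nth: "ws ! i \<in> forms" if "i < length ws" for i using ws that by (meson in_listsD nth_mem)
  have Suc: "take (Suc i) ws = take i ws @ [ws ! i]" if "i < length ws" for i
    using that by (simp add: take_Suc_conv_app_nth)
  have "path_iterated_integral (p \<circ> \<gamma>) ws = (\<lambda>i s. J x (take i ws) (\<gamma> s)) (length ws) 1"
  proof (rule path_iterated_integral_eq[OF \<gamma>'(5,6)])
    fix w assume "w \<in> set ws"
    then have "continuous_on C w"
      using ws by (auto intro: holomorphic_on_imp_continuous_on)
    then show "continuous_on (path_image (p \<circ> \<gamma>)) w"
      by (rule continuous_on_subset) (use \<gamma>'(2) p_in_base in \<open>auto simp: path_image_def\<close>)
  next
    fix i
    have "continuous_on Ct (J x (take i ws))"
      using J_hcd[OF tk x] by (rule continuous_on_hcd)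
    then show "continuous_on {0..1} (\<lambda>s. J x (take i ws) (\<gamma> s))"
      by (rule continuous_on_compose2[OF _ \<gamma>'(1,2)])
  next
    fix i s v assume i: "i < length ws" and s: "s \<in> {0<..<1}"
      and v: "(p \<circ> \<gamma> has_vector_derivative v) (at s)"
    have "\<gamma> s \<in> Ct" using s \<gamma>'(2) by auto
    have at: "at s within {0<..<1} = at s" using s by (intro at_within_open) auto
    have "((\<lambda>s. J x (take (Suc i) ws) (\<gamma> s)) has_vector_derivative
        ((ws ! i) (p (\<gamma> s)) * J x (take i ws) (\<gamma> s)) * v) (at s within {0<..<1})"
    proof (rule has_cover_derivative_path[where p=p and \<gamma>=\<gamma>])
      show "hcd (J x (take (Suc i) ws)) (\<gamma> s) ((ws ! i) (p (\<gamma> s)) * J x (take i ws) (\<gamma> s))"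
        unfolding Suc[OF i] by (rule J_snoc[OF tk nth[OF i] x \<open>\<gamma> s \<in> Ct\<close>])
      have "continuous_on {0<..<1} \<gamma>" using \<gamma>'(1) by (rule continuous_on_subset) auto
      then show "(\<gamma> \<longlongrightarrow> \<gamma> s) (at s within {0<..<1})" using s by (simp add: continuous_on_def)
      show "((\<lambda>s. p (\<gamma> s)) has_vector_derivative v) (at s within {0<..<1})"
        using v by (simp add: at o_def)
    qed (use s \<gamma>'(2) in auto)
    then show "((\<lambda>s. J x (take (Suc i) ws) (\<gamma> s)) has_vector_derivative
        (ws ! i) ((p \<circ> \<gamma>) s) * v * J x (take i ws) (\<gamma> s)) (at s)"
      by (simp only: at o_apply mult_ac)
  next
    fix s :: real assume "s \<in> {0..1}"
    then show "J x (take 0 ws) (\<gamma> s) = 1" using \<gamma>'(2) by (auto simp: J_Nil hol_one_def)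
  next
    fix i assume "i < length ws"
    then show "J x (take (Suc i) ws) (\<gamma> 0) = 0"
      using J_start[OF tk nth x] \<gamma>'(3) by (simp add: Suc)
  qed
  then show ?thesis using \<gamma>'(4) by simp
qed

text \<open>\<open>J\<close> does not mention a path, so a common value exists; it is unique because
  at least one admissible path joins x to y.\<close>

lemma iterated_integral_eq:
  assumes "ws \<in> lists forms" "x \<in> Ct" "y \<in> Ct"
  shows "iterated_integral Ct p x ws y = J x ws y"
proof -
  obtain \<gamma> where "cover_path Ct p x y \<gamma>" using ex_cover_path[OF assms(2,3)] .
  then show ?thesis
    unfolding iterated_integral_def
    using path_iterated_integral_cover[OF assms(1,2)] by (intro the_equality) auto
qed

end

section \<open>Shuffle algebras and multilinearity\<close>

definition linear_extension :: "('b list \<Rightarrow> complex) \<Rightarrow> 'b word_comb \<Rightarrow> complex" where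
  "linear_extension F t = (\<Sum>w\<in>Poly_Mapping.keys t. Poly_Mapping.lookup t w * F w)"

lemma linear_extension_superset:
  assumes "finite X" "Poly_Mapping.keys t \<subseteq> X"
  shows "linear_extension F t = (\<Sum>w\<in>X. Poly_Mapping.lookup t w * F w)"
  unfolding linear_extension_def using assms
  by (intro sum.mono_neutral_left) (auto simp: in_keys_iff)

lemma lookup_scale_comb [simp]:
  "Poly_Mapping.lookup (scale_comb c t) w = c * Poly_Mapping.lookup t w"
  by (simp add: scale_comb_def map.rep_eq when_def)

lemma keys_scale_comb: "Poly_Mapping.keys (scale_comb c t) \<subseteq> Poly_Mapping.keys t"
  by (auto simp: in_keys_iff)

interpretation word_comb: module "scale_comb :: complex \<Rightarrow> 'b word_comb \<Rightarrow> 'b word_comb"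
  by unfold_locales (auto intro!: poly_mapping_eqI simp: lookup_add algebra_simps)

lemma linear_extension_add: "linear_extension F (s + t) = linear_extension F s + linear_extension F t"
proof -
  let ?X = "Poly_Mapping.keys s \<union> Poly_Mapping.keys t"
  have "Poly_Mapping.keys (s + t) \<subseteq> ?X" by (rule keys_add)
  then show ?thesis
    by (subst (1 2 3) linear_extension_superset[of ?X])
      (auto simp: lookup_add algebra_simps sum.distrib)
qed

lemma linear_extension_scale: "linear_extension F (scale_comb c t) = c * linear_extension F t"
  by (subst linear_extension_superset[OF finite_keys keys_scale_comb])
    (simp add: linear_extension_def sum_distrib_left mult.assoc)

lemma linear_extension_word [simp]: "linear_extension F (word w) = F w"
  by (simp add: linear_extension_def word_def)

lemma linear_extension_0 [simp]: "linear_extension F 0 = 0"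
  by (simp add: linear_extension_def)

lemma linear_extension_diff: "linear_extension F (s - t) = linear_extension F s - linear_extension F t"
  using linear_extension_add[of F "s - t" t] by simp

lemma linear_extension_sum: "linear_extension F (sum f X) = (\<Sum>i\<in>X. linear_extension F (f i))"
  by (induction X rule: infinite_finite_induct) (auto simp: linear_extension_add)

lemma linear_extension_sum_list:
  "linear_extension F (\<Sum>w\<leftarrow>ws. f w) = (\<Sum>w\<leftarrow>ws. linear_extension F (f w))"
  by (induction ws) (auto simp: linear_extension_add)

lemma word_comb_expand: "t = (\<Sum>w\<in>Poly_Mapping.keys t. scale_comb (Poly_Mapping.lookup t w) (word w))"
proof (rule poly_mapping_eqI)
  fix v
  show "Poly_Mapping.lookup t v =
      Poly_Mapping.lookup (\<Sum>w\<in>Poly_Mapping.keys t. scale_comb (Poly_Mapping.lookup t w) (word w)) v"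
    by (cases "v \<in> Poly_Mapping.keys t")
      (auto simp: lookup_sum word_def lookup_single when_def in_keys_iff
        sum.delta if_distrib cong: if_cong)
qed

lemma keys_word [simp]: "Poly_Mapping.keys (word w) = {w}"
  by (simp add: word_def)

lemma keys_sum_subset:
  assumes "\<And>i. i \<in> X \<Longrightarrow> Poly_Mapping.keys (f i) \<subseteq> K"
  shows "Poly_Mapping.keys (sum f X) \<subseteq> K"
  using assms
proof (induction X rule: infinite_finite_induct)
  case (insert i X)
  then show ?case using keys_add[of "f i" "sum f X"] by (simp add: subset_iff) blast
qed auto

lemma keys_sum_list_word: "Poly_Mapping.keys (\<Sum>w\<leftarrow>ws. word w :: 'b word_comb) \<subseteq> set ws"
proof (induction ws)
  case (Cons w ws)
  then show ?case
    using keys_add[of "word w :: 'b word_comb" "\<Sum>w\<leftarrow>ws. word w"] by auto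
qed auto

lemma word_in_Sh: "w \<in> lists A \<Longrightarrow> word w \<in> Sh A"
  by (simp add: Sh_def)

lemma Sh_add: "s \<in> Sh A \<Longrightarrow> t \<in> Sh A \<Longrightarrow> s + t \<in> Sh A"
  unfolding Sh_def using keys_add[of s t] by blast

lemma Sh_scale: "t \<in> Sh A \<Longrightarrow> scale_comb c t \<in> Sh A"
  unfolding Sh_def using keys_scale_comb[of c t] by blast

lemma Sh_sum: "(\<And>i. i \<in> X \<Longrightarrow> f i \<in> Sh A) \<Longrightarrow> sum f X \<in> Sh A"
  unfolding Sh_def using keys_sum_subset[of X f "lists A"] by blast

lemma word_shuffles_Nil2 [simp]: "word_shuffles u [] = [u]"
  by (cases u) auto

lemma set_word_shuffles: "w \<in> set (word_shuffles u v) \<Longrightarrow> set w = set u \<union> set v"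
  by (induction u v arbitrary: w rule: word_shuffles.induct) fastforce+

lemma length_word_shuffles: "w \<in> set (word_shuffles u v) \<Longrightarrow> length w = length u + length v"
  by (induction u v arbitrary: w rule: word_shuffles.induct) fastforce+

lemma shuffle_prod_in_Sh:
  assumes "t \<in> Sh A" "t' \<in> Sh A"
  shows "shuffle_prod t t' \<in> Sh A"
  unfolding shuffle_prod_def
proof (intro Sh_sum Sh_scale)
  fix u v assume "u \<in> Poly_Mapping.keys t" "v \<in> Poly_Mapping.keys t'"
  then have "u \<in> lists A" "v \<in> lists A" using assms by (auto simp: Sh_def)
  then have "set (word_shuffles u v) \<subseteq> lists A"
    using set_word_shuffles[of _ u v] by (fastforce simp: in_lists_conv_set)
  then show "(\<Sum>w\<leftarrow>word_shuffles u v. word w) \<in> Sh A"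
    using keys_sum_list_word[of "word_shuffles u v"] by (auto simp: Sh_def)
qed

lemma linear_extension_shuffle_prod:
  assumes "\<And>u v. u \<in> Poly_Mapping.keys t \<Longrightarrow> v \<in> Poly_Mapping.keys t' \<Longrightarrow>
      (\<Sum>w\<leftarrow>word_shuffles u v. F w) = F u * F v"
  shows "linear_extension F (shuffle_prod t t') = linear_extension F t * linear_extension F t'"
proof -
  have "linear_extension F (shuffle_prod t t') =
     (\<Sum>u\<in>Poly_Mapping.keys t. \<Sum>v\<in>Poly_Mapping.keys t'.
        Poly_Mapping.lookup t u * Poly_Mapping.lookup t' v * (F u * F v))"
    unfolding shuffle_prod_def linear_extension_sum linear_extension_scale linear_extension_sum_list
    using assms by (intro sum.cong refl) simp
  then show ?thesis
    by (simp add: linear_extension_def sum_product mult_ac)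
qed

lemma shuffle_prod_word: "shuffle_prod (word u) (word v) = (\<Sum>w\<leftarrow>word_shuffles u v. word w)"
  by (simp add: shuffle_prod_def word_def)

text \<open>The shuffles are defined by recursion on first letters, while iterated integrals are
  differentiated by removing last letters.\<close>

lemma word_shuffles_snoc:
  "mset (word_shuffles (u @ [a]) (v @ [b])) =
     image_mset (\<lambda>w. w @ [a]) (mset (word_shuffles u (v @ [b]))) +
     image_mset (\<lambda>w. w @ [b]) (mset (word_shuffles (u @ [a]) v))"
proof (induction "length u + length v" arbitrary: u v rule: less_induct)
  case less
  show ?case
  proof (cases u)
    case Nil
    show ?thesis
    proof (cases v)
      case (Cons y v')
      then show ?thesis using less[of "[]" v'] Nil by (simp add: multiset.map_comp o_def)
    qed (simp add: Nil)
  next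
    case u: (Cons x u')
    show ?thesis
    proof (cases v)
      case Nil
      then show ?thesis using less[of u' "[]"] u by (simp add: multiset.map_comp o_def)
    next
      case v: (Cons y v')
      then show ?thesis using less[of u' v] less[of u v'] u
        by (simp add: multiset.map_comp o_def)
    qed
  qed
qed

text \<open>Sums forget the order of a list, so the recursion by last letters is only needed for
  multisets.\<close>

lemma sum_word_shuffles_snoc:
  fixes F :: "'b list \<Rightarrow> 'c::comm_monoid_add"
  shows "(\<Sum>w\<leftarrow>word_shuffles (u @ [a]) (v @ [b]). F w) =
    (\<Sum>w\<leftarrow>word_shuffles u (v @ [b]). F (w @ [a])) + (\<Sum>w\<leftarrow>word_shuffles (u @ [a]) v. F (w @ [b]))"
proof -
  have s: "(\<Sum>w\<leftarrow>ws. G w) = (\<Sum>w\<in>#mset ws. G w)" for ws :: "'b list list" and G :: "_ \<Rightarrow> 'c"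
    by (simp add: sum_mset_sum_list flip: mset_map)
  show ?thesis
    unfolding s word_shuffles_snoc by (simp add: multiset.map_comp o_def)
qed

section \<open>Iterated integrals on classes of tensors of regular forms\<close>

lemma dlog_form_regular:
  assumes "finite A" "s \<in> A"
  shows "dlog_form A s \<in> regular_forms A"
proof -
  \<comment> \<open>Common denominator of all punctures, with exponent 1.\<close>
  have "1 / (z - s) = poly (\<Prod>a\<in>A - {s}. [:- a, 1:]) z / (\<Prod>a\<in>A. z - a) ^ 1"
    if "z \<in> curve A" for z
  proof -
    have "(\<Prod>a\<in>A. z - a) = (z - s) * (\<Prod>a\<in>A - {s}. z - a)"
      using assms by (rule prod.remove)
    moreover have "(\<Prod>a\<in>A - {s}. z - a) \<noteq> 0"
      using that assms by (auto simp: curve_def)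
    moreover have "poly (\<Prod>a\<in>A - {s}. [:- a, 1:]) z = (\<Prod>a\<in>A - {s}. z - a)"
      by (simp add: poly_prod)
    ultimately show ?thesis by simp
  qed
  then have "dlog_form A s = (\<lambda>z. if z \<in> curve A
      then poly (\<Prod>a\<in>A - {s}. [:- a, 1:]) z / (\<Prod>a\<in>A. z - a) ^ 1 else 0)"
    by (auto simp: dlog_form_def)
  then show ?thesis
    unfolding regular_forms_def regular_functions_def by blast
qed

lemma regular_forms_holomorphic:
  assumes "finite A" "g \<in> regular_forms A"
  shows "g holomorphic_on curve A"
proof -
  obtain P n where g: "g = (\<lambda>z. if z \<in> curve A then poly P z / (\<Prod>s\<in>A. z - s) ^ n else 0)"
    using assms(2) unfolding regular_forms_def regular_functions_def by blast
  have "(\<lambda>z. poly P z / (\<Prod>s\<in>A. z - s) ^ n) holomorphic_on curve A"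
    using assms(1) by (auto intro!: holomorphic_intros simp: curve_def)
  then show ?thesis by (rule holomorphic_transform) (simp add: g)
qed

locale punctured_plane_cover =
  fixes A :: "complex set" and Ct :: "'a::topological_space set" and p :: "'a \<Rightarrow> complex"
  assumes finite_A: "finite A" and universal: "universal_cover Ct p (curve A)"

sublocale punctured_plane_cover \<subseteq> simply_connected_cover Ct p "curve A"
proof
  show "open (curve A)"
    using finite_A by (simp add: curve_def finite_imp_closed open_Compl)
qed (use universal in \<open>auto simp: universal_cover_def\<close>)

context punctured_plane_cover
begin

lemma regular_forms_subset: "regular_forms A \<subseteq> forms"
  using regular_forms_holomorphic[OF finite_A] by blast

lemma dlog_words: "w \<in> lists A \<Longrightarrow> map (dlog_form A) w \<in> lists (regular_forms A)"
  using dlog_form_regular[OF finite_A] by auto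

lemma J_eqI:
  assumes "\<And>y. y \<in> Ct \<Longrightarrow> hcd f y (h y)" "\<And>y. y \<in> Ct \<Longrightarrow> hcd g y (h y)" "x \<in> Ct" "f x = g x"
    "\<And>y. y \<notin> Ct \<Longrightarrow> f y = g y"
  shows "f = g"
  using hcd_eqI[OF assms(1,2,3,4)] assms(5) by blast

text \<open>This makes \<open>I_map\<close> well defined on classes. Induction on the forms after
  the varied slot: the base case is linearity in the last slot, and a further form preserves the
  identity because both sides get the same derivative and vanish at x.\<close>

lemma J_multilinear:
  assumes u: "u \<in> lists forms" and f: "f \<in> forms" and g: "g \<in> forms"
    and x: "x \<in> Ct" and v: "v \<in> lists forms"
  shows "J x (u @ [\<lambda>z. a * f z + b * g z] @ v) =
    (\<lambda>y. a * J x (u @ [f] @ v) y + b * J x (u @ [g] @ v) y)"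
  using v
proof (induction v rule: rev_induct)
  case Nil
  have h: "(\<lambda>z. a * f z + b * g z) \<in> forms"
    using f g by (auto intro!: holomorphic_intros)
  show ?case unfolding append_Nil2
  proof (rule J_eqI[OF J_snoc[OF u h x] _ x])
    fix y assume y: "y \<in> Ct"
    show "hcd (\<lambda>y. a * J x (u @ [f]) y + b * J x (u @ [g]) y) y ((a * f (p y) + b * g (p y)) * J x u y)"
      using has_cover_derivative_add[OF has_cover_derivative_cmult[OF J_snoc[OF u f x y], of a]
          has_cover_derivative_cmult[OF J_snoc[OF u g x y], of b]]
      by (simp add: algebra_simps)
  next
    show "J x (u @ [\<lambda>z. a * f z + b * g z]) x = a * J x (u @ [f]) x + b * J x (u @ [g]) x"
      using J_start[OF u _ x] f g h by simp
  next
    fix y assume "y \<notin> Ct"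
    then show "J x (u @ [\<lambda>z. a * f z + b * g z]) y = a * J x (u @ [f]) y + b * J x (u @ [g]) y"
      using J_out[OF _ x, of _ y] u f g h by simp
  qed
next
  case (snoc w v)
  have w: "w \<in> forms" and v: "v \<in> lists forms" using snoc.prems by auto
  have h: "(\<lambda>z. a * f z + b * g z) \<in> forms"
    using f g by (auto intro!: holomorphic_intros)
  have L: "u @ [f] @ v \<in> lists forms" "u @ [g] @ v \<in> lists forms"
      "u @ [\<lambda>z. a * f z + b * g z] @ v \<in> lists forms"
    using u v f g h by auto
  have "J x ((u @ [\<lambda>z. a * f z + b * g z] @ v) @ [w]) =
      (\<lambda>y. a * J x ((u @ [f] @ v) @ [w]) y + b * J x ((u @ [g] @ v) @ [w]) y)"
  proof (rule J_eqI[OF J_snoc[OF L(3) w x] _ x])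
    fix y assume y: "y \<in> Ct"
    show "hcd (\<lambda>y. a * J x ((u @ [f] @ v) @ [w]) y + b * J x ((u @ [g] @ v) @ [w]) y) y
        (w (p y) * J x (u @ [\<lambda>z. a * f z + b * g z] @ v) y)"
      unfolding snoc.IH[OF v]
      using has_cover_derivative_add[OF has_cover_derivative_cmult[OF J_snoc[OF L(1) w x y], of a]
          has_cover_derivative_cmult[OF J_snoc[OF L(2) w x y], of b]]
      by (simp add: algebra_simps)
  next
    show "J x ((u @ [\<lambda>z. a * f z + b * g z] @ v) @ [w]) x =
        a * J x ((u @ [f] @ v) @ [w]) x + b * J x ((u @ [g] @ v) @ [w]) x"
      using J_start[OF L(1) w x] J_start[OF L(2) w x] J_start[OF L(3) w x] by simp
  next
    fix y assume "y \<notin> Ct"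
    then show "J x ((u @ [\<lambda>z. a * f z + b * g z] @ v) @ [w]) y =
        a * J x ((u @ [f] @ v) @ [w]) y + b * J x ((u @ [g] @ v) @ [w]) y"
      using J_out[OF _ x, of "(u @ [f] @ v) @ [w]" y] J_out[OF _ x, of "(u @ [g] @ v) @ [w]" y]
        J_out[OF _ x, of "(u @ [\<lambda>z. a * f z + b * g z] @ v) @ [w]" y] L w by simp
  qed
  then show ?case by simp
qed

text \<open>Integration kills the span of the multilinear relations, so all representatives give one
  value; t itself is a representative, so the description in \<open>I_map\<close> has exactly one
  solution.\<close>

lemma I_map_forms_class:
  assumes t: "Poly_Mapping.keys t \<subseteq> lists (regular_forms A)" and x: "x \<in> Ct" and y: "y \<in> Ct"
  shows "I_map Ct p x (forms_class A t) y = linear_extension (\<lambda>ws. J x ws y) t"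
proof -
  let ?I = "\<lambda>ws. iterated_integral Ct p x ws y"
  have I: "?I ws = J x ws y" if "ws \<in> lists forms" for ws
    using iterated_integral_eq[OF that x y] .
  have 0: "linear_extension ?I r = 0" if "r \<in> module.span scale_comb (multilinear_relations A)" for r
    using that
  proof (induction r rule: word_comb.span_induct_alt)
    case (step c r s)
    from step(1) obtain u v f g a b where r: "r = word (u @ [\<lambda>z. a * f z + b * g z] @ v)
        - scale_comb a (word (u @ [f] @ v)) - scale_comb b (word (u @ [g] @ v))"
      and uv: "u \<in> lists (regular_forms A)" "v \<in> lists (regular_forms A)"
      and fg: "f \<in> regular_forms A" "g \<in> regular_forms A"
      unfolding multilinear_relations_def by blast
    have forms: "u \<in> lists forms" "v \<in> lists forms" "f \<in> forms" "g \<in> forms"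
      using uv fg regular_forms_subset lists_mono by blast+
    then have h: "(\<lambda>z. a * f z + b * g z) \<in> forms"
      by (auto intro!: holomorphic_intros)
    have "u @ [f] @ v \<in> lists forms" "u @ [g] @ v \<in> lists forms"
      "u @ [\<lambda>z. a * f z + b * g z] @ v \<in> lists forms"
      using forms h by auto
    then have "linear_extension ?I r = 0"
      unfolding r linear_extension_diff linear_extension_scale linear_extension_word
      using fun_cong[OF J_multilinear[OF forms(1,3,4) x forms(2), of a b], of y] I by simp
    then show ?case
      using step(2) by (simp add: linear_extension_add linear_extension_scale)
  qed simp
  have 1: "linear_extension ?I t' = linear_extension ?I t" if "t' \<in> forms_class A t" for t'
    using 0[of "t' - t"] that by (simp add: forms_class_def linear_extension_diff)
  have 2: "t \<in> forms_class A t"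
    using t word_comb.span_zero by (simp add: forms_class_def)
  have "(THE v. \<forall>t'\<in>forms_class A t. linear_extension ?I t' = v) = linear_extension ?I t"
  proof (rule the_equality)
    show "\<forall>t'\<in>forms_class A t. linear_extension ?I t' = linear_extension ?I t"
      by (rule ballI) (rule 1)
    show "v = linear_extension ?I t" if "\<forall>t'\<in>forms_class A t. linear_extension ?I t' = v" for v
      using bspec[OF that 2] by (rule sym)
  qed
  then have "I_map Ct p x (forms_class A t) y = linear_extension ?I t"
    using y unfolding I_map_def linear_extension_def[symmetric] by (simp only: if_True)
  also have "\<dots> = linear_extension (\<lambda>ws. J x ws y) t"
    unfolding linear_extension_def
    using I t regular_forms_subset lists_mono[of "regular_forms A" forms]
    by (intro sum.cong refl) auto
  finally show ?thesis .
qed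

abbreviation "Jw x w \<equiv> J x (map (dlog_form A) w)"

lemma I_map_sigma0:
  assumes t: "t \<in> Sh A" and x: "x \<in> Ct"
  shows "I_map Ct p x (sigma0_star A t) = (\<lambda>y. linear_extension (\<lambda>w. Jw x w y) t)"
proof
  fix y
  let ?t = "\<Sum>w\<in>Poly_Mapping.keys t. scale_comb (Poly_Mapping.lookup t w) (word (map (dlog_form A) w))"
  have tk: "Poly_Mapping.keys t \<subseteq> lists A" using t by (simp add: Sh_def)
  show "I_map Ct p x (sigma0_star A t) y = linear_extension (\<lambda>w. Jw x w y) t"
  proof (cases "y \<in> Ct")
    case True
    have "Poly_Mapping.keys ?t \<subseteq> lists (regular_forms A)"
    proof (rule keys_sum_subset)
      fix w assume "w \<in> Poly_Mapping.keys t"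
      then have "map (dlog_form A) w \<in> lists (regular_forms A)" using tk dlog_words by blast
      then show "Poly_Mapping.keys (scale_comb (Poly_Mapping.lookup t w) (word (map (dlog_form A) w)))
          \<subseteq> lists (regular_forms A)"
        using keys_scale_comb[of "Poly_Mapping.lookup t w" "word (map (dlog_form A) w)"]
        unfolding keys_word by blast
    qed
    then show ?thesis
      unfolding sigma0_star_def
      by (simp add: I_map_forms_class x True linear_extension_sum linear_extension_scale)
        (simp add: linear_extension_def)
  next
    case False
    have "Jw x w y = 0" if "w \<in> Poly_Mapping.keys t" for w
      using that tk dlog_words regular_forms_subset lists_mono[of "regular_forms A" forms]
      by (intro J_out x False) blast
    then show ?thesis using False by (simp add: I_map_def linear_extension_def)
  qed
qed

lemma Jw_snoc:
  assumes "w \<in> lists A" "s \<in> A" "x \<in> Ct" "y \<in> Ct"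
  shows "hcd (Jw x (w @ [s])) y (Jw x w y / (p y - s))"
  and "Jw x (w @ [s]) x = 0"
proof -
  have l: "map (dlog_form A) w \<in> lists forms" "dlog_form A s \<in> forms"
    using dlog_words[OF assms(1)] dlog_form_regular[OF finite_A assms(2)] regular_forms_subset
      lists_mono[of "regular_forms A" forms] by blast+
  have "dlog_form A s (p y) = 1 / (p y - s)"
    using p_in_base[OF assms(4)] by (simp add: dlog_form_def)
  then show "hcd (Jw x (w @ [s])) y (Jw x w y / (p y - s))"
    using J_snoc[OF l assms(3,4)] by simp
  show "Jw x (w @ [s]) x = 0" using J_start[OF l assms(3)] by simp
qed

lemma Jw_out: "w \<in> lists A \<Longrightarrow> x \<in> Ct \<Longrightarrow> y \<notin> Ct \<Longrightarrow> Jw x w y = 0"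
  using dlog_words[of w] regular_forms_subset lists_mono[of "regular_forms A" forms] J_out by blast

end

section \<open>The section over the segment at the origin\<close>

context simply_connected_cover
begin

lemma evenly_covered:
  assumes "z \<in> C"
  obtains T v where "z \<in> T" "open T" "\<Union>v = Ct \<inter> p -` T" "\<forall>u\<in>v. openin (top_of_set Ct) u"
    "pairwise disjnt v" "\<forall>u\<in>v. \<exists>q. homeomorphism u T p q"
proof -
  have "\<exists>T. z \<in> T \<and> openin (top_of_set C) T \<and> (\<exists>v. \<Union>v = Ct \<inter> p -` T \<and>
      (\<forall>u\<in>v. openin (top_of_set Ct) u) \<and> pairwise disjnt v \<and> (\<forall>u\<in>v. \<exists>q. homeomorphism u T p q))"
    using covering assms by (simp add: covering_space_def)
  then obtain T v where T: "z \<in> T" "openin (top_of_set C) T" "\<Union>v = Ct \<inter> p -` T"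
      "\<forall>u\<in>v. openin (top_of_set Ct) u" "pairwise disjnt v" "\<forall>u\<in>v. \<exists>q. homeomorphism u T p q"
    by meson
  have "open T" using T(2) open_base by (rule openin_open_trans)
  from that[OF T(1) this T(3-6)] show ?thesis .
qed

lemma eventually_in_openin:
  assumes g: "continuous_on X g" "g ` X \<subseteq> Ct" and u: "openin (top_of_set Ct) u" and t: "t \<in> X" "g t \<in> u"
  shows "\<forall>\<^sub>F t' in at t within X. g t' \<in> u"
proof -
  obtain V where V: "open V" "u = Ct \<inter> V" using u by (auto simp: openin_open)
  have "(g \<longlongrightarrow> g t) (at t within X)" using g t by (simp add: continuous_on_def)
  then have "\<forall>\<^sub>F t' in at t within X. g t' \<in> V" using V t by (intro topological_tendstoD) auto
  moreover have "\<forall>\<^sub>F t' in at t within X. t' \<in> X" by (auto simp: eventually_at_filter)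
  ultimately show ?thesis by eventually_elim (use g V in auto)
qed

text \<open>Agreement of two lifts is locally constant: in one sheet they agree because
  \<open>p\<close> is injective there, and in two different sheets they never meet. The domain has a
  general topological type because it will be a real interval or a subset of the cover.\<close>

lemma lift_unique:
  assumes g1: "continuous_on X g1" "g1 ` X \<subseteq> Ct" and g2: "continuous_on X g2" "g2 ` X \<subseteq> Ct"
    and eq: "\<And>t. t \<in> X \<Longrightarrow> p (g1 t) = p (g2 t)"
    and X: "connected X" "a \<in> X" "t \<in> X" and a: "g1 a = g2 a"
  shows "g1 t = g2 t"
proof -
  have "(g1 a = g2 a) = (g1 t = g2 t)"
  proof (rule connected_local_const[OF X], rule ballI)
    fix s assume s: "s \<in> X"
    then have "p (g1 s) \<in> C" using g1 p_in_base by auto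
    then obtain T v where T: "p (g1 s) \<in> T" "open T" "\<Union>v = Ct \<inter> p -` T"
        "\<forall>u\<in>v. openin (top_of_set Ct) u" "pairwise disjnt v"
        "\<forall>u\<in>v. \<exists>q. homeomorphism u T p q"
      by (rule evenly_covered)
    have "g1 s \<in> \<Union>v" "g2 s \<in> \<Union>v" unfolding T(3) using T(1) s g1 g2 eq by auto
    then obtain u1 u2 where u: "u1 \<in> v" "g1 s \<in> u1" "u2 \<in> v" "g2 s \<in> u2" by blast
    have inj: "x = y" if "u \<in> v" "x \<in> u" "y \<in> u" "p x = p y" for u x y
      using bspec[OF T(6) that(1)] that(2-) unfolding homeomorphism_def by metis
    have "\<forall>\<^sub>F t' in at s within X. g1 t' \<in> u1" "\<forall>\<^sub>F t' in at s within X. g2 t' \<in> u2"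
      using eventually_in_openin[OF g1 _ s] eventually_in_openin[OF g2 _ s] T(4) u by simp_all
    moreover have "\<forall>\<^sub>F t' in at s within X. t' \<in> X" by (auto simp: eventually_at_filter)
    ultimately show "\<forall>\<^sub>F t' in at s within X. (g1 s = g2 s) = (g1 t' = g2 t')"
    proof eventually_elim
      case (elim t')
      show ?case
      proof (cases "u1 = u2")
        case True
        then have "g1 t' = g2 t'" using inj[OF u(3)] elim eq by blast
        moreover have "g1 s = g2 s" using inj[OF u(3)] True u eq[OF s] by blast
        ultimately show ?thesis by simp
      next
        case False
        then have "u1 \<inter> u2 = {}" using T(5) u by (auto simp: pairwise_def disjnt_def)
        then show ?thesis using elim u by auto
      qed
    qed
  qed
  with a show ?thesis by simp
qed

text \<open>Bisection down to intervals mapped into an evenly covered set. The value is prescribed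
  at an arbitrary parameter, so a lift over either half can be continued across the common
  endpoint.\<close>

lemma lift_interval:
  fixes f :: "real \<Rightarrow> complex"
  assumes f: "continuous_on UNIV f" "range f \<subseteq> C" and ab: "a \<le> b"
    and x: "x \<in> Ct" "t \<in> {a..b}" "p x = f t"
  obtains g where "continuous_on {a..b} g" "g ` {a..b} \<subseteq> Ct" "\<And>s. s \<in> {a..b} \<Longrightarrow> p (g s) = f s" "g t = x"
proof -
  define L where "L a b x t g \<longleftrightarrow> continuous_on {a..b} g \<and> g ` {a..b} \<subseteq> Ct \<and>
      (\<forall>s\<in>{a..b}. p (g s) = f s) \<and> g t = x" for a b x t g
  have "\<forall>x\<in>Ct. \<forall>t\<in>{a..b}. p x = f t \<longrightarrow> (\<exists>g. L a b x t g)"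
  proof (rule Bolzano[of a b "\<lambda>a b. \<forall>x\<in>Ct. \<forall>t\<in>{a..b}. p x = f t \<longrightarrow> (\<exists>g. L a b x t g)"])
    fix a b c :: real
    assume 1: "\<forall>x\<in>Ct. \<forall>t\<in>{a..b}. p x = f t \<longrightarrow> (\<exists>g. L a b x t g)"
      and 2: "\<forall>x\<in>Ct. \<forall>t\<in>{b..c}. p x = f t \<longrightarrow> (\<exists>g. L b c x t g)" and abc: "a \<le> b" "b \<le> c"
    have glue: "\<exists>k. L a c x t k"
      if g: "L a b (g b) b g" and h: "L b c (g b) b h" and t: "t \<in> {a..c}"
        "x = (if t \<le> b then g t else h t)" for g h t x
    proof -
      have "continuous_on ({a..b} \<union> {b..c}) (\<lambda>s. if s \<le> b then g s else h s)"
        using g h by (intro continuous_on_cases) (auto simp: L_def)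
      moreover have "{a..b} \<union> {b..c} = {a..c}" using abc by auto
      ultimately have "L a c x t (\<lambda>s. if s \<le> b then g s else h s)"
        using g h t by (auto simp: L_def)
      then show ?thesis by blast
    qed
    show "\<forall>x\<in>Ct. \<forall>t\<in>{a..c}. p x = f t \<longrightarrow> (\<exists>g. L a c x t g)"
    proof (intro ballI impI)
      fix x t assume x: "x \<in> Ct" and t: "t \<in> {a..c}" and px: "p x = f t"
      show "\<exists>g. L a c x t g"
      proof (cases "t \<le> b")
        case True
        then obtain g where g: "L a b x t g" using 1 x t px by force
        then have "g b \<in> Ct" "p (g b) = f b" using abc by (auto simp: L_def)
        then obtain h where "L b c (g b) b h" using 2 abc by force
        then show ?thesis using glue[of g h t x] g t True by (auto simp: L_def)
      next
        case False
        then obtain h where h: "L b c x t h" using 2 x t px by force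
        then have "h b \<in> Ct" "p (h b) = f b" using abc by (auto simp: L_def)
        then obtain g where "L a b (h b) b g" using 1 abc by force
        then show ?thesis using glue[of g h t x] h t False by (auto simp: L_def)
      qed
    qed
  next
    fix s assume "a \<le> s" "s \<le> b"
    have "f s \<in> C" using f(2) by blast
    then obtain T v where T: "f s \<in> T" "open T" "\<Union>v = Ct \<inter> p -` T"
        "\<forall>u\<in>v. openin (top_of_set Ct) u" "pairwise disjnt v"
        "\<forall>u\<in>v. \<exists>q. homeomorphism u T p q"
      by (rule evenly_covered)
    have "open (f -` T)" using f(1) T(2) by (simp add: open_vimage)
    then obtain d where d: "d > 0" "ball s d \<subseteq> f -` T" using T(1) by (auto elim: openE)
    have "\<exists>g. L a b x t g"
      if ab: "a \<le> s" "s \<le> b" "b - a < d" and x: "x \<in> Ct" and t: "t \<in> {a..b}" and px: "p x = f t"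
      for a b x t
    proof -
      have fT: "f r \<in> T" if "r \<in> {a..b}" for r
      proof -
        have "r \<in> ball s d" using that ab by (auto simp: dist_real_def)
        then show ?thesis using d by auto
      qed
      then have "x \<in> \<Union>v" unfolding T(3) using x t px by auto
      then obtain u where u: "x \<in> u" "u \<in> v" by blast
      obtain q where q: "homeomorphism u T p q" using bspec[OF T(6) u(2)] by blast
      have "continuous_on {a..b} (\<lambda>r. q (f r))"
        by (rule continuous_on_compose2[of T q]) (use q fT f(1) in \<open>auto simp: homeomorphism_def
            intro: continuous_on_subset\<close>)
      moreover have "u \<subseteq> Ct" using T(3) u(2) by blast
      ultimately have "L a b x t (\<lambda>r. q (f r))"
        using q fT u px t unfolding L_def homeomorphism_def by (auto simp flip: px)
      then show ?thesis by blast
    qed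
    then show "\<exists>d>0. \<forall>a b. a \<le> s \<and> s \<le> b \<and> b - a < d \<longrightarrow>
        (\<forall>x\<in>Ct. \<forall>t\<in>{a..b}. p x = f t \<longrightarrow> (\<exists>g. L a b x t g))"
      using d(1) by blast
  qed (use ab in simp)
  then obtain g where "L a b x t g" using x by blast
  then show ?thesis by (intro that[of g]) (auto simp: L_def)
qed

text \<open>Compact intervals around t exhaust the open one, and their lifts fit together by
  \<open>lift_unique\<close>.\<close>

lemma section_over_open_interval:
  assumes sub: "open_segment_0 \<delta> \<subseteq> C" and x: "x \<in> Ct" "p x = of_real t" "t \<in> {0<..<\<delta>}"
  obtains g where "continuous_on {0<..<\<delta>} g" "g ` {0<..<\<delta>} \<subseteq> Ct"
    "\<And>s. s \<in> {0<..<\<delta>} \<Longrightarrow> p (g s) = of_real s" "g t = x"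
proof -
  define L where "L a b g \<longleftrightarrow> continuous_on {a..b} g \<and> g ` {a..b} \<subseteq> Ct \<and>
      (\<forall>s\<in>{a..b}. p (g s) = of_real s) \<and> g t = x" for a b g
  have ex: "\<exists>g. L a b g" if ab: "0 < a" "a \<le> t" "t \<le> b" "b < \<delta>" for a b
  proof -
    \<comment> \<open>Clamping extends the segment to all real parameters without leaving C, as
      \<open>lift_interval\<close> requires.\<close>
    define f where "f s = complex_of_real (max a (min b s))" for s
    have "continuous_on UNIV f" unfolding f_def by (intro continuous_intros)
    moreover have "range f \<subseteq> C"
    proof -
      have "max a (min b s) \<in> {0<..<\<delta>}" for s using ab by auto
      then have "range f \<subseteq> open_segment_0 \<delta>" unfolding f_def open_segment_0_def by blast
      then show ?thesis using sub by blast
    qed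
    moreover have "a \<le> b" "t \<in> {a..b}" "p x = f t" using ab x by (auto simp: f_def)
    ultimately obtain g where "continuous_on {a..b} g" "g ` {a..b} \<subseteq> Ct"
        "\<And>s. s \<in> {a..b} \<Longrightarrow> p (g s) = f s" "g t = x"
      using lift_interval[of f a b x t] x(1) by blast
    then have "L a b g" by (auto simp: L_def f_def)
    then show ?thesis by blast
  qed
  define g where "g s = (SOME h. L (min s t) (max s t) h) s" for s
  have gL: "g s = h s" if L: "L a b h" and ab: "0 < a" "a \<le> t" "t \<le> b" "b < \<delta>" and s: "s \<in> {a..b}" for a b h s
  proof -
    have "\<exists>h. L (min s t) (max s t) h" using ab s x(3) by (intro ex) auto
    then have k: "L (min s t) (max s t) (SOME h. L (min s t) (max s t) h)" by (rule someI_ex)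
    have sub: "{min s t..max s t} \<subseteq> {a..b}" using ab s by auto
    show ?thesis unfolding g_def
    proof (rule lift_unique[of "{min s t..max s t}" "SOME h. L (min s t) (max s t) h" h t])
      show "continuous_on {min s t..max s t} h"
        using L by (intro continuous_on_subset[OF _ sub]) (simp add: L_def)
      show "h ` {min s t..max s t} \<subseteq> Ct" using L image_mono[OF sub, of h] unfolding L_def by blast
      show "p ((SOME h. L (min s t) (max s t) h) r) = p (h r)" if "r \<in> {min s t..max s t}" for r
        using k L that subsetD[OF sub that] unfolding L_def by simp
    qed (use k L in \<open>auto simp: L_def\<close>)
  qed
  have loc: "continuous (at s within {0<..<\<delta>}) g \<and> g s \<in> Ct \<and> p (g s) = of_real s"
    if s: "s \<in> {0<..<\<delta>}" for s
  proof -
    \<comment> \<open>Midpoints towards the ends of the segment put s strictly inside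
      \<open>{a..b}\<close>, where g equals a single continuous lift.\<close>
    define a b where "a = min s t / 2" and "b = (max s t + \<delta>) / 2"
    have ab: "0 < a" "a \<le> t" "t \<le> b" "b < \<delta>" "a < s" "s < b"
      using s x(3) by (auto simp: a_def b_def min_def max_def)
    obtain h where h: "L a b h" using ex[OF ab(1-4)] by blast
    have eq: "g r = h r" if "r \<in> {a..b}" for r using gL[OF h ab(1-4) that] .
    have "continuous_on {a<..<b} g"
    proof (rule continuous_on_eq)
      show "continuous_on {a<..<b} h"
        using h by (auto simp: L_def intro: continuous_on_subset[of "{a..b}"])
    qed (use eq in auto)
    then have "isCont g s" using ab by (simp add: continuous_on_eq_continuous_at)
    then show ?thesis using eq[of s] h ab by (auto simp: L_def continuous_at_imp_continuous_at_within)
  qed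
  have "\<exists>h. L t t h" using x by (intro ex) auto
  then obtain h where "L t t h" by blast
  then have "g t = x" using gL[of t t h t] x(3) by (auto simp: L_def)
  then show ?thesis using loc by (intro that[of g]) (auto simp: continuous_on_eq_continuous_within)
qed

text \<open>The section through a point of K has a connected image, hence lies in the component.
  Conversely, on K the identity and \<open>\<lambda>y. g (Re (p y))\<close> are two lifts of
  \<open>p\<close> that agree at that point, so K is no larger.\<close>

lemma component_section:
  assumes sub: "open_segment_0 \<delta> \<subseteq> C" and K: "K \<in> components (Ct \<inter> p -` open_segment_0 \<delta>)"
  obtains g where "continuous_on {0<..<\<delta>} g" "K = g ` {0<..<\<delta>}" "K \<subseteq> Ct"
    "\<And>s. s \<in> {0<..<\<delta>} \<Longrightarrow> p (g s) = of_real s"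
    "\<And>s. s \<in> {0<..<\<delta>} \<Longrightarrow> inv_into K p (of_real s) = g s"
proof -
  have KE: "K \<subseteq> Ct \<inter> p -` open_segment_0 \<delta>" using K by (rule in_components_subset)
  obtain x where xK: "x \<in> K" using in_components_nonempty[OF K] by blast
  then obtain t where t: "t \<in> {0<..<\<delta>}" "p x = of_real t"
    using KE unfolding open_segment_0_def by blast
  obtain g where g: "continuous_on {0<..<\<delta>} g" "g ` {0<..<\<delta>} \<subseteq> Ct"
      "\<And>s. s \<in> {0<..<\<delta>} \<Longrightarrow> p (g s) = of_real s" "g t = x"
    using section_over_open_interval[OF sub _ t(2,1)] xK KE by blast
  have "connected (g ` {0<..<\<delta>})"
    using g(1) by (intro connected_continuous_image) auto
  moreover have "g ` {0<..<\<delta>} \<subseteq> Ct \<inter> p -` open_segment_0 \<delta>"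
    using g(2,3) by (auto simp: open_segment_0_def)
  moreover have "K \<inter> g ` {0<..<\<delta>} \<noteq> {}" using xK g(4) t by blast
  ultimately have 1: "g ` {0<..<\<delta>} \<subseteq> K" by (rule components_maximal[OF K])
  have id: "y = g (Re (p y))" and Re: "Re (p y) \<in> {0<..<\<delta>}" if y: "y \<in> K" for y
  proof -
    have R: "Re (p y) \<in> {0<..<\<delta>}" "p y = of_real (Re (p y))" if "y \<in> K" for y
      using that KE by (auto simp: open_segment_0_def)
    show "Re (p y) \<in> {0<..<\<delta>}" using R y by blast
    have "continuous_on K p" using continuous_p KE by (auto intro: continuous_on_subset)
    then have c: "continuous_on K (\<lambda>y. g (Re (p y)))"
      using R by (intro continuous_on_compose2[OF g(1)] continuous_intros) auto
    show "y = g (Re (p y))"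
    proof (rule lift_unique[of K "\<lambda>y. y" "\<lambda>y. g (Re (p y))" x])
      show "connected K" using K by (rule in_components_connected)
    qed (use c KE R g t xK y in \<open>auto\<close>)
  qed
  have K_eq: "K = g ` {0<..<\<delta>}" using 1 id Re by blast
  have inv: "inv_into K p (of_real s) = g s" if s: "s \<in> {0<..<\<delta>}" for s
  proof -
    have "inj_on p K" by (rule inj_onI) (metis id)
    moreover have "g s \<in> K" using 1 s by blast
    ultimately show ?thesis using inv_into_f_f[of p K "g s"] g(3)[OF s] by simp
  qed
  show ?thesis using that[OF g(1) K_eq _ g(3) inv] KE by blast
qed

end

section \<open>Hyperlogarithms normalized at the tangential base point\<close>

lemma bounded_on_half_open:
  fixes f :: "real \<Rightarrow> 'a::real_normed_vector"
  assumes "continuous_on {0<..r} f" "(f \<longlongrightarrow> l) (at_right 0)"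
  shows "\<exists>B. \<forall>t\<in>{0<..r}. norm (f t) \<le> B"
proof -
  have "\<forall>\<^sub>F t in at_right 0. dist (f t) l < 1" using assms(2) by (rule tendstoD) simp
  then obtain b where b: "b > 0" "\<And>t. 0 < t \<Longrightarrow> t < b \<Longrightarrow> dist (f t) l < 1"
    unfolding eventually_at_right_field by auto
  have "compact (f ` {b..r})"
    using b(1) by (intro compact_continuous_image continuous_on_subset[OF assms(1)]) auto
  then have "bounded (f ` {b..r})" by (rule compact_imp_bounded)
  then obtain M where M: "\<And>t. t \<in> {b..r} \<Longrightarrow> norm (f t) \<le> M" unfolding bounded_iff by (metis imageI)
  have "norm (f t) \<le> max M (norm l + 1)" if t: "t \<in> {0<..r}" for t
  proof (cases "t < b")
    case True
    then have "norm (f t - l) < 1" using b(2)[of t] t by (simp add: dist_norm)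
    then show ?thesis using norm_triangle_sub[of "f t" l] by simp
  next
    case False
    then show ?thesis using M[of t] t by simp
  qed
  then show ?thesis by blast
qed

text \<open>The comparison function \<open>2 * c * sqrt t\<close> has derivative
  \<open>c / sqrt t\<close> and tends to 0, which gives the Cauchy property at 0. The rate is
  recorded because it is the bound that the next integration starts from.\<close>

lemma limit_at_0_of_sqrt_bounded_derivative:
  fixes f :: "real \<Rightarrow> 'a::banach"
  assumes r: "r > 0" and f: "\<And>t. t \<in> {0<..r} \<Longrightarrow> (f has_vector_derivative f' t) (at t)"
    and c: "\<And>t. t \<in> {0<..r} \<Longrightarrow> norm (f' t) \<le> c / sqrt t"
  shows "\<exists>L. \<forall>t\<in>{0<..r}. norm (f t - L) \<le> 2 * c * sqrt t"
proof -
  have c0: "c \<ge> 0"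
  proof -
    have "0 \<le> c / sqrt r" by (rule order_trans[OF norm_ge_zero c[of r]]) (use r in simp)
    then show ?thesis using r by (simp add: zero_le_divide_iff)
  qed
  have le: "norm (f b - f a) \<le> 2 * c * sqrt b" if ab: "0 < a" "a \<le> b" "b \<le> r" for a b
  proof (cases "a = b")
    case False
    have "norm (f b - f a) \<le> 2 * c * sqrt b - 2 * c * sqrt a"
    proof (rule differentiable_bound_general[where f'=f' and \<phi>'="\<lambda>t. c / sqrt t"])
      show "continuous_on {a..b} f"
        using f ab by (auto intro!: continuous_at_imp_continuous_on has_vector_derivative_continuous[OF f])
      show "continuous_on {a..b} (\<lambda>t. 2 * c * sqrt t)" by (intro continuous_intros)
      fix x assume x: "a < x" "x < b"
      show "((\<lambda>t. 2 * c * sqrt t) has_vector_derivative c / sqrt x) (at x)"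
        unfolding has_real_derivative_iff_has_vector_derivative[symmetric]
        using ab x by (auto intro!: derivative_eq_intros simp: field_simps)
    qed (use ab False f c in auto)
    moreover have "0 \<le> 2 * c * sqrt a" using ab c0 by simp
    ultimately show ?thesis by linarith
  qed (use c0 that in simp)
  define a where "a n = r / real (Suc n)" for n
  have a: "0 < a n" "a n \<le> r" for n using r by (auto simp: a_def field_simps)
  have mono: "a m \<le> a n" if "n \<le> m" for m n
    using r that unfolding a_def by (intro divide_left_mono) auto
  have sq: "(\<lambda>n. 2 * c * sqrt (a n)) \<longlonglongrightarrow> 0"
  proof (rule tendsto_mult_right_zero)
    show "(\<lambda>n. sqrt (a n)) \<longlonglongrightarrow> 0" unfolding a_def using r by real_asymp
  qed
  have "Cauchy (\<lambda>n. f (a n))"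
  proof (rule metric_CauchyI)
    fix e :: real assume "e > 0"
    then obtain N where N: "\<And>n. n \<ge> N \<Longrightarrow> 2 * c * sqrt (a n) < e"
      using order_tendstoD(2)[OF sq] unfolding eventually_sequentially by blast
    have *: "dist (f (a m)) (f (a n)) < e" if "N \<le> n" "n \<le> m" for m n
      using le[OF a(1) mono[OF that(2)] a(2)] N[OF that(1)] by (simp add: dist_norm norm_minus_commute)
    show "\<exists>M. \<forall>m\<ge>M. \<forall>n\<ge>M. dist (f (a m)) (f (a n)) < e"
      using * by (metis dist_commute nle_le)
  qed
  then obtain L where L: "(\<lambda>n. f (a n)) \<longlonglongrightarrow> L"
    using Cauchy_convergent unfolding convergent_def by blast
  have "norm (f t - L) \<le> 2 * c * sqrt t" if t: "t \<in> {0<..r}" for t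
  proof (rule Lim_norm_ubound[OF _ tendsto_diff[OF tendsto_const L]])
    have "a \<longlonglongrightarrow> 0" unfolding a_def using r by real_asymp
    then have "\<forall>\<^sub>F n in sequentially. a n < t" using t by (auto dest: order_tendstoD)
    then show "\<forall>\<^sub>F n in sequentially. norm (f t - f (a n)) \<le> 2 * c * sqrt t"
      by eventually_elim (use le a t in auto)
  qed simp
  then show ?thesis by blast
qed

text \<open>Growth below every negative power of t. Logarithms satisfy it and it is stable under
  sums and products, so their powers need not be tracked. Its companion
  \<open>negligible_at_0\<close>, decay faster than some positive power, outweighs any such
  factor.\<close>

definition moderate_at_0 :: "(real \<Rightarrow> complex) \<Rightarrow> bool" where
  "moderate_at_0 f \<longleftrightarrow> (\<forall>\<beta>>0. ((\<lambda>t. of_real (t powr \<beta>) * f t) \<longlongrightarrow> 0) (at_right 0))"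

definition negligible_at_0 :: "(real \<Rightarrow> complex) \<Rightarrow> bool" where
  "negligible_at_0 f \<longleftrightarrow> (\<exists>\<beta>>0. ((\<lambda>t. of_real (t powr - \<beta>) * f t) \<longlongrightarrow> 0) (at_right 0))"

lemma eventually_at_right_0_pos: "\<forall>\<^sub>F t::real in at_right 0. 0 < t"
  by (simp add: eventually_at_filter)

lemma moderate_at_0_const: "moderate_at_0 (\<lambda>_. c)"
  unfolding moderate_at_0_def
proof (intro allI impI)
  fix \<beta> :: real assume "\<beta> > 0"
  then have "((\<lambda>t::real. t powr \<beta>) \<longlongrightarrow> 0) (at_right 0)" by real_asymp
  from tendsto_mult_right[OF tendsto_of_real[OF this, where 'a=complex], of c]
  show "((\<lambda>t. of_real (t powr \<beta>) * c) \<longlongrightarrow> 0) (at_right 0)" by simp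
qed

lemma moderate_at_0_add: "moderate_at_0 f \<Longrightarrow> moderate_at_0 g \<Longrightarrow> moderate_at_0 (\<lambda>t. f t + g t)"
  unfolding moderate_at_0_def distrib_left by (auto intro: tendsto_add_zero)

lemma moderate_at_0_sum:
  "(\<And>i. i \<in> X \<Longrightarrow> moderate_at_0 (f i)) \<Longrightarrow> moderate_at_0 (\<lambda>t. \<Sum>i\<in>X. f i t)"
  by (induction X rule: infinite_finite_induct)
    (auto intro: moderate_at_0_add moderate_at_0_const)

lemma moderate_at_0_mult:
  assumes "moderate_at_0 f" "moderate_at_0 g"
  shows "moderate_at_0 (\<lambda>t. f t * g t)"
  unfolding moderate_at_0_def
proof (intro allI impI)
  fix \<beta> :: real assume "\<beta> > 0"
  then have "((\<lambda>t. (of_real (t powr (\<beta> / 2)) * f t) * (of_real (t powr (\<beta> / 2)) * g t)) \<longlongrightarrow> 0) (at_right 0)"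
    using tendsto_mult_zero[OF assms[unfolded moderate_at_0_def, rule_format, of "\<beta> / 2"]] by simp
  moreover have "\<forall>\<^sub>F t in at_right 0. (of_real (t powr (\<beta> / 2)) * f t) * (of_real (t powr (\<beta> / 2)) * g t)
      = of_real (t powr \<beta>) * (f t * g t)"
    using eventually_at_right_0_pos
  proof eventually_elim
    case (elim t)
    have "t powr \<beta> = t powr (\<beta> / 2) * t powr (\<beta> / 2)" by (simp flip: powr_add)
    then show ?case by simp
  qed
  ultimately show "((\<lambda>t. of_real (t powr \<beta>) * (f t * g t)) \<longlongrightarrow> 0) (at_right 0)"
    by (rule Lim_transform_eventually)
qed

lemma moderate_at_0_ln: "moderate_at_0 (\<lambda>t. of_real (ln t))"
  unfolding moderate_at_0_def
proof (intro allI impI)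
  fix \<beta> :: real assume "\<beta> > 0"
  then have "((\<lambda>t::real. t powr \<beta> * ln t) \<longlongrightarrow> 0) (at_right 0)" by real_asymp
  from tendsto_of_real[OF this, where 'a=complex]
  show "((\<lambda>t. of_real (t powr \<beta>) * complex_of_real (ln t)) \<longlongrightarrow> 0) (at_right 0)" by simp
qed

lemma moderate_at_0_ln_power: "moderate_at_0 (\<lambda>t. of_real (ln t) ^ n / c)"
proof -
  have "moderate_at_0 (\<lambda>t. of_real (ln t) ^ n)"
    by (induction n) (auto intro: moderate_at_0_const moderate_at_0_mult moderate_at_0_ln)
  from moderate_at_0_mult[OF this moderate_at_0_const[of "1 / c"]] show ?thesis by simp
qed

lemma negligible_at_0_mult:
  assumes "negligible_at_0 f" "moderate_at_0 g"
  shows "((\<lambda>t. f t * g t) \<longlongrightarrow> 0) (at_right 0)"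
proof -
  obtain \<beta> where \<beta>: "\<beta> > 0" "((\<lambda>t. of_real (t powr - \<beta>) * f t) \<longlongrightarrow> 0) (at_right 0)"
    using assms(1) by (auto simp: negligible_at_0_def)
  have "((\<lambda>t. (of_real (t powr - \<beta>) * f t) * (of_real (t powr \<beta>) * g t)) \<longlongrightarrow> 0) (at_right 0)"
    using tendsto_mult_zero[OF \<beta>(2) assms(2)[unfolded moderate_at_0_def, rule_format, OF \<beta>(1)]] .
  moreover have "\<forall>\<^sub>F t in at_right 0. (of_real (t powr - \<beta>) * f t) * (of_real (t powr \<beta>) * g t) = f t * g t"
    using eventually_at_right_0_pos
  proof eventually_elim
    case (elim t)
    have "t powr - \<beta> * t powr \<beta> = 1" using elim by (simp flip: powr_add)
    then have "complex_of_real (t powr - \<beta>) * of_real (t powr \<beta>) = 1" by (metis of_real_1 of_real_mult)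
    then show ?case by (metis (no_types, lifting) mult.assoc mult.left_commute mult_1)
  qed
  ultimately show ?thesis by (rule Lim_transform_eventually)
qed

lemma negligible_at_0_tendsto: "negligible_at_0 f \<Longrightarrow> (f \<longlongrightarrow> 0) (at_right 0)"
  using negligible_at_0_mult[OF _ moderate_at_0_const[of 1], of f] by simp

lemma negligible_at_0_sqrt_bound:
  assumes r: "r > 0" and c: "\<And>t. t \<in> {0<..r} \<Longrightarrow> norm (f t) \<le> c * sqrt t"
  shows "negligible_at_0 f" "moderate_at_0 f"
proof -
  have ev: "\<forall>\<^sub>F t in at_right 0. t \<in> {0<..r}"
    using r by (auto simp: eventually_at_right_field intro: exI[of _ r])
  have *: "((\<lambda>t. of_real (t powr \<beta>) * f t) \<longlongrightarrow> 0) (at_right 0)" if "\<beta> > -1/2" for \<beta>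
  proof (rule Lim_null_comparison)
    show "\<forall>\<^sub>F t in at_right 0. norm (of_real (t powr \<beta>) * f t) \<le> t powr \<beta> * (c * sqrt t)"
      using ev by eventually_elim (use c in \<open>auto simp: norm_mult intro!: mult_left_mono\<close>)
    have "((\<lambda>t. c * t powr (\<beta> + 1/2)) \<longlongrightarrow> 0) (at_right 0)"
      using that by real_asymp
    moreover have "\<forall>\<^sub>F t in at_right 0. c * t powr (\<beta> + 1/2) = t powr \<beta> * (c * sqrt t)"
      using eventually_at_right_0_pos
      by eventually_elim (simp add: powr_add powr_half_sqrt)
    ultimately show "((\<lambda>t. t powr \<beta> * (c * sqrt t)) \<longlongrightarrow> 0) (at_right 0)"
      by (rule Lim_transform_eventually)
  qed
  show "negligible_at_0 f"
    \<comment> \<open>Every exponent below 1/2 is outweighed by the square root; 1/4 is one such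
      choice.\<close>
    unfolding negligible_at_0_def using *[of "- (1/4)"] by (intro exI[of _ "1/4"]) auto
  show "moderate_at_0 f"
    unfolding moderate_at_0_def using * by auto
qed

lemma has_cover_derivative_sum_list:
  assumes "\<And>w. w \<in> set ws \<Longrightarrow> has_cover_derivative Ct p (f w) x (d w)"
    and "has_cover_derivative Ct p (\<lambda>_. 0) x 0"
  shows "has_cover_derivative Ct p (\<lambda>y. \<Sum>w\<leftarrow>ws. f w y) x (\<Sum>w\<leftarrow>ws. d w)"
  using assms by (induction ws) (auto intro!: has_cover_derivative_add)

lemma has_cover_derivative_sum:
  assumes "\<And>i. i \<in> X \<Longrightarrow> has_cover_derivative Ct p (f i) x (d i)"
    and "has_cover_derivative Ct p (\<lambda>_. 0) x 0"
  shows "has_cover_derivative Ct p (\<lambda>y. \<Sum>i\<in>X. f i y) x (\<Sum>i\<in>X. d i)"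
  using assms by (induction X rule: infinite_finite_induct) (auto intro!: has_cover_derivative_add)

lemma word_shuffles_count: "length (word_shuffles u v) = (length u + length v) choose length u"
  by (induction u v rule: word_shuffles.induct) auto

text \<open>The analysis sees the component K only through the section \<open>q\<close> over the
  segment.\<close>

locale tangential_base_point = punctured_plane_cover A Ct p
  for A :: "complex set" and Ct :: "'a::topological_space set" and p :: "'a \<Rightarrow> complex" +
  fixes \<delta> :: real and q :: "real \<Rightarrow> 'a"
  assumes zero_in_A: "0 \<in> A" and delta_pos: "\<delta> > 0" and segment: "open_segment_0 \<delta> \<subseteq> curve A"
    and continuous_q: "continuous_on {0<..<\<delta>} q" and q_in: "t \<in> {0<..<\<delta>} \<Longrightarrow> q t \<in> Ct"
    and p_q: "t \<in> {0<..<\<delta>} \<Longrightarrow> p (q t) = of_real t"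
begin

text \<open>The far end of the segment may be a puncture. On half its length the functions
  \<open>1 / (t - s)\<close> with s nonzero stay bounded.\<close>

definition "r\<^sub>0 = \<delta> / 2"

lemma r0: "0 < r\<^sub>0" "r\<^sub>0 < \<delta>" "t \<in> {0<..r\<^sub>0} \<Longrightarrow> t \<in> {0<..<\<delta>}"
  using delta_pos by (auto simp: r\<^sub>0_def)

lemma hcd_along_q:
  assumes "hcd f (q t) d" "t \<in> {0<..<\<delta>}"
  shows "((\<lambda>s. f (q s)) has_vector_derivative d) (at t)"
proof -
  have at: "at t within {0<..<\<delta>} = at t" using assms(2) by (intro at_within_open) auto
  have "((\<lambda>s. p (q s)) has_vector_derivative 1) (at t within {0<..<\<delta>})"
    by (rule has_vector_derivative_transform[where f=of_real])
      (use assms(2) p_q in \<open>auto intro!: derivative_eq_intros\<close>)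
  then have "((\<lambda>s. f (q s)) has_vector_derivative d * 1) (at t within {0<..<\<delta>})"
    using assms q_in continuous_q
    by (intro has_cover_derivative_path[where p=p]) (auto simp: continuous_on_def)
  then show ?thesis by (simp add: at)
qed

text \<open>On the closed half segment 0 is the only possible puncture. For nonzero s the first
  bound weakens the second by the factor \<open>r\<^sub>0 / t\<close>, which is at least 1, so all
  letters can be treated alike where the old function is O(sqrt t).\<close>

lemma inverse_bounds:
  assumes "s \<in> A"
  shows "\<exists>M\<ge>0. \<forall>t\<in>{0<..r\<^sub>0}. norm (1 / (of_real t - s)) \<le> M / t"
    and "s \<noteq> 0 \<Longrightarrow> \<exists>M\<ge>0. \<forall>t\<in>{0<..r\<^sub>0}. norm (1 / (of_real t - s)) \<le> M"
proof -
  show 2: "\<exists>M\<ge>0. \<forall>t\<in>{0<..r\<^sub>0}. norm (1 / (of_real t - s)) \<le> M" if "s \<noteq> 0"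
  proof -
    have "of_real t \<noteq> s" if "t \<in> {0..r\<^sub>0}" for t :: real
    proof (cases "t = 0")
      case False
      then have "of_real t \<in> open_segment_0 \<delta>"
        using that r0(2) unfolding open_segment_0_def by (intro imageI) auto
      then show ?thesis using segment assms by (auto simp: curve_def)
    qed (use \<open>s \<noteq> 0\<close> in simp)
    then have "continuous_on {0..r\<^sub>0} (\<lambda>t. 1 / (of_real t - s))"
      by (intro continuous_intros) auto
    then have "compact ((\<lambda>t. 1 / (of_real t - s)) ` {0..r\<^sub>0})"
      by (intro compact_continuous_image) auto
    then have "bounded ((\<lambda>t. 1 / (of_real t - s)) ` {0..r\<^sub>0})" by (rule compact_imp_bounded)
    then obtain M where M: "\<And>t. t \<in> {0..r\<^sub>0} \<Longrightarrow> norm (1 / (of_real t - s)) \<le> M"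
      unfolding bounded_iff by (metis imageI)
    have "0 \<le> M" by (rule order_trans[OF norm_ge_zero M[of 0]]) (use r0 in simp)
    then show ?thesis using M by auto
  qed
  show "\<exists>M\<ge>0. \<forall>t\<in>{0<..r\<^sub>0}. norm (1 / (of_real t - s)) \<le> M / t"
  proof (cases "s = 0")
    case True
    then show ?thesis by (intro exI[of _ 1]) (auto simp: norm_divide)
  next
    case False
    then obtain M where M: "M \<ge> 0" "\<And>t. t \<in> {0<..r\<^sub>0} \<Longrightarrow> norm (1 / (of_real t - s)) \<le> M"
      using 2 by blast
    have "M \<le> M * r\<^sub>0 / t" if "t \<in> {0<..r\<^sub>0}" for t
      using that M(1) by (simp add: field_simps mult_left_mono)
    then show ?thesis using M r0(1)
      by (intro exI[of _ "M * r\<^sub>0"]) (meson order_trans mult_nonneg_nonneg less_imp_le)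
  qed
qed

text \<open>The regularized limit at the tangential base point: only the powers of the logarithm survive.\<close>

definition asymptotics :: "complex list \<Rightarrow> ('a \<Rightarrow> complex) \<Rightarrow> bool" where
  "asymptotics w f \<longleftrightarrow>
     (if set w \<subseteq> {0} then \<forall>t\<in>{0<..<\<delta>}. f (q t) = of_real (ln t) ^ length w / fact (length w)
      else \<exists>c. \<forall>t\<in>{0<..r\<^sub>0}. norm (f (q t)) \<le> c * sqrt t)"

text \<open>\<open>asymptotics\<close> depends only on the set of letters and the length, so it may
  be imposed on the reversed word.\<close>

primrec hyper_rev :: "complex list \<Rightarrow> 'a \<Rightarrow> complex" where
  "hyper_rev [] = hol_one Ct"
| "hyper_rev (s # w) =
     (SOME G. (\<forall>y\<in>Ct. hcd G y (hyper_rev w y / (p y - s))) \<and> (\<forall>y. y \<notin> Ct \<longrightarrow> G y = 0) \<and>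
       asymptotics (s # w) G)"

definition hyper :: "complex list \<Rightarrow> 'a \<Rightarrow> complex" where
  "hyper w = hyper_rev (rev w)"

lemma asymptotics_moderate:
  assumes "asymptotics w f"
  shows "moderate_at_0 (\<lambda>t. f (q t))"
proof (cases "set w \<subseteq> {0}")
  case True
  have ev: "\<forall>\<^sub>F t in at_right 0. of_real (t powr \<beta>) * (of_real (ln t) ^ length w / fact (length w))
      = of_real (t powr \<beta>) * f (q t)" for \<beta>
    unfolding eventually_at_right_field using assms True delta_pos
    by (intro exI[of _ \<delta>]) (auto simp: asymptotics_def)
  show ?thesis
    using moderate_at_0_ln_power[of "length w" "fact (length w)"] unfolding moderate_at_0_def
    using Lim_transform_eventually[OF _ ev] by blast
next
  case False
  then obtain c where "\<And>t. t \<in> {0<..r\<^sub>0} \<Longrightarrow> norm (f (q t)) \<le> c * sqrt t"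
    using assms unfolding asymptotics_def by meson
  then show ?thesis by (rule negligible_at_0_sqrt_bound(2)[OF r0(1)])
qed

lemma asymptotics_negligible:
  assumes "asymptotics w f" "\<not> set w \<subseteq> {0}"
  shows "negligible_at_0 (\<lambda>t. f (q t))"
proof -
  obtain c where "\<And>t. t \<in> {0<..r\<^sub>0} \<Longrightarrow> norm (f (q t)) \<le> c * sqrt t"
    using assms unfolding asymptotics_def by meson
  then show ?thesis by (rule negligible_at_0_sqrt_bound(1)[OF r0(1)])
qed

lemma quotient_hcd:
  assumes "\<exists>d. hcd f y d" "y \<in> Ct" "s \<in> A"
  shows "\<exists>d. hcd (\<lambda>y. f y / (p y - s)) y d"
proof -
  have "p y \<noteq> s" using p_in_base[OF assms(2)] assms(3) by (auto simp: curve_def)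
  then have "((\<lambda>z. 1 / (z - s)) has_field_derivative - 1 / (p y - s)\<^sup>2) (at (p y))"
    by (auto intro!: derivative_eq_intros simp: power2_eq_square)
  from hcd_compose_p[OF assms(2) this] assms(1) show ?thesis
    using has_cover_derivative_mult[of Ct p f y _ "\<lambda>y. 1 / (p y - s)"] by auto
qed

text \<open>The order 1/sqrt t has two sources. After a power of the letter 0 the new letter is
  nonzero, its form is bounded, and 1/sqrt t absorbs the logarithms. Otherwise the old function is
  O(sqrt t), and dividing by t leaves 1/sqrt t.\<close>

lemma derivative_bound:
  assumes s: "s \<in> A" and f: "\<And>y. y \<in> Ct \<Longrightarrow> \<exists>d. hcd f y d" and as: "asymptotics w f"
    and nz: "\<not> set (w @ [s]) \<subseteq> {0}"
  shows "\<exists>c. \<forall>t\<in>{0<..r\<^sub>0}. norm (f (q t) / (of_real t - s)) \<le> c / sqrt t"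
proof (cases "set w \<subseteq> {0}")
  case True
  then have "s \<noteq> 0" using nz by auto
  then obtain M where M: "M \<ge> 0" "\<And>t. t \<in> {0<..r\<^sub>0} \<Longrightarrow> norm (1 / (of_real t - s)) \<le> M"
    using inverse_bounds(2)[OF s] by blast
  have "continuous_on Ct f" using f by (rule continuous_on_hcd)
  then have "continuous_on {0<..r\<^sub>0} (\<lambda>t. f (q t))"
    by (rule continuous_on_compose2[OF _ continuous_on_subset[OF continuous_q]])
      (use r0 q_in in auto)
  then have "continuous_on {0<..r\<^sub>0} (\<lambda>t. of_real (t powr (1/2)) * f (q t))"
    by (intro continuous_intros) auto
  moreover have "((\<lambda>t. of_real (t powr (1/2)) * f (q t)) \<longlongrightarrow> 0) (at_right 0)"
    using asymptotics_moderate[OF as] unfolding moderate_at_0_def by simp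
  ultimately obtain B where B: "\<And>t. t \<in> {0<..r\<^sub>0} \<Longrightarrow> norm (of_real (t powr (1/2)) * f (q t)) \<le> B"
    using bounded_on_half_open by meson
  have "norm (f (q t) / (of_real t - s)) \<le> (B * M) / sqrt t" if t: "t \<in> {0<..r\<^sub>0}" for t
  proof -
    have "norm (f (q t)) \<le> B / sqrt t"
      using B[OF t] t by (simp add: norm_mult powr_half_sqrt field_simps)
    then have "norm (f (q t)) * norm (1 / (of_real t - s)) \<le> B / sqrt t * M"
      using M(2)[OF t] by (intro mult_mono) (auto intro: order_trans[OF norm_ge_zero])
    then show ?thesis by (simp add: norm_divide)
  qed
  then show ?thesis by blast
next
  case False
  then obtain c where c: "\<And>t. t \<in> {0<..r\<^sub>0} \<Longrightarrow> norm (f (q t)) \<le> c * sqrt t"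
    using as unfolding asymptotics_def by meson
  obtain M where M: "M \<ge> 0" "\<And>t. t \<in> {0<..r\<^sub>0} \<Longrightarrow> norm (1 / (of_real t - s)) \<le> M / t"
    using inverse_bounds(1)[OF s] by blast
  have "norm (f (q t) / (of_real t - s)) \<le> (c * M) / sqrt t" if t: "t \<in> {0<..r\<^sub>0}" for t
  proof -
    have "norm (f (q t)) * norm (1 / (of_real t - s)) \<le> c * sqrt t * (M / t)"
      using M(2)[OF t] c[OF t] by (intro mult_mono) (auto intro: order_trans[OF norm_ge_zero])
    also have "\<dots> = c * M * (sqrt t / t)" by simp
    also have "sqrt t / t = 1 / sqrt t"
      using t by (simp add: real_div_sqrt field_simps)
    finally show ?thesis by (simp add: norm_divide)
  qed
  then show ?thesis by blast
qed

text \<open>If only the letter 0 occurs, the primitive is adjusted at one point of the segment, and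
  equal derivatives carry the formula along all of it. Otherwise the primitive has a limit at 0,
  which is subtracted.\<close>

lemma hyper_step:
  assumes s: "s \<in> A" and f: "\<And>y. y \<in> Ct \<Longrightarrow> \<exists>d. hcd f y d" and as: "asymptotics w f"
  shows "\<exists>G. (\<forall>y\<in>Ct. hcd G y (f y / (p y - s))) \<and> (\<forall>y. y \<notin> Ct \<longrightarrow> G y = 0) \<and> asymptotics (s # w) G"
proof (cases "set (w @ [s]) \<subseteq> {0}")
  case True
  define n where "n = length w"
  define l where "l t = (of_real (ln t) ^ Suc n / fact (Suc n) :: complex)" for t :: real
  have qr: "q r\<^sub>0 \<in> Ct" using q_in r0 by auto
  obtain G where G: "\<And>y. y \<in> Ct \<Longrightarrow> hcd G y (f y / (p y - s))" "\<And>y. y \<notin> Ct \<Longrightarrow> G y = 0"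
      "G (q r\<^sub>0) = l r\<^sub>0"
    using ex_primitive_at[OF quotient_hcd[OF f _ s] qr, of "l r\<^sub>0"] by auto
  have "((\<lambda>t. G (q t) - l t) has_vector_derivative 0) (at t)" if t: "t \<in> {0<..<\<delta>}" for t
  proof -
    have "f (q t) / (p (q t) - s) = of_real (ln t) ^ n / fact n / of_real t"
      using as t True p_q[OF t] by (simp add: asymptotics_def n_def)
    then have 1: "((\<lambda>t. G (q t)) has_vector_derivative (of_real (ln t) ^ n / fact n / of_real t)) (at t)"
      using hcd_along_q[OF G(1)[OF q_in[OF t]] t] by simp
    have "((\<lambda>t. ln t ^ Suc n / fact (Suc n)) has_real_derivative (ln t ^ n / fact n / t)) (at t)"
    proof -
      have "(ln has_real_derivative 1 / t) (at t)" using t by (intro DERIV_ln_divide) auto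
      from DERIV_cdivide[OF DERIV_power[OF this, of "Suc n"], of "fact (Suc n)"]
      show ?thesis by (simp add: fact_Suc field_simps del: of_nat_Suc power_Suc)
    qed
    then have "((\<lambda>t. of_real (ln t ^ Suc n / fact (Suc n))) has_vector_derivative
        complex_of_real (ln t ^ n / fact n / t)) (at t)"
      by (intro has_vector_derivative_of_real) (simp add: has_real_derivative_iff_has_vector_derivative)
    then have "(l has_vector_derivative (of_real (ln t) ^ n / fact n / of_real t)) (at t)"
      by (simp add: l_def[abs_def])
    from has_vector_derivative_diff[OF 1 this] show ?thesis by simp
  qed
  then have "((\<lambda>t. G (q t) - l t) has_derivative (\<lambda>h. 0)) (at t within {0<..<\<delta>})"
    if "t \<in> {0<..<\<delta>}" for t
    using that by (auto simp: has_vector_derivative_def intro: has_derivative_at_withinI)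
  from has_derivative_zero_constant[OF _ this]
  obtain c where c: "\<And>t. t \<in> {0<..<\<delta>} \<Longrightarrow> G (q t) - l t = c" by auto
  have "c = 0" using c[of r\<^sub>0] G(3) r0 by simp
  then have "G (q t) = l t" if "t \<in> {0<..<\<delta>}" for t
    using c[OF that] by simp
  then have "asymptotics (s # w) G" using True by (auto simp: asymptotics_def l_def n_def)
  then show ?thesis using G by blast
next
  case False
  obtain G where G: "\<And>y. y \<in> Ct \<Longrightarrow> hcd G y (f y / (p y - s))"
    using ex_primitive[of "\<lambda>y. f y / (p y - s)"] quotient_hcd[OF f _ s] by blast
  obtain c where c: "\<And>t. t \<in> {0<..r\<^sub>0} \<Longrightarrow> norm (f (q t) / (of_real t - s)) \<le> c / sqrt t"
    using derivative_bound[OF s f as False] by blast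
  have "((\<lambda>t. G (q t)) has_vector_derivative f (q t) / (of_real t - s)) (at t)"
    if t: "t \<in> {0<..r\<^sub>0}" for t
    using hcd_along_q[OF G[OF q_in[OF r0(3)[OF t]]] r0(3)[OF t]] p_q[OF r0(3)[OF t]] by simp
  from limit_at_0_of_sqrt_bounded_derivative[OF r0(1) this c]
  obtain L where L: "\<And>t. t \<in> {0<..r\<^sub>0} \<Longrightarrow> norm (G (q t) - L) \<le> 2 * c * sqrt t"
    by meson
  define H where "H y = (if y \<in> Ct then G y + (- L) else 0)" for y
  have "hcd H y (f y / (p y - s))" if y: "y \<in> Ct" for y
    by (rule has_cover_derivative_cong[where f="\<lambda>y. G y + (- L)"])
      (use has_cover_derivative_add[OF G[OF y] hcd_const[OF y, of "- L"]] y in \<open>auto simp: H_def\<close>)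
  moreover have "asymptotics (s # w) H"
  proof -
    have "norm (H (q t)) \<le> 2 * c * sqrt t" if "t \<in> {0<..r\<^sub>0}" for t
      using L[OF that] q_in[OF r0(3)[OF that]] by (simp add: H_def)
    moreover have "\<not> set (s # w) \<subseteq> {0}" using False by auto
    ultimately show ?thesis unfolding asymptotics_def by meson
  qed
  ultimately show ?thesis by (intro exI[of _ H]) (auto simp: H_def)
qed

lemma asymptotics_rev [simp]: "asymptotics (rev w) = asymptotics w"
  by (simp add: asymptotics_def fun_eq_iff)

lemma hyper_aux:
  assumes "w \<in> lists A"
  shows "(\<forall>y\<in>Ct. \<exists>d. hcd (hyper w) y d) \<and> (\<forall>y. y \<notin> Ct \<longrightarrow> hyper w y = 0) \<and> asymptotics w (hyper w) \<and>
    (\<forall>s\<in>A. (\<forall>y\<in>Ct. hcd (hyper (w @ [s])) y (hyper w y / (p y - s))) \<and>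
      (\<forall>y. y \<notin> Ct \<longrightarrow> hyper (w @ [s]) y = 0) \<and> asymptotics (w @ [s]) (hyper (w @ [s])))"
proof -
  have step: "(\<forall>y\<in>Ct. hcd (hyper (w @ [s])) y (hyper w y / (p y - s))) \<and>
      (\<forall>y. y \<notin> Ct \<longrightarrow> hyper (w @ [s]) y = 0) \<and> asymptotics (w @ [s]) (hyper (w @ [s]))"
    if "s \<in> A" "\<And>y. y \<in> Ct \<Longrightarrow> \<exists>d. hcd (hyper w) y d" "asymptotics w (hyper w)" for w s
  proof -
    have "asymptotics (rev w) (hyper w)" using that by simp
    from someI_ex[OF hyper_step[OF that(1,2) this]]
    show ?thesis using asymptotics_rev[of "w @ [s]"] by (simp add: hyper_def)
  qed
  show ?thesis
    using assms
  proof (induction w rule: rev_induct)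
    case Nil
    have "(\<forall>y\<in>Ct. \<exists>d. hcd (hyper []) y d) \<and> (\<forall>y. y \<notin> Ct \<longrightarrow> hyper [] y = 0) \<and> asymptotics [] (hyper [])"
      using hcd_hol_one q_in by (auto simp: hyper_def hol_one_def asymptotics_def)
    then show ?case using step[of _ "[]"] by blast
  next
    case (snoc s w)
    then have "\<forall>y\<in>Ct. hcd (hyper (w @ [s])) y (hyper w y / (p y - s))"
        "\<forall>y. y \<notin> Ct \<longrightarrow> hyper (w @ [s]) y = 0" "asymptotics (w @ [s]) (hyper (w @ [s]))"
      by auto
    then show ?case using step[of _ "w @ [s]"] by blast
  qed
qed

lemma hyper_Nil: "hyper [] = hol_one Ct"
  by (simp add: hyper_def)

lemma hyper_hcd: "w \<in> lists A \<Longrightarrow> y \<in> Ct \<Longrightarrow> \<exists>d. hcd (hyper w) y d"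
  and hyper_out: "w \<in> lists A \<Longrightarrow> y \<notin> Ct \<Longrightarrow> hyper w y = 0"
  and hyper_asymptotics: "w \<in> lists A \<Longrightarrow> asymptotics w (hyper w)"
  and hyper_snoc: "w \<in> lists A \<Longrightarrow> s \<in> A \<Longrightarrow> y \<in> Ct \<Longrightarrow> hcd (hyper (w @ [s])) y (hyper w y / (p y - s))"
  using hyper_aux[of w] by auto

end

section \<open>Shuffle relations and path composition\<close>

context tangential_base_point
begin

lemma shuffle_lists: "u \<in> lists A \<Longrightarrow> v \<in> lists A \<Longrightarrow> w \<in> set (word_shuffles u v) \<Longrightarrow> w \<in> lists A"
  using set_word_shuffles[of w u v] by (auto simp: in_lists_conv_set)

lemma sum_list_divide: "(\<Sum>w\<leftarrow>ws. f w / c) = (\<Sum>w\<leftarrow>ws. f w) / (c :: complex)"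
  by (induction ws) (auto simp: add_divide_distrib)

text \<open>Grouping shuffles by their last letter gives the derivative the shape of the Leibniz
  rule for a product of two hyperlogarithms.\<close>

lemma hcd_shuffle_sum:
  assumes u: "u \<in> lists A" "a \<in> A" and v: "v \<in> lists A" "b \<in> A" and y: "y \<in> Ct"
  shows "hcd (\<lambda>y. \<Sum>w\<leftarrow>word_shuffles (u @ [a]) (v @ [b]). hyper w y) y
    ((\<Sum>w\<leftarrow>word_shuffles u (v @ [b]). hyper w y) / (p y - a) +
     (\<Sum>w\<leftarrow>word_shuffles (u @ [a]) v. hyper w y) / (p y - b))"
proof -
  have *: "hcd (\<lambda>y. \<Sum>w\<leftarrow>word_shuffles u' v'. hyper (w @ [s]) y) y
      ((\<Sum>w\<leftarrow>word_shuffles u' v'. hyper w y) / (p y - s))"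
    if "u' \<in> lists A" "v' \<in> lists A" "s \<in> A" for u' v' s
    unfolding sum_list_divide[symmetric]
  proof (rule has_cover_derivative_sum_list)
    fix w assume "w \<in> set (word_shuffles u' v')"
    then show "hcd (hyper (w @ [s])) y (hyper w y / (p y - s))"
      by (intro hyper_snoc shuffle_lists[OF that(1,2)] that(3) y)
  qed (rule hcd_const[OF y])
  have "(\<lambda>y. \<Sum>w\<leftarrow>word_shuffles (u @ [a]) (v @ [b]). hyper w y) =
     (\<lambda>y. (\<Sum>w\<leftarrow>word_shuffles u (v @ [b]). hyper (w @ [a]) y) +
       (\<Sum>w\<leftarrow>word_shuffles (u @ [a]) v. hyper (w @ [b]) y))"
    by (simp add: sum_word_shuffles_snoc)
  then show ?thesis
    using has_cover_derivative_add[OF *[of u "v @ [b]" a] *[of "u @ [a]" v b]] u v by simp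
qed

lemma moderate_hyper: "w \<in> lists A \<Longrightarrow> moderate_at_0 (\<lambda>t. hyper w (q t))"
  by (rule asymptotics_moderate[OF hyper_asymptotics])

lemma negligible_hyper: "w \<in> lists A \<Longrightarrow> \<not> set w \<subseteq> {0} \<Longrightarrow> negligible_at_0 (\<lambda>t. hyper w (q t))"
  by (rule asymptotics_negligible[OF hyper_asymptotics])

lemma eventually_segment: "\<forall>\<^sub>F t in at_right 0. t \<in> {0<..<\<delta>}"
  unfolding eventually_at_right_field using delta_pos by (intro exI[of _ \<delta>]) auto

text \<open>Along the segment both sides are the same monomial in the logarithm when \<open>u\<close> and \<open>v\<close>
  are powers of the letter \<open>0\<close>, and both tend to \<open>0\<close> otherwise.\<close>

lemma shuffle_difference_tendsto:
  assumes u: "u \<in> lists A" and v: "v \<in> lists A"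
  shows "((\<lambda>t. hyper u (q t) * hyper v (q t) - (\<Sum>w\<leftarrow>word_shuffles u v. hyper w (q t))) \<longlongrightarrow> 0)
    (at_right 0)"
proof (cases "set u \<subseteq> {0} \<and> set v \<subseteq> {0}")
  case True
  let ?n = "length u" and ?m = "length v"
  have "hyper u (q t) * hyper v (q t) - (\<Sum>w\<leftarrow>word_shuffles u v. hyper w (q t)) = 0"
    if t: "t \<in> {0<..<\<delta>}" for t
  proof -
    have w: "hyper w (q t) = of_real (ln t) ^ (?n + ?m) / fact (?n + ?m)"
      if "w \<in> set (word_shuffles u v)" for w
      using hyper_asymptotics[OF shuffle_lists[OF u v that]] True t
        set_word_shuffles[OF that] length_word_shuffles[OF that] by (simp add: asymptotics_def)
    have "(\<Sum>w\<leftarrow>word_shuffles u v. hyper w (q t))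
        = (\<Sum>w\<leftarrow>word_shuffles u v. of_real (ln t) ^ (?n + ?m) / fact (?n + ?m))"
      by (intro arg_cong[where f=sum_list] map_cong refl w)
    \<comment> \<open>The number of shuffles is exactly the factor between
      \<open>1 / fact (n + m)\<close> and \<open>1 / (fact n * fact m)\<close>.\<close>
    also have "\<dots> = of_nat ((?n + ?m) choose ?n) * (of_real (ln t) ^ (?n + ?m) / fact (?n + ?m))"
      by (simp add: sum_list_triv word_shuffles_count)
    also have "\<dots> = (of_real (ln t) ^ ?n / fact ?n) * (of_real (ln t) ^ ?m / fact ?m)"
      by (simp add: binomial_fact power_add field_simps)
    finally show ?thesis
      using hyper_asymptotics[OF u] hyper_asymptotics[OF v] True t by (simp add: asymptotics_def)
  qed
  then have "\<forall>\<^sub>F t in at_right 0.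
      0 = hyper u (q t) * hyper v (q t) - (\<Sum>w\<leftarrow>word_shuffles u v. hyper w (q t))"
    using eventually_segment by (auto elim!: eventually_mono)
  then show ?thesis by (rule Lim_transform_eventually[OF tendsto_const])
next
  case False
  have "((\<lambda>t. hyper u (q t) * hyper v (q t)) \<longlongrightarrow> 0) (at_right 0)"
  proof (cases "set u \<subseteq> {0}")
    case True
    then have "\<not> set v \<subseteq> {0}" using False by blast
    from negligible_at_0_mult[OF negligible_hyper[OF v this] moderate_hyper[OF u]]
    show ?thesis by (simp add: mult.commute)
  next
    case False
    from negligible_at_0_mult[OF negligible_hyper[OF u this] moderate_hyper[OF v]]
    show ?thesis .
  qed
  moreover have "((\<lambda>t. \<Sum>w\<leftarrow>ws. hyper w (q t)) \<longlongrightarrow> 0) (at_right 0)"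
    if "set ws \<subseteq> set (word_shuffles u v)" for ws
    using that
  proof (induction ws)
    case (Cons w ws)
    have "\<not> set w \<subseteq> {0}" using Cons.prems set_word_shuffles[of w u v] False by auto
    then have "((\<lambda>t. hyper w (q t)) \<longlongrightarrow> 0) (at_right 0)"
      using Cons.prems shuffle_lists[OF u v] by (intro negligible_at_0_tendsto negligible_hyper) auto
    then show ?case using Cons by (simp add: tendsto_add_zero)
  qed simp
  ultimately show ?thesis using tendsto_diff by fastforce
qed

theorem hyper_shuffle:
  assumes "u \<in> lists A" "v \<in> lists A"
  shows "(\<Sum>w\<leftarrow>word_shuffles u v. hyper w y) = hyper u y * hyper v y"
proof (cases "y \<in> Ct")
  case True
  with assms show ?thesis
  \<comment> \<open>The point y is generalized because the derivative of \<open>D\<close> at each z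
    uses the relation for shorter pairs at z.\<close>
  proof (induction "length u + length v" arbitrary: u v y rule: less_induct)
    case less
    show ?case
    proof (cases "u = [] \<or> v = []")
      case True
      then show ?thesis using less.prems(3) by (auto simp: hyper_Nil hol_one_def)
    next
      case False
      then obtain u' a v' b where uv: "u = u' @ [a]" "v = v' @ [b]" by (metis rev_exhaust)
      have l: "u' \<in> lists A" "a \<in> A" "v' \<in> lists A" "b \<in> A" using less.prems uv by auto
      define D where "D y = hyper u y * hyper v y + (-1) * (\<Sum>w\<leftarrow>word_shuffles u v. hyper w y)" for y
      have "hcd D z 0" if z: "z \<in> Ct" for z
      proof -
        have "(\<Sum>w\<leftarrow>word_shuffles u' v. hyper w z) = hyper u' z * hyper v z"
          "(\<Sum>w\<leftarrow>word_shuffles u v'. hyper w z) = hyper u z * hyper v' z"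
          using less.hyps[of u' v z] less.hyps[of u v' z] l less.prems z uv by auto
        then have "hcd (\<lambda>y. \<Sum>w\<leftarrow>word_shuffles u v. hyper w y) z
            (hyper u' z * hyper v z / (p z - a) + hyper u z * hyper v' z / (p z - b))"
          using hcd_shuffle_sum[OF l z] uv by simp
        from has_cover_derivative_add[OF has_cover_derivative_mult[OF hyper_snoc[OF l(1,2) z]
              hyper_snoc[OF l(3,4) z]] has_cover_derivative_cmult[OF this, of "-1"]]
        show ?thesis unfolding D_def by (simp add: uv algebra_simps)
      qed
      then have const: "D z = D y" if "z \<in> Ct" for z
        using hcd_zero_const[of D z y] that less.prems(3) by blast
      have "((\<lambda>t. D (q t)) \<longlongrightarrow> 0) (at_right 0)"
        using shuffle_difference_tendsto[OF less.prems(1,2)] by (simp add: D_def)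
      moreover have "\<forall>\<^sub>F t in at_right 0. D (q t) = D y"
        using eventually_segment by eventually_elim (rule const[OF q_in])
      \<comment> \<open>\<open>D\<close> is constant on the cover, so its limit along the segment is
        its value at y.\<close>
      ultimately have "((\<lambda>_. D y) \<longlongrightarrow> 0) (at_right (0::real))" by (rule Lim_transform_eventually)
      then have "D y = 0" by (simp add: tendsto_const_iff)
      then show ?thesis by (simp add: D_def)
    qed
  qed
next
  case False
  have "(\<Sum>w\<leftarrow>word_shuffles u v. hyper w y) = (\<Sum>w\<leftarrow>word_shuffles u v. 0)"
    using False shuffle_lists[OF assms] hyper_out by (intro arg_cong[where f=sum_list] map_cong) auto
  then show ?thesis using hyper_out[OF assms(1) False] by simp
qed

text \<open>For a nonempty word, the summand with full prefix is the constant
  \<open>hyper w x\<close>. It fixes the value at x, where all other summands vanish, and their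
  derivatives are governed by the formula without the last letter.\<close>

theorem hyper_path_composition:
  assumes w: "w \<in> lists A" and x: "x \<in> Ct"
  shows "hyper w y = (\<Sum>k\<le>length w. hyper (take k w) x * Jw x (drop k w) y)"
proof (cases "y \<in> Ct")
  case True
  with w show ?thesis
  proof (induction w arbitrary: y rule: rev_induct)
    case Nil
    then show ?case using x by (simp add: hyper_Nil J_Nil hol_one_def)
  next
    case (snoc s w)
    then have w: "w \<in> lists A" and s: "s \<in> A" by auto
    let ?n = "length w"
    have sp: "(\<Sum>k\<le>length (w @ [s]). hyper (take k (w @ [s])) x * Jw x (drop k (w @ [s])) z) =
        (\<Sum>k\<le>?n. hyper (take k w) x * Jw x (drop k w @ [s]) z) + hyper (w @ [s]) x" if "z \<in> Ct" for z
      using that by (simp add: J_Nil hol_one_def)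
    have dr: "drop k w \<in> lists A" for k using w by (meson in_listsD in_listsI in_set_dropD)
    have "hyper (w @ [s]) y =
        (\<Sum>k\<le>?n. hyper (take k w) x * Jw x (drop k w @ [s]) y) + hyper (w @ [s]) x"
    proof (rule hcd_eqI[OF hyper_snoc[OF w s] _ x _ snoc.prems(2)])
      fix z assume z: "z \<in> Ct"
      have "hcd (\<lambda>z. \<Sum>k\<le>?n. hyper (take k w) x * Jw x (drop k w @ [s]) z) z
          (\<Sum>k\<le>?n. hyper (take k w) x * (Jw x (drop k w) z / (p z - s)))"
        by (intro has_cover_derivative_sum has_cover_derivative_cmult Jw_snoc(1)[OF dr s x z] hcd_const z)
      moreover have "(\<Sum>k\<le>?n. hyper (take k w) x * (Jw x (drop k w) z / (p z - s))) = hyper w z / (p z - s)"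
        by (simp add: snoc.IH[OF w z] sum_divide_distrib)
      ultimately have "hcd (\<lambda>z. \<Sum>k\<le>?n. hyper (take k w) x * Jw x (drop k w @ [s]) z) z (hyper w z / (p z - s))"
        by simp
      from has_cover_derivative_add[OF this hcd_const[OF z, of "hyper (w @ [s]) x"]]
      show "hcd (\<lambda>z. (\<Sum>k\<le>?n. hyper (take k w) x * Jw x (drop k w @ [s]) z) + hyper (w @ [s]) x)
          z (hyper w z / (p z - s))"
        by simp
    next
      show "hyper (w @ [s]) x = (\<Sum>k\<le>?n. hyper (take k w) x * Jw x (drop k w @ [s]) x) + hyper (w @ [s]) x"
        by (simp only: Jw_snoc(2)[OF dr s x x] mult_zero_right sum.neutral_const add_0)
    qed
    then show ?case using sp[OF snoc.prems(2)] by simp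
  qed
next
  case False
  have "drop k w \<in> lists A" for k using w by (meson in_listsD in_listsI in_set_dropD)
  then show ?thesis using hyper_out[OF w False] Jw_out[OF _ x False] by simp
qed

text \<open>The summand with empty prefix is \<open>Jw x w y\<close>, so the unitriangular formula
  can be solved for it; the integrals left on the right belong to shorter words.\<close>

lemma Jw_eq_hyper:
  assumes w: "w \<in> lists A" and x: "x \<in> Ct"
  shows "Jw x w y = hyper w y - (\<Sum>k\<in>{1..length w}. hyper (take k w) x * Jw x (drop k w) y)"
proof -
  have "{..length w} = insert 0 {1..length w}" by auto
  then show ?thesis
    using hyper_path_composition[OF w x, of y] x by (simp add: hyper_Nil hol_one_def)
qed

lemma take_drop_lists: "w \<in> lists A \<Longrightarrow> take k w \<in> lists A" "w \<in> lists A \<Longrightarrow> drop k w \<in> lists A"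
  by (auto simp: in_lists_conv_set dest: in_set_takeD in_set_dropD)

lemma moderate_at_0_cong:
  assumes "moderate_at_0 f" "\<And>t. t \<in> {0<..<\<delta>} \<Longrightarrow> f t = g t"
  shows "moderate_at_0 g"
proof -
  have ev: "\<forall>\<^sub>F t in at_right 0. of_real (t powr \<beta>) * f t = of_real (t powr \<beta>) * g t" for \<beta>
    using eventually_segment by eventually_elim (simp add: assms(2))
  then show ?thesis
    using assms(1) Lim_transform_eventually[OF _ ev] unfolding moderate_at_0_def by blast
qed

text \<open>The base point moves while y stays fixed. The solved composition formula expresses the
  integral through shorter ones and hyperlogarithms at the moving point, all of them
  moderate.\<close>

lemma moderate_Jw:
  assumes "w \<in> lists A"
  shows "moderate_at_0 (\<lambda>t. Jw (q t) w y)"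
  using assms
proof (induction "length w" arbitrary: w rule: less_induct)
  case less
  have "moderate_at_0 (\<lambda>t. hyper w y + (\<Sum>k\<in>{1..length w}. (-1) * (hyper (take k w) (q t) * Jw (q t) (drop k w) y)))"
    using less by (intro moderate_at_0_add moderate_at_0_const moderate_at_0_sum moderate_at_0_mult
        moderate_hyper take_drop_lists less.hyps) auto
  then show ?case
    by (rule moderate_at_0_cong) (simp add: Jw_eq_hyper[OF less.prems q_in] sum_negf)
qed

text \<open>A nonempty prefix contains the nonzero first letter, so its hyperlogarithm at the moving
  base point is negligible and outweighs the moderate integral of the remaining word.\<close>

theorem Jw_tendsto_hyper:
  assumes w: "w \<in> lists A" and first: "w = [] \<or> hd w \<noteq> 0"
  shows "((\<lambda>t. Jw (q t) w y) \<longlongrightarrow> hyper w y) (at_right 0)"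
proof -
  have "((\<lambda>t. hyper (take k w) (q t) * Jw (q t) (drop k w) y) \<longlongrightarrow> 0) (at_right 0)"
    if "k \<in> {1..length w}" for k
  proof (intro negligible_at_0_mult negligible_hyper moderate_Jw take_drop_lists w)
    have "w \<noteq> []" using that by auto
    then have "hd w \<in> set (take k w)" using that by (cases w; cases k) auto
    then show "\<not> set (take k w) \<subseteq> {0}" using first \<open>w \<noteq> []\<close> by auto
  qed
  then have "((\<lambda>t. hyper w y - (\<Sum>k\<in>{1..length w}. hyper (take k w) (q t) * Jw (q t) (drop k w) y))
      \<longlongrightarrow> hyper w y - (\<Sum>k\<in>{1..length w}. 0)) (at_right 0)"
    by (intro tendsto_diff tendsto_const tendsto_sum)
  moreover have "\<forall>\<^sub>F t in at_right 0.
      hyper w y - (\<Sum>k\<in>{1..length w}. hyper (take k w) (q t) * Jw (q t) (drop k w) y) = Jw (q t) w y"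
    using eventually_segment by eventually_elim (simp add: Jw_eq_hyper[OF w q_in])
  ultimately show ?thesis by (simp add: Lim_transform_eventually)
qed

end

section \<open>The two bases of the algebra of hyperlogarithms\<close>

lemma leading_zeros:
  fixes w :: "complex list"
  obtains k v where "w = replicate k 0 @ v" "v = [] \<or> hd v \<noteq> 0"
proof -
  have "\<exists>k v. w = replicate k 0 @ v \<and> (v = [] \<or> hd v \<noteq> 0)"
  proof (induction w)
    case Nil
    then show ?case by (intro exI[of _ 0] exI[of _ "[]"]) simp
  next
    case (Cons s w)
    then obtain k v where kv: "w = replicate k 0 @ v" "v = [] \<or> hd v \<noteq> 0" by blast
    show ?case
    proof (cases "s = 0")
      case True
      then show ?thesis using kv by (intro exI[of _ "Suc k"] exI[of _ v]) simp
    next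
      case False
      then show ?thesis by (intro exI[of _ 0] exI[of _ "s # w"]) simp
    qed
  qed
  then show ?thesis using that by blast
qed

text \<open>The letter can enter at the leading block in k + 1 places with the same result; every
  other insertion comes after the first letter of v.\<close>

lemma sum_shuffles_leading_letter:
  fixes H :: "'b list \<Rightarrow> complex"
  shows "(\<Sum>w\<leftarrow>word_shuffles [a] (replicate k a @ v). H w) =
    of_nat (Suc k) * H (replicate (Suc k) a @ v) +
    (case v of [] \<Rightarrow> 0 | c # v' \<Rightarrow> (\<Sum>x\<leftarrow>word_shuffles [a] v'. H (replicate k a @ c # x)))"
proof (induction k arbitrary: H)
  case 0
  then show ?case by (cases v) (simp_all add: o_def)
next
  case (Suc k)
  have "(\<Sum>w\<leftarrow>word_shuffles [a] (replicate (Suc k) a @ v). H w) =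
      H (replicate (Suc (Suc k)) a @ v) + (\<Sum>w\<leftarrow>word_shuffles [a] (replicate k a @ v). H (a # w))"
    by (simp add: o_def)
  then show ?case unfolding Suc.IH[of "\<lambda>w. H (a # w)"]
    by (cases v) (simp_all add: algebra_simps)
qed

lemma linear_extension_span:
  assumes f: "\<And>w. w \<in> lists A \<Longrightarrow> \<exists>s\<in>Sh A. \<forall>y. f w y = linear_extension (\<lambda>v. g v y) s"
    and t: "t \<in> Sh A"
  shows "\<exists>s\<in>Sh A. \<forall>y. linear_extension (\<lambda>w. f w y) t = linear_extension (\<lambda>v. g v y) s"
proof -
  obtain s where s: "\<And>w. w \<in> lists A \<Longrightarrow> s w \<in> Sh A"
      "\<And>w y. w \<in> lists A \<Longrightarrow> f w y = linear_extension (\<lambda>v. g v y) (s w)"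
    using f by metis
  have k: "w \<in> lists A" if "w \<in> Poly_Mapping.keys t" for w using t that by (auto simp: Sh_def)
  let ?s = "\<Sum>w\<in>Poly_Mapping.keys t. scale_comb (Poly_Mapping.lookup t w) (s w)"
  have "?s \<in> Sh A" by (intro Sh_sum Sh_scale s(1) k)
  moreover have "linear_extension (\<lambda>w. f w y) t = linear_extension (\<lambda>v. g v y) ?s" for y
    unfolding linear_extension_sum linear_extension_scale
    unfolding linear_extension_def[of "\<lambda>w. f w y"] by (intro sum.cong refl) (simp add: s(2) k)
  ultimately show ?thesis by blast
qed

lemma Sh_star_subset: "Sh_star A \<subseteq> Sh A"
proof -
  have "insert [] {s # w |s w. s \<in> A - {0} \<and> w \<in> lists A} \<subseteq> lists A" by auto
  then show ?thesis unfolding Sh_star_def Sh_def by blast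
qed

lemma Sh_algebra_morphism_linear:
  assumes F: "Sh_algebra_morphism A Ct p F" and t: "t \<in> Sh A"
  shows "F t y = linear_extension (\<lambda>w. F (word w) y) t"
proof -
  have add: "\<And>s t. s \<in> Sh A \<Longrightarrow> t \<in> Sh A \<Longrightarrow> F (s + t) y = F s y + F t y"
    and scale: "\<And>c t. t \<in> Sh A \<Longrightarrow> F (scale_comb c t) y = c * F t y"
    using F by (auto simp: Sh_algebra_morphism_def)
  have zero: "F 0 y = 0"
    using scale[of "word []" 0] by (simp add: word_in_Sh)
  let ?f = "\<lambda>w. scale_comb (Poly_Mapping.lookup t w) (word w)"
  have "F (sum ?f X) y = (\<Sum>w\<in>X. Poly_Mapping.lookup t w * F (word w) y)"
    if "finite X" "X \<subseteq> lists A" for X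
    using that
  proof (induction X rule: finite_induct)
    case (insert w X)
    have "sum ?f X \<in> Sh A" using insert by (intro Sh_sum Sh_scale word_in_Sh) auto
    moreover have "?f w \<in> Sh A" using insert by (intro Sh_scale word_in_Sh) auto
    ultimately show ?case using insert by (simp add: add scale word_in_Sh)
  qed (simp add: zero)
  from this[of "Poly_Mapping.keys t"] show ?thesis
    using t word_comb_expand[of t] by (simp add: Sh_def linear_extension_def)
qed

text \<open>\<open>Sh(H\<^sub>C)\<close> is generated by \<open>Sh\<^sup>*(H\<^sub>C)\<close> and the letter \<open>0\<close>: induction on the number of
  leading zeros \<open>k\<close>, since shuffling the letter \<open>0\<close> into a word with \<open>k\<close> leading zeros yields
  \<open>k + 1\<close> times the word with one more of them, plus words with \<open>k\<close> leading zeros.\<close>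

lemma Sh_algebra_morphism_unique:
  fixes Ct :: "'a::topological_space set"
  assumes F: "Sh_algebra_morphism A Ct p F" and G: "Sh_algebra_morphism A Ct p G"
    and A: "0 \<in> A" and star: "\<And>t. t \<in> Sh_star A \<Longrightarrow> F t = G t" and letter: "F (word [0]) = G (word [0])"
    and t: "t \<in> Sh A"
  shows "F t = G t"
proof -
  have shuffle: "(\<Sum>w\<leftarrow>word_shuffles [0] u. H (word w) y) = H (word [0]) y * H (word u) y"
    if H: "Sh_algebra_morphism A Ct p H" and u: "u \<in> lists A" for H u y
  proof -
    have "word [0] \<in> Sh A" "word u \<in> Sh A" using u A by (simp_all add: word_in_Sh)
    then have "H (shuffle_prod (word [0]) (word u)) y = H (word [0]) y * H (word u) y"
      and "shuffle_prod (word [0]) (word u) \<in> Sh A"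
      using H by (auto simp: Sh_algebra_morphism_def shuffle_prod_in_Sh)
    then show ?thesis
      using Sh_algebra_morphism_linear[OF H, of "shuffle_prod (word [0]) (word u)" y]
      by (simp add: shuffle_prod_word linear_extension_sum_list)
  qed
  have zeros: "F (word (replicate k 0 @ v)) = G (word (replicate k 0 @ v))"
    if "v \<in> lists A" "v = [] \<or> hd v \<noteq> 0" for k v
    using that
  proof (induction k arbitrary: v)
    case 0
    then have "word v \<in> Sh_star A" by (cases v) (auto simp: Sh_star_def)
    then show ?case using star by simp
  next
    case (Suc k)
    let ?u = "replicate k 0 @ v"
    have u: "?u \<in> lists A" using Suc.prems A by (auto simp: in_lists_conv_set)
    show ?case
    proof
      fix y
      let ?R = "\<lambda>H :: complex word_comb \<Rightarrow> 'a \<Rightarrow> complex. case v of [] \<Rightarrow> 0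
        | c # v' \<Rightarrow> (\<Sum>x\<leftarrow>word_shuffles [0] v'. H (word (replicate k 0 @ c # x)) y)"
      have "?R F = ?R G"
      proof (cases v)
        case (Cons c v')
        \<comment> \<open>Here 0 has been inserted behind the nonzero letter c, so there are still k
          leading zeros, and the induction hypothesis applies with \<open>c # x\<close> in place of
          v.\<close>
        have "F (word (replicate k 0 @ c # x)) y = G (word (replicate k 0 @ c # x)) y"
          if "x \<in> set (word_shuffles [0] v')" for x
        proof -
          have "c # x \<in> lists A"
            using set_word_shuffles[OF that] Suc.prems(1) A Cons by (auto simp: in_lists_conv_set)
          then show ?thesis using Suc.IH[of "c # x"] Suc.prems(2) Cons by simp
        qed
        then have "(\<Sum>x\<leftarrow>word_shuffles [0] v'. F (word (replicate k 0 @ c # x)) y) =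
            (\<Sum>x\<leftarrow>word_shuffles [0] v'. G (word (replicate k 0 @ c # x)) y)"
          by (intro arg_cong[where f=sum_list] map_cong refl)
        then show ?thesis by (simp add: Cons)
      qed simp
      moreover have "of_nat (Suc k) * F (word (replicate (Suc k) 0 @ v)) y + ?R F =
          of_nat (Suc k) * G (word (replicate (Suc k) 0 @ v)) y + ?R G"
        using shuffle[OF F u, of y] shuffle[OF G u, of y] letter Suc.IH[OF Suc.prems]
        unfolding sum_shuffles_leading_letter by simp
      ultimately have "of_nat (Suc k) * F (word (replicate (Suc k) 0 @ v)) y =
          of_nat (Suc k) * G (word (replicate (Suc k) 0 @ v)) y" by simp
      \<comment> \<open>The multiplicity k + 1 is a nonzero complex number and can be
        cancelled.\<close>
      then show "F (word (replicate (Suc k) 0 @ v)) y = G (word (replicate (Suc k) 0 @ v)) y"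
        by (simp only: mult_cancel_left of_nat_eq_0_iff nat.distinct simp_thms)
    qed
  qed
  have words: "F (word w) = G (word w)" if w: "w \<in> lists A" for w
  proof -
    obtain k v where kv: "w = replicate k 0 @ v" "v = [] \<or> hd v \<noteq> 0" by (rule leading_zeros)
    then show ?thesis using zeros[of v k] w by simp
  qed
  have "linear_extension (\<lambda>w. F (word w) y) t = linear_extension (\<lambda>w. G (word w) y) t" for y
    unfolding linear_extension_def
  proof (rule sum.cong[OF refl])
    fix w assume "w \<in> Poly_Mapping.keys t"
    then have "w \<in> lists A" using t unfolding Sh_def by blast
    then show "Poly_Mapping.lookup t w * F (word w) y = Poly_Mapping.lookup t w * G (word w) y"
      by (simp add: words)
  qed
  then show ?thesis
    using Sh_algebra_morphism_linear[OF F t] Sh_algebra_morphism_linear[OF G t] by (intro ext) simp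
qed

lemma hol_subalgebra_sum:
  assumes B: "hol_subalgebra Ct p B" and f: "\<And>i. i \<in> X \<Longrightarrow> f i \<in> B"
  shows "(\<lambda>y. \<Sum>i\<in>X. c i * f i y) \<in> B"
proof -
  have one: "hol_one Ct \<in> B" and cmult: "\<forall>c. \<forall>f\<in>B. (\<lambda>x. c * f x) \<in> B"
    and add: "\<forall>f\<in>B. \<forall>g\<in>B. (\<lambda>x. f x + g x) \<in> B"
    using B by (simp_all add: hol_subalgebra_def)
  have "(\<lambda>y. 0 * hol_one Ct y) \<in> B" using bspec[OF spec[OF cmult] one] .
  then have zero: "(\<lambda>y. 0) \<in> B" by simp
  show ?thesis using f
  proof (induction X rule: infinite_finite_induct)
    case (insert i X)
    have 1: "(\<lambda>y. c i * f i y) \<in> B" using bspec[OF spec[OF cmult]] insert.prems by simp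
    have 2: "(\<lambda>y. \<Sum>i\<in>X. c i * f i y) \<in> B" using insert by simp
    show ?case using bspec[OF bspec[OF add 1] 2] insert.hyps by simp
  qed (simp_all add: zero)
qed

lemma hol_subalgebra_morphism_image:
  assumes F: "Sh_algebra_morphism A Ct p F"
  shows "hol_subalgebra Ct p (F ` Sh A)"
proof -
  have 1: "hol_one Ct \<in> F ` Sh A"
    using F word_in_Sh[of "[]" A] by (metis Sh_algebra_morphism_def imageI lists.Nil)
  have 2: "(\<lambda>x. c * f x) \<in> F ` Sh A" if f: "f \<in> F ` Sh A" for c f
  proof -
    obtain t where t: "t \<in> Sh A" "f = F t" using f by blast
    then have "(\<lambda>x. c * f x) = F (scale_comb c t)" using F by (simp add: Sh_algebra_morphism_def)
    then show ?thesis using Sh_scale[OF t(1)] by blast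
  qed
  have 3: "(\<lambda>x. f x + g x) \<in> F ` Sh A \<and> (\<lambda>x. f x * g x) \<in> F ` Sh A"
    if fg: "f \<in> F ` Sh A" "g \<in> F ` Sh A" for f g
  proof -
    obtain t s where t: "t \<in> Sh A" "f = F t" "s \<in> Sh A" "g = F s" using fg by blast
    then have "(\<lambda>x. f x + g x) = F (t + s)" "(\<lambda>x. f x * g x) = F (shuffle_prod t s)"
      using F by (simp_all add: Sh_algebra_morphism_def)
    then show ?thesis using Sh_add[OF t(1,3)] shuffle_prod_in_Sh[OF t(1,3)] by blast
  qed
  have "F ` Sh A \<subseteq> O_hol Ct p" using F by (simp add: Sh_algebra_morphism_def)
  then show ?thesis unfolding hol_subalgebra_def using 1 2 3 by blast
qed

section \<open>Identification of \<open>f_tilde\<close> and comparison of the three algebras\<close>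

context tangential_base_point
begin

text \<open>Restricted to \<open>Sh A\<close> so that it can equal \<open>f_tilde\<close> as a
  function on the whole type.\<close>

definition hyper_ext :: "complex word_comb \<Rightarrow> 'a \<Rightarrow> complex" where
  "hyper_ext = (\<lambda>t\<in>Sh A. \<lambda>y. linear_extension (\<lambda>w. hyper w y) t)"

lemma hyper_ext_word: "w \<in> lists A \<Longrightarrow> hyper_ext (word w) = hyper w"
  by (simp add: hyper_ext_def word_in_Sh)

lemma hyper_ext_morphism: "Sh_algebra_morphism A Ct p hyper_ext"
proof -
  have "hyper_ext t \<in> O_hol Ct p" if t: "t \<in> Sh A" for t
  proof -
    have k: "w \<in> lists A" if "w \<in> Poly_Mapping.keys t" for w using t that by (auto simp: Sh_def)
    have eq: "hyper_ext t = (\<lambda>y. \<Sum>w\<in>Poly_Mapping.keys t. Poly_Mapping.lookup t w * hyper w y)"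
      using t by (simp add: hyper_ext_def linear_extension_def)
    have "\<exists>d. hcd (hyper_ext t) y d" if y: "y \<in> Ct" for y
    proof -
      obtain d where "\<And>w. w \<in> Poly_Mapping.keys t \<Longrightarrow> hcd (hyper w) y (d w)"
        using hyper_hcd[OF k y] by metis
      then have "hcd (hyper_ext t) y (\<Sum>w\<in>Poly_Mapping.keys t. Poly_Mapping.lookup t w * d w)"
        unfolding eq by (intro has_cover_derivative_sum has_cover_derivative_cmult hcd_const y)
      then show ?thesis by blast
    qed
    moreover have "hyper_ext t y = 0" if "y \<notin> Ct" for y
      unfolding eq using hyper_out[OF k that] by simp
    ultimately show ?thesis by (simp add: O_hol_iff)
  qed
  moreover have "hyper_ext (word []) = hol_one Ct" by (simp add: hyper_ext_word hyper_Nil)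
  moreover have "hyper_ext (scale_comb c t) = (\<lambda>x. c * hyper_ext t x)" if "t \<in> Sh A" for c t
    using that by (simp add: hyper_ext_def Sh_scale linear_extension_scale)
  moreover have "hyper_ext (t + t') = (\<lambda>x. hyper_ext t x + hyper_ext t' x)"
      "hyper_ext (shuffle_prod t t') = (\<lambda>x. hyper_ext t x * hyper_ext t' x)"
    if t: "t \<in> Sh A" "t' \<in> Sh A" for t t'
  proof -
    show "hyper_ext (t + t') = (\<lambda>x. hyper_ext t x + hyper_ext t' x)"
      using t by (simp add: hyper_ext_def Sh_add linear_extension_add)
    have "linear_extension (\<lambda>w. hyper w y) (shuffle_prod t t') =
        linear_extension (\<lambda>w. hyper w y) t * linear_extension (\<lambda>w. hyper w y) t'" for y
      by (intro linear_extension_shuffle_prod hyper_shuffle) (use t in \<open>auto simp: Sh_def\<close>)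
    then show "hyper_ext (shuffle_prod t t') = (\<lambda>x. hyper_ext t x * hyper_ext t' x)"
      using t by (simp add: hyper_ext_def shuffle_prod_in_Sh)
  qed
  ultimately show ?thesis unfolding Sh_algebra_morphism_def by blast
qed

text \<open>\<open>Sh_star\<close> is spanned by the words not starting with 0, for which the
  integral from the moving base point converges to the hyperlogarithm.\<close>

lemma f_star_eq:
  assumes inv: "\<And>s. s \<in> {0<..<\<delta>} \<Longrightarrow> inv_into K p (of_real s) = q s" and t: "t \<in> Sh_star A"
  shows "f_star A Ct p K t = hyper_ext t"
proof
  fix y
  have tS: "t \<in> Sh A" using t Sh_star_subset[of A] by blast
  show "f_star A Ct p K t y = hyper_ext t y"
  proof (cases "y \<in> Ct")
    case True
    have "((\<lambda>\<epsilon>. linear_extension (\<lambda>w. Jw (q \<epsilon>) w y) t) \<longlongrightarrow> linear_extension (\<lambda>w. hyper w y) t) (at_right 0)"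
      unfolding linear_extension_def
    proof (intro tendsto_sum tendsto_mult_left Jw_tendsto_hyper)
      fix w assume "w \<in> Poly_Mapping.keys t"
      then show "w \<in> lists A" "w = [] \<or> hd w \<noteq> 0" using t tS by (auto simp: Sh_star_def Sh_def)
    qed
    moreover have "\<forall>\<^sub>F \<epsilon> in at_right 0. linear_extension (\<lambda>w. Jw (q \<epsilon>) w y) t =
        I_map Ct p (inv_into K p (complex_of_real \<epsilon>)) (sigma0_star A t) y"
      using eventually_segment by eventually_elim (simp add: inv I_map_sigma0[OF tS q_in])
    ultimately have "((\<lambda>\<epsilon>. I_map Ct p (inv_into K p (complex_of_real \<epsilon>)) (sigma0_star A t) y)
        \<longlongrightarrow> linear_extension (\<lambda>w. hyper w y) t) (at_right 0)"
      by (rule Lim_transform_eventually)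
    then show ?thesis using True tS
      by (simp add: f_star_def hyper_ext_def tendsto_Lim)
  next
    case False
    have "hyper_ext t \<in> O_hol Ct p"
      using hyper_ext_morphism tS unfolding Sh_algebra_morphism_def by blast
    then show ?thesis using False by (simp add: f_star_def O_hol_iff)
  qed
qed

text \<open>The differential determines the function up to a constant, and agreement at one point of
  the segment removes it.\<close>

lemma cover_log_eq:
  assumes K: "K = q ` {0<..<\<delta>}"
  shows "cover_log A Ct p K = hyper [0]"
  unfolding cover_log_def
proof (rule the_equality, intro conjI)
  have l: "[0] \<in> lists A" using zero_in_A by simp
  show "hyper [0] \<in> O_hol Ct p"
    using hyper_hcd[OF l] hyper_out[OF l] by (simp add: O_hol_iff)
  have d: "hcd (hyper [0]) y (dlog_form A 0 (p y))" if y: "y \<in> Ct" for y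
    using hyper_snoc[of "[]" 0 y] zero_in_A y p_in_base[OF y]
    by (simp add: hyper_Nil hol_one_def dlog_form_def)
  then show "has_differential Ct p (hyper [0]) (dlog_form A 0)" by (simp add: has_differential_iff)
  have ln: "hyper [0] (q t) = complex_of_real (ln (Re (p (q t))))" if "t \<in> {0<..<\<delta>}" for t
    using hyper_asymptotics[OF l] that p_q[OF that] by (simp add: asymptotics_def)
  then show "\<forall>x\<in>K. hyper [0] x = complex_of_real (ln (Re (p x)))" by (auto simp: K)
  fix f assume f: "f \<in> O_hol Ct p \<and> has_differential Ct p f (dlog_form A 0) \<and>
      (\<forall>x\<in>K. f x = complex_of_real (ln (Re (p x))))"
  define t where "t = \<delta> / 2"
  have t: "t \<in> {0<..<\<delta>}" using delta_pos by (simp add: t_def)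
  show "f = hyper [0]"
  proof (rule J_eqI[OF _ d])
    show "hcd f y (dlog_form A 0 (p y))" if "y \<in> Ct" for y
      using f that by (simp add: has_differential_iff)
    show "q t \<in> Ct" using q_in[OF t] .
    have "q t \<in> K" using t K by simp
    then show "f (q t) = hyper [0] (q t)" using f ln[OF t] by simp
    show "f y = hyper [0] y" if "y \<notin> Ct" for y
      using f that hyper_out[OF l] by (simp add: O_hol_iff)
  qed
qed

lemma f_tilde_eq:
  assumes K: "K = q ` {0<..<\<delta>}"
    and inv: "\<And>s. s \<in> {0<..<\<delta>} \<Longrightarrow> inv_into K p (of_real s) = q s"
  shows "f_tilde A Ct p K = hyper_ext"
  unfolding f_tilde_def
proof (rule the_equality, intro conjI)
  have l: "[0] \<in> lists A" using zero_in_A by simp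
  show ext: "hyper_ext \<in> extensional (Sh A)" by (simp add: hyper_ext_def)
  show "Sh_algebra_morphism A Ct p hyper_ext" by (rule hyper_ext_morphism)
  show "\<forall>t\<in>Sh_star A. hyper_ext t = f_star A Ct p K t" using f_star_eq[OF inv] by simp
  show log: "hyper_ext (word [0]) = cover_log A Ct p K"
    using hyper_ext_word[OF l] cover_log_eq[OF K] by simp
  fix F assume F: "F \<in> extensional (Sh A) \<and> Sh_algebra_morphism A Ct p F \<and>
      (\<forall>t\<in>Sh_star A. F t = f_star A Ct p K t) \<and> F (word [0]) = cover_log A Ct p K"
  show "F = hyper_ext"
  proof (rule extensionalityI)
    show "F \<in> extensional (Sh A)" using F by blast
    show "hyper_ext \<in> extensional (Sh A)" by (rule ext)
    fix t assume "t \<in> Sh A"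
    then show "F t = hyper_ext t"
    proof (rule Sh_algebra_morphism_unique[OF _ hyper_ext_morphism zero_in_A, rotated 3])
      show "Sh_algebra_morphism A Ct p F" using F by blast
      show "F t = hyper_ext t" if "t \<in> Sh_star A" for t
        using F that f_star_eq[OF inv that] by simp
      show "F (word [0]) = hyper_ext (word [0])" using F log by simp
    qed
  qed
qed

text \<open>The shuffle relations turn products into sums, so the linear span of the hyperlogarithms
  is already closed under multiplication.\<close>

lemma generated_subalgebra_hyper: "generated_subalgebra Ct p (hyper ` lists A) = hyper_ext ` Sh A"
  unfolding generated_subalgebra_def
proof (rule hull_unique)
  show "hyper ` lists A \<subseteq> hyper_ext ` Sh A"
    using hyper_ext_word word_in_Sh by (metis image_subsetI rev_image_eqI)
  show "hol_subalgebra Ct p (hyper_ext ` Sh A)"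
    by (rule hol_subalgebra_morphism_image[OF hyper_ext_morphism])
  fix B assume B: "hyper ` lists A \<subseteq> B" "hol_subalgebra Ct p B"
  show "hyper_ext ` Sh A \<subseteq> B"
  proof
    fix f assume "f \<in> hyper_ext ` Sh A"
    then obtain t where t: "t \<in> Sh A" "f = hyper_ext t" by blast
    have "(\<lambda>y. \<Sum>w\<in>Poly_Mapping.keys t. Poly_Mapping.lookup t w * hyper w y) \<in> B"
    proof (rule hol_subalgebra_sum[OF B(2)])
      fix w assume "w \<in> Poly_Mapping.keys t"
      then have "w \<in> lists A" using t(1) unfolding Sh_def by blast
      then show "hyper w \<in> B" using B(1) by blast
    qed
    then show "f \<in> B" using t by (simp add: hyper_ext_def linear_extension_def)
  qed
qed

lemma hyper_in_span_Jw:
  assumes w: "w \<in> lists A" and x: "x \<in> Ct"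
  shows "\<exists>s\<in>Sh A. \<forall>y. hyper w y = linear_extension (\<lambda>v. Jw x v y) s"
proof (intro bexI allI)
  let ?s = "\<Sum>k\<le>length w. scale_comb (hyper (take k w) x) (word (drop k w))"
  show "hyper w y = linear_extension (\<lambda>v. Jw x v y) ?s" for y
    by (simp add: hyper_path_composition[OF w x, of y] linear_extension_sum linear_extension_scale)
  show "?s \<in> Sh A" using w by (intro Sh_sum Sh_scale word_in_Sh take_drop_lists)
qed

text \<open>Inversion of the unitriangular composition formula, by induction on the length of the
  word.\<close>

lemma Jw_in_span_hyper:
  assumes "w \<in> lists A" and x: "x \<in> Ct"
  shows "\<exists>s\<in>Sh A. \<forall>y. Jw x w y = linear_extension (\<lambda>v. hyper v y) s"
  using assms(1)
proof (induction "length w" arbitrary: w rule: less_induct)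
  case less
  have "\<exists>s\<in>Sh A. \<forall>y. Jw x (drop k w) y = linear_extension (\<lambda>v. hyper v y) s" if "k \<in> {1..length w}" for k
    using that less by (intro less.hyps take_drop_lists) auto
  then obtain s where s: "\<And>k. k \<in> {1..length w} \<Longrightarrow> s k \<in> Sh A"
      "\<And>k y. k \<in> {1..length w} \<Longrightarrow> Jw x (drop k w) y = linear_extension (\<lambda>v. hyper v y) (s k)"
    by metis
  let ?s = "word w + (\<Sum>k\<in>{1..length w}. scale_comb (- hyper (take k w) x) (s k))"
  have "?s \<in> Sh A" using less.prems by (intro Sh_add Sh_sum Sh_scale word_in_Sh s(1))
  moreover have "Jw x w y = linear_extension (\<lambda>v. hyper v y) ?s" for y
  proof -
    have "(\<Sum>k\<in>{1..length w}. hyper (take k w) x * Jw x (drop k w) y) =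
        (\<Sum>k\<in>{1..length w}. hyper (take k w) x * linear_extension (\<lambda>v. hyper v y) (s k))"
      by (intro sum.cong refl) (simp only: s(2))
    then show ?thesis
      unfolding Jw_eq_hyper[OF less.prems x] linear_extension_add linear_extension_sum linear_extension_scale
      by (simp add: sum_negf)
  qed
  ultimately show ?case by blast
qed

text \<open>The right side does not mention x, so independence of the base point is part of the
  result.\<close>

lemma H_sigma0_eq:
  assumes x: "x \<in> Ct"
  shows "H_sigma0 A Ct p x = hyper_ext ` Sh A"
proof -
  have "H_sigma0 A Ct p x = (\<lambda>t y. linear_extension (\<lambda>w. Jw x w y) t) ` Sh A"
    unfolding H_sigma0_def image_image by (intro image_cong refl I_map_sigma0 x)
  also have "\<dots> = (\<lambda>t y. linear_extension (\<lambda>w. hyper w y) t) ` Sh A"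
  proof (intro equalityI subsetI)
    fix f assume "f \<in> (\<lambda>t y. linear_extension (\<lambda>w. Jw x w y) t) ` Sh A"
    then obtain t where t: "t \<in> Sh A" "f = (\<lambda>y. linear_extension (\<lambda>w. Jw x w y) t)" by blast
    then obtain s where "s \<in> Sh A" "f = (\<lambda>y. linear_extension (\<lambda>w. hyper w y) s)"
      using linear_extension_span[of A "\<lambda>w. Jw x w" hyper t] Jw_in_span_hyper[OF _ x] by blast
    then show "f \<in> (\<lambda>t y. linear_extension (\<lambda>w. hyper w y) t) ` Sh A" by blast
  next
    fix f assume "f \<in> (\<lambda>t y. linear_extension (\<lambda>w. hyper w y) t) ` Sh A"
    then obtain t where t: "t \<in> Sh A" "f = (\<lambda>y. linear_extension (\<lambda>w. hyper w y) t)" by blast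
    then obtain s where "s \<in> Sh A" "f = (\<lambda>y. linear_extension (\<lambda>w. Jw x w y) s)"
      using linear_extension_span[of A hyper "\<lambda>w. Jw x w" t] hyper_in_span_Jw[OF _ x] by blast
    then show "f \<in> (\<lambda>t y. linear_extension (\<lambda>w. Jw x w y) t) ` Sh A" by blast
  qed
  also have "\<dots> = hyper_ext ` Sh A"
    by (intro image_cong refl) (simp add: hyper_ext_def)
  finally show ?thesis .
qed

end

theorem proposition2p19:
  fixes S :: "proj_line set"
    and Ct :: "'a::topological_space set"
    and p :: "'a \<Rightarrow> complex"
    and \<delta> :: real
    and K :: "'a set"
    and x\<^sub>0 :: 'a
  assumes "finite S" and "Some 0 \<in> S" and "None \<in> S"
    and "universal_cover Ct p (curve (finite_points S))"
    and "\<delta> > 0" and "open_segment_0 \<delta> \<subseteq> curve (finite_points S)"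
    and "K \<in> components (Ct \<inter> p -` open_segment_0 \<delta>)"
    and "x\<^sub>0 \<in> Ct"
  shows "hol_subalgebra Ct p (f_tilde (finite_points S) Ct p K ` Sh (finite_points S)) \<and>
         f_tilde (finite_points S) Ct p K ` Sh (finite_points S) =
         generated_subalgebra Ct p {hyperlog (finite_points S) Ct p K w |w. w \<in> lists (finite_points S)} \<and>
         generated_subalgebra Ct p {hyperlog (finite_points S) Ct p K w |w. w \<in> lists (finite_points S)} =
         H_sigma0 (finite_points S) Ct p x\<^sub>0"
proof -
  let ?A = "finite_points S"
  have "Some ` ?A \<subseteq> S" by (auto simp: finite_points_def)
  then have "finite (Some ` ?A)" using assms(1) by (rule finite_subset)
  then have "finite ?A" by (rule finite_imageD) simp
  with assms(4) interpret punctured_plane_cover ?A Ct p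
    by (rule punctured_plane_cover.intro[rotated])
  \<comment> \<open>The component is replaced by its parametrization, which supplies the data of the
    tangential base point.\<close>
  obtain q where q: "continuous_on {0<..<\<delta>} q" "K = q ` {0<..<\<delta>}" "K \<subseteq> Ct"
      "\<And>s. s \<in> {0<..<\<delta>} \<Longrightarrow> p (q s) = of_real s"
      "\<And>s. s \<in> {0<..<\<delta>} \<Longrightarrow> inv_into K p (of_real s) = q s"
    using component_section[OF assms(6,7)] by blast
  interpret tangential_base_point ?A Ct p \<delta> q
    by unfold_locales (use assms(2,5,6) q in \<open>auto simp: finite_points_def\<close>)
  have f: "f_tilde ?A Ct p K = hyper_ext" using f_tilde_eq[OF q(2,5)] .
  have "{hyperlog ?A Ct p K w |w. w \<in> lists ?A} = hyper ` lists ?A"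
    unfolding hyperlog_def f using hyper_ext_word by force
  then show ?thesis
    using hol_subalgebra_morphism_image[OF hyper_ext_morphism] generated_subalgebra_hyper
      H_sigma0_eq[OF assms(8)] by (simp add: f)
qed

end
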